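(* Let $G$ be a symmetry group of a holomorphic, eventually contracting iterated function scheme (IFS), let $V:\phi(D)\to\mathbb{C}$ be a holomorphic, bounded function which is $G$-invariant, and let $\mathcal{L}_V$ be the associated transfer operator. Then for every integer $n\ge1$ and every irreducible unitary character $\chi\in\hat G$ (of dimension $d_\chi$), the operator $(\mathcal{L}_V^\chi)^n$ is trace class and its trace is given by $$\mathrm{Tr}_{B^\chi}\left[(\mathcal{L}_V^\chi)^n\right]=\frac{d_\chi}{|G|}\sum_{g\in G}\chi(g)\sum_{w\in\mathcal{W}_n^g}\frac{V_w(gu_{w,g})}{1-(\phi_w\circ g)'(u_{w,g})},$$ where $u_{w,g}$ is the unique fixed point satisfying $u_{w,g}=\phi_w(gu_{w,g})$, and $V_w(u)=\prod_{k=1}^nV(\phi_{w_{0,k}}(u))$.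
   Context: A holomorphic IFS consists of $N$ open disks $D_1,\dots,D_N\subset\mathbb{C}$ with pairwise disjoint closures, an adjacency matrix $A\in\{0,1\}^{N\times N}$ defining the relation $i\rightsquigarrow j$ iff $A_{i,j}=1$, and for each $i\rightsquigarrow j$ a biholomorphic map $\phi_{i,j}:D_i\to\phi_{i,j}(D_i)\Subset D_j$ (image relatively compact in $D_j$), such that $\phi_{i,j}(D_i)\cap\phi_{k,l}(D_k)\ne\emptyset$ iff $(i,j)=(k,l)$. Put $D=\bigcup_i D_i$ and $\phi(D)=\bigcup_{i\rightsquigarrow j}\phi_{i,j}(D_i)$. Words of length $n\ge1$: $\mathcal{W}_n=\{(w_0,\dots,w_n): w_i\rightsquigarrow w_{i+1},\ 0\le i\le n-1\}$. For $w\in\mathcal{W}_n$, $w_{0,k}=(w_0,\dots,w_k)$ and $\phi_w=\phi_{w_{n-1},w_n}\circ\cdots\circ\phi_{w_0,w_1}:D_{w_0}\to D_{w_n}$. The IFS is eventually contracting if there are $N_0\in\mathbb{N}$ and $\theta<1$ with $|\phi_w'(u)|\le\theta$ for all $n\ge N_0$, $w\in\mathcal{W}_n$, $u\in D_{w_0}$. A symmetry group of the IFS is a finite group $G$ acting on $D$ by holomorphic maps such that for each $g\in G$ and $i\rightsquigarrow j$ there is a pair $k\rightsquigarrow l$ with $g\phi_{i,j}(u)=\phi_{k,l}(gu)$ for $u\in D_i$. Each $g$ permutes the disks; one writes $gi:=j$ if $g(D_i)=D_j$, so $G$ acts on the symbols. For $g\in G$, $\mathcal{W}_n^g=\{w\in\mathcal{W}_n: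 gw_n=w_0\}$. $\mathcal{B}(D)$ is the Bergman space of holomorphic functions on $D$ lying in $L^2(D)$ (Lebesgue measure). The transfer operator on $\mathcal{B}(D)$ is $(\mathcal{L}_Vf)(u)=\sum_{j:\,i\rightsquigarrow j}V(\phi_{i,j}(u))f(\phi_{i,j}(u))$ for $u\in D_i$. $V$ is $G$-invariant if $V(gu)=V(u)$ for all $g\in G$, $u\in\phi(D)$ (the set $\phi(D)$ is $G$-invariant). $\hat G$ is the set of equivalence classes of irreducible unitary representations of $G$, identified with their characters. $G$ acts on $\mathcal{B}(D)$ by $(gf)(u)=f(g^{-1}u)$; $P_\chi=\frac{d_\chi}{|G|}\sum_{g\in G}\overline{\chi(g)}\,g$ and $B^\chi=P_\chi\mathcal{B}(D)$. For $G$-invariant $V$, $\mathcal{L}_V$ preserves $B^\chi$, and $\mathcal{L}_V^\chi:=\mathcal{L}_V|_{B^\chi}:B^\chi\to B^\chi$. *)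

theory Defs
  imports "HOL-Complex_Analysis.Complex_Analysis" "HOL-Algebra.Group_Action"
begin

section \<open>Holomorphic iterated function schemes\<close>

text \<open>The disks are indexed by \<open>{1..ifs_size S}\<close>; the values of the fields at other indices are
  irrelevant, and so are the values of \<open>branch S i j\<close> outside \<open>disk S i\<close>.\<close>

record ifs =
  ifs_size :: nat
  disk :: "nat \<Rightarrow> complex set"
  adj :: "nat \<Rightarrow> nat \<Rightarrow> nat"
  branch :: "nat \<Rightarrow> nat \<Rightarrow> complex \<Rightarrow> complex"

definition ifs_rel :: "ifs \<Rightarrow> nat \<Rightarrow> nat \<Rightarrow> bool" where
  "ifs_rel S i j \<longleftrightarrow> i \<in> {1..ifs_size S} \<and> j \<in> {1..ifs_size S} \<and> adj S i j = 1"

definition ifs_domain :: "ifs \<Rightarrow> complex set" where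
  "ifs_domain S = (\<Union>i\<in>{1..ifs_size S}. disk S i)"

definition ifs_image :: "ifs \<Rightarrow> complex set" where
  "ifs_image S = (\<Union>(i, j)\<in>{(i, j). ifs_rel S i j}. branch S i j ` disk S i)"

definition biholomorphic_between :: "(complex \<Rightarrow> complex) \<Rightarrow> complex set \<Rightarrow> complex set \<Rightarrow> bool" where
  "biholomorphic_between f U W \<longleftrightarrow>
     f holomorphic_on U \<and> bij_betw f U W \<and> inv_into U f holomorphic_on W"

definition relatively_compact_in :: "complex set \<Rightarrow> complex set \<Rightarrow> bool" where
  "relatively_compact_in K U \<longleftrightarrow> compact (closure K) \<and> closure K \<subseteq> U"

definition holomorphic_ifs :: "ifs \<Rightarrow> bool" where
  "holomorphic_ifs S \<longleftrightarrow>
     (\<forall>i\<in>{1..ifs_size S}. \<exists>c r. r > 0 \<and> disk S i = ball c r) \<and>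
     (\<forall>i\<in>{1..ifs_size S}. \<forall>j\<in>{1..ifs_size S}.
        i \<noteq> j \<longrightarrow> closure (disk S i) \<inter> closure (disk S j) = {}) \<and>
     (\<forall>i\<in>{1..ifs_size S}. \<forall>j\<in>{1..ifs_size S}. adj S i j \<in> {0, 1}) \<and>
     (\<forall>i j. ifs_rel S i j \<longrightarrow>
        biholomorphic_between (branch S i j) (disk S i) (branch S i j ` disk S i) \<and>
        relatively_compact_in (branch S i j ` disk S i) (disk S j)) \<and>
     (\<forall>i j k l. ifs_rel S i j \<longrightarrow> ifs_rel S k l \<longrightarrow>
        (branch S i j ` disk S i \<inter> branch S k l ` disk S k \<noteq> {} \<longleftrightarrow> (i, j) = (k, l)))"

text \<open>A word \<open>(w\<^sub>0, \<dots>, w\<^sub>n)\<close> of length \<open>n\<close> is a list with \<open>n + 1\<close> entries.\<close>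

definition words :: "ifs \<Rightarrow> nat \<Rightarrow> nat list set" where
  "words S n = {w. length w = n + 1 \<and> set w \<subseteq> {1..ifs_size S} \<and>
                   (\<forall>i<n. ifs_rel S (w ! i) (w ! (i + 1)))}"

fun word_map :: "ifs \<Rightarrow> nat list \<Rightarrow> complex \<Rightarrow> complex" where
  "word_map S [] = id"
| "word_map S [i] = id"
| "word_map S (i # j # w) = word_map S (j # w) \<circ> branch S i j"

text \<open>\<open>take (k + 1) w\<close> is the initial subword \<open>(w\<^sub>0, \<dots>, w\<^sub>k)\<close>.\<close>

definition word_weight :: "ifs \<Rightarrow> (complex \<Rightarrow> complex) \<Rightarrow> nat list \<Rightarrow> complex \<Rightarrow> complex" where
  "word_weight S V w u = (\<Prod>k=1..length w - 1. V (word_map S (take (k + 1) w) u))"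

definition eventually_contracting :: "ifs \<Rightarrow> bool" where
  "eventually_contracting S \<longleftrightarrow>
     (\<exists>(N\<^sub>0::nat) (\<theta>::real). \<theta> < 1 \<and>
        (\<forall>n\<ge>N\<^sub>0. \<forall>w\<in>words S n. \<forall>u\<in>disk S (w ! 0). cmod (deriv (word_map S w) u) \<le> \<theta>))"


section \<open>Symmetry groups\<close>

text \<open>The clause \<open>act g u \<in> disk S k\<close> makes explicit that \<open>branch S k l (act g u)\<close> has to be
  defined; \<open>branch S k l\<close> is only meaningful on \<open>disk S k\<close>.\<close>

definition symmetry_group ::
  "ifs \<Rightarrow> ('g, 'm) monoid_scheme \<Rightarrow> ('g \<Rightarrow> complex \<Rightarrow> complex) \<Rightarrow> bool" where
  "symmetry_group S G act \<longleftrightarrow>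
     group_action G (ifs_domain S) act \<and> finite (carrier G) \<and>
     (\<forall>g\<in>carrier G. act g holomorphic_on ifs_domain S) \<and>
     (\<forall>g\<in>carrier G. \<forall>i j. ifs_rel S i j \<longrightarrow>
        (\<exists>k l. ifs_rel S k l \<and>
           (\<forall>u\<in>disk S i. act g u \<in> disk S k \<and> act g (branch S i j u) = branch S k l (act g u))))"

definition symbol_act :: "ifs \<Rightarrow> ('g \<Rightarrow> complex \<Rightarrow> complex) \<Rightarrow> 'g \<Rightarrow> nat \<Rightarrow> nat" where
  "symbol_act S act g i = (THE j. j \<in> {1..ifs_size S} \<and> act g ` disk S i = disk S j)"

definition twisted_words ::
  "ifs \<Rightarrow> ('g \<Rightarrow> complex \<Rightarrow> complex) \<Rightarrow> nat \<Rightarrow> 'g \<Rightarrow> nat list set" where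
  "twisted_words S act n g = {w \<in> words S n. symbol_act S act g (w ! n) = w ! 0}"

text \<open>For \<open>w \<in> twisted_words S act n g\<close>, the map \<open>word_map S w \<circ> act g\<close> is defined on
  \<open>disk S (w ! n)\<close> and maps this disk into itself.\<close>

definition is_twisted_fixpoint ::
  "ifs \<Rightarrow> ('g \<Rightarrow> complex \<Rightarrow> complex) \<Rightarrow> nat list \<Rightarrow> 'g \<Rightarrow> complex \<Rightarrow> bool" where
  "is_twisted_fixpoint S act w g u \<longleftrightarrow> u \<in> disk S (last w) \<and> u = word_map S w (act g u)"

definition twisted_fixpoint ::
  "ifs \<Rightarrow> ('g \<Rightarrow> complex \<Rightarrow> complex) \<Rightarrow> nat list \<Rightarrow> 'g \<Rightarrow> complex" where
  "twisted_fixpoint S act w g = (THE u. is_twisted_fixpoint S act w g u)"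


section \<open>Irreducible unitary representations\<close>

definition hermitian_conjugate :: "complex^'n^'n \<Rightarrow> complex^'n^'n" where
  "hermitian_conjugate M = (\<chi> i j. cnj (M $ j $ i))"

definition unitary_matrix :: "complex^'n^'n \<Rightarrow> bool" where
  "unitary_matrix M \<longleftrightarrow>
     hermitian_conjugate M ** M = mat 1 \<and> M ** hermitian_conjugate M = mat 1"

definition unitary_rep :: "('g, 'm) monoid_scheme \<Rightarrow> ('g \<Rightarrow> complex^'n^'n) \<Rightarrow> bool" where
  "unitary_rep G \<rho> \<longleftrightarrow>
     (\<forall>g\<in>carrier G. unitary_matrix (\<rho> g)) \<and> \<rho> \<one>\<^bsub>G\<^esub> = mat 1 \<and>
     (\<forall>g\<in>carrier G. \<forall>h\<in>carrier G. \<rho> (g \<otimes>\<^bsub>G\<^esub> h) = \<rho> g ** \<rho> h)"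

text \<open>\<open>vec.subspace\<close> refers to complex-linear subspaces. The dimension \<open>CARD('n)\<close> is positive, so
  the zero representation is excluded.\<close>

definition irreducible_unitary_rep ::
  "('g, 'm) monoid_scheme \<Rightarrow> ('g \<Rightarrow> complex^'n^'n) \<Rightarrow> bool" where
  "irreducible_unitary_rep G \<rho> \<longleftrightarrow>
     unitary_rep G \<rho> \<and>
     (\<forall>U. vec.subspace U \<and> (\<forall>g\<in>carrier G. \<forall>x\<in>U. \<rho> g *v x \<in> U) \<longrightarrow> U = {0} \<or> U = UNIV)"

definition character :: "('g \<Rightarrow> complex^'n^'n) \<Rightarrow> 'g \<Rightarrow> complex" where
  "character \<rho> g = trace (\<rho> g)"


section \<open>The Bergman space, the transfer operator and the isotypic subspaces\<close>

text \<open>Functions on \<open>D\<close> are represented by functions on the whole plane that vanish outside \<open>D\<close>,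
  so that equality of elements of the Bergman space is equality on \<open>D\<close>.\<close>

definition bergman_space :: "complex set \<Rightarrow> (complex \<Rightarrow> complex) set" where
  "bergman_space D = {f. f holomorphic_on D \<and> (\<forall>u. u \<notin> D \<longrightarrow> f u = 0) \<and>
                         set_integrable lborel D (\<lambda>u. (cmod (f u))\<^sup>2)}"

definition bergman_inner ::
  "complex set \<Rightarrow> (complex \<Rightarrow> complex) \<Rightarrow> (complex \<Rightarrow> complex) \<Rightarrow> complex" where
  "bergman_inner D f h = set_lebesgue_integral lborel D (\<lambda>u. f u * cnj (h u))"

text \<open>The disks are disjoint, so at \<open>u \<in> disk S i\<close> the sum runs over the \<open>j\<close> with
  \<open>ifs_rel S i j\<close>; outside the domain of the scheme it is empty.\<close>

definition transfer_op ::
  "ifs \<Rightarrow> (complex \<Rightarrow> complex) \<Rightarrow> (complex \<Rightarrow> complex) \<Rightarrow> complex \<Rightarrow> complex" where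
  "transfer_op S V f u =
     (\<Sum>(i, j)\<in>{(i, j). ifs_rel S i j \<and> u \<in> disk S i}. V (branch S i j u) * f (branch S i j u))"

definition invariant_potential ::
  "ifs \<Rightarrow> ('g, 'm) monoid_scheme \<Rightarrow> ('g \<Rightarrow> complex \<Rightarrow> complex) \<Rightarrow> (complex \<Rightarrow> complex) \<Rightarrow> bool" where
  "invariant_potential S G act V \<longleftrightarrow> (\<forall>g\<in>carrier G. \<forall>u\<in>ifs_image S. V (act g u) = V u)"

definition act_on_functions ::
  "ifs \<Rightarrow> ('g, 'm) monoid_scheme \<Rightarrow> ('g \<Rightarrow> complex \<Rightarrow> complex) \<Rightarrow> 'g \<Rightarrow>
     (complex \<Rightarrow> complex) \<Rightarrow> complex \<Rightarrow> complex" where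
  "act_on_functions S G act g f u = (if u \<in> ifs_domain S then f (act (inv\<^bsub>G\<^esub> g) u) else 0)"

definition isotypic_proj ::
  "ifs \<Rightarrow> ('g, 'm) monoid_scheme \<Rightarrow> ('g \<Rightarrow> complex \<Rightarrow> complex) \<Rightarrow> ('g \<Rightarrow> complex^'n^'n) \<Rightarrow>
     (complex \<Rightarrow> complex) \<Rightarrow> complex \<Rightarrow> complex" where
  "isotypic_proj S G act \<rho> f u =
     of_nat CARD('n) / of_nat (card (carrier G)) *
       (\<Sum>g\<in>carrier G. cnj (character \<rho> g) * act_on_functions S G act g f u)"

definition isotypic_space ::
  "ifs \<Rightarrow> ('g, 'm) monoid_scheme \<Rightarrow> ('g \<Rightarrow> complex \<Rightarrow> complex) \<Rightarrow> ('g \<Rightarrow> complex^'n^'n) \<Rightarrow>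
     (complex \<Rightarrow> complex) set" where
  "isotypic_space S G act \<rho> = isotypic_proj S G act \<rho> ` bergman_space (ifs_domain S)"

definition reduced_transfer_op ::
  "ifs \<Rightarrow> ('g, 'm) monoid_scheme \<Rightarrow> ('g \<Rightarrow> complex \<Rightarrow> complex) \<Rightarrow> ('g \<Rightarrow> complex^'n^'n) \<Rightarrow>
     (complex \<Rightarrow> complex) \<Rightarrow> (complex \<Rightarrow> complex) \<Rightarrow> complex \<Rightarrow> complex" where
  "reduced_transfer_op S G act \<rho> V = restrict (transfer_op S V) (isotypic_space S G act \<rho>)"


section \<open>Trace class operators\<close>

text \<open>A Hilbert space is given by a set \<open>H\<close> of complex functions, closed under pointwise linear
  combinations, and an inner product \<open>ip\<close> on it, linear in the first argument. Only the values of an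
  operator on \<open>H\<close> matter.\<close>

type_synonym cfun = "complex \<Rightarrow> complex"

definition bounded_op_on :: "(cfun \<Rightarrow> cfun \<Rightarrow> complex) \<Rightarrow> cfun set \<Rightarrow> (cfun \<Rightarrow> cfun) \<Rightarrow> bool" where
  "bounded_op_on ip H T \<longleftrightarrow>
     (\<forall>f\<in>H. T f \<in> H) \<and>
     (\<forall>f\<in>H. \<forall>h\<in>H. \<forall>a b. T (\<lambda>u. a * f u + b * h u) = (\<lambda>u. a * T f u + b * T h u)) \<and>
     (\<exists>C. \<forall>f\<in>H. sqrt (Re (ip (T f) (T f))) \<le> C * sqrt (Re (ip f f)))"

definition orthonormal_basis_of :: "(cfun \<Rightarrow> cfun \<Rightarrow> complex) \<Rightarrow> cfun set \<Rightarrow> cfun set \<Rightarrow> bool" where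
  "orthonormal_basis_of ip H E \<longleftrightarrow>
     E \<subseteq> H \<and> (\<forall>e\<in>E. \<forall>e'\<in>E. ip e e' = (if e = e' then 1 else 0)) \<and>
     (\<forall>f\<in>H. (\<forall>e\<in>E. ip f e = 0) \<longrightarrow> f = (\<lambda>_. 0))"

text \<open>\<open>P\<close> is the absolute value \<open>\<bar>T\<bar>\<close>, that is, the positive square root of \<open>T\<^sup>*T\<close>; the last clause is
  \<open>P\<^sup>2 = T\<^sup>*T\<close> with the adjoint moved to the other side of the inner product.\<close>

definition is_abs_op_on ::
  "(cfun \<Rightarrow> cfun \<Rightarrow> complex) \<Rightarrow> cfun set \<Rightarrow> (cfun \<Rightarrow> cfun) \<Rightarrow> (cfun \<Rightarrow> cfun) \<Rightarrow> bool" where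
  "is_abs_op_on ip H T P \<longleftrightarrow>
     bounded_op_on ip H P \<and>
     (\<forall>f\<in>H. Im (ip (P f) f) = 0 \<and> 0 \<le> Re (ip (P f) f)) \<and>
     (\<forall>f\<in>H. \<forall>h\<in>H. ip (P (P f)) h = ip (T f) (T h))"

definition trace_class_on :: "(cfun \<Rightarrow> cfun \<Rightarrow> complex) \<Rightarrow> cfun set \<Rightarrow> (cfun \<Rightarrow> cfun) \<Rightarrow> bool" where
  "trace_class_on ip H T \<longleftrightarrow>
     bounded_op_on ip H T \<and>
     (\<exists>P E. is_abs_op_on ip H T P \<and> orthonormal_basis_of ip H E \<and>
            (\<lambda>e. ip (P e) e) summable_on E)"

text \<open>The common value of \<open>\<Sum>e. \<langle>T e, e\<rangle>\<close> over all orthonormal bases.\<close>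

definition trace_on :: "(cfun \<Rightarrow> cfun \<Rightarrow> complex) \<Rightarrow> cfun set \<Rightarrow> (cfun \<Rightarrow> cfun) \<Rightarrow> complex" where
  "trace_on ip H T =
     (THE t. \<forall>E. orthonormal_basis_of ip H E \<longrightarrow> ((\<lambda>e. ip (T e) e) has_sum t) E)"

end

(* The functions on D split into power series on the individual disks, so L^n f is the absolutely
   convergent sum, over the words w and the exponents k, of the k-th Taylor coefficient of f at the
   centre of the last disk of w times V_w (phi_w - centre)^k. Applying P_chi to the second factors
   exhibits the restriction of L^n to B^chi as a nuclear operator. For a nuclear operator T on a
   Hilbert space an orthonormal basis of eigenvectors of T*T exists; it yields the absolute value
   and shows that T is trace class, and the trace over any orthonormal basis is the nuclear trace.
   Expanding P_chi, the nuclear trace becomes a sum over group elements g and words w of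
   sum_k [z^k] psi Phi^k with psi = V_w o g and Phi = phi_w o g. This vanishes unless g maps the last
   disk of w to the first one. In that case Phi maps the disk strictly into itself, has exactly one
   fixed point u by Rouche's theorem, and the sum is the residue psi(u) / (1 - Phi'(u)). *)
theory Submission
  imports Defs
    "HOL-Library.Function_Algebras"
    "HOL-Library.Diagonal_Subsequence"
    "HOL-Computational_Algebra.Fundamental_Theorem_Algebra"
begin

unbundle no fps_syntax

section \<open>Area integrals of holomorphic functions\<close>

text \<open>The group acts by composition, with no Jacobian factor, so it is in general not unitary
  on the Bergman space: \<open>isotypic_proj\<close> is idempotent but need not be an orthogonal
  projection, and an orthonormal basis of the full space need not split along the isotypic spaces.
  Hence the trace is taken on each isotypic space separately, through a quantity that does not refer
  to a basis. That the action preserves square integrability at all needs bounded derivatives of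
  isomorphisms between disks; this is where the Schwarz lemma enters. The other analytic input is
  the boundedness of point evaluations. Norm convergence then implies locally uniform convergence,
  which gives completeness, closedness of the isotypic spaces under pointwise limits, and Cauchy
  estimates for the Taylor functionals. Summability comes from two radii about the centre of the
  last disk of a word: the word map stays within the smaller one, Cauchy's estimate uses the larger
  one, and their quotient is the ratio of a geometric series.\<close>

lemma lborel_complex_eq_distr:
  "(lborel :: complex measure) = distr (lborel :: (real^2) measure) borel (\<lambda>v. Complex (v $ 1) (v $ 2))"
proof (rule lborel_eqI)
  fix l u :: complex
  assume le: "\<And>b. b \<in> Basis \<Longrightarrow> l \<bullet> b \<le> u \<bullet> b"
  have m: "(\<lambda>v::real^2. Complex (v $ 1) (v $ 2)) \<in> borel_measurable borel"
    by (intro borel_measurable_continuous_onI) (auto simp: Complex_eq intro!: continuous_intros)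
  have pre: "(\<lambda>v::real^2. Complex (v $ 1) (v $ 2)) -` box l u = box (vector [Re l, Im l]) (vector [Re u, Im u])"
    by (auto simp: mem_box_cart forall_2 in_box_complex_iff)
  have lu: "Re l \<le> Re u" "Im l \<le> Im u"
    using le[of 1] le[of \<i>] by (auto simp: Basis_complex_def)
  have B: "(Basis :: (real^2) set) = {axis 1 1, axis 2 1}"
    by (auto simp: Basis_vec_def UNIV_2)
  have ne: "(axis 1 1 :: real^2) \<noteq> axis 2 1" by (simp add: axis_eq_axis)
  have "emeasure (distr lborel borel (\<lambda>v::real^2. Complex (v $ 1) (v $ 2))) (box l u)
     = emeasure lborel (box (vector [Re l, Im l] :: real^2) (vector [Re u, Im u]))"
    using m by (subst emeasure_distr) (auto simp: pre)
  also have "\<dots> = ennreal ((Re u - Re l) * (Im u - Im l))"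
    using lu ne by (subst emeasure_lborel_box) (auto simp: B inner_axis algebra_simps)
  also have "\<dots> = ennreal (\<Prod>b\<in>Basis. (u - l) \<bullet> b)"
    by (simp add: Basis_complex_def)
  finally show "emeasure (distr lborel borel (\<lambda>v::real^2. Complex (v $ 1) (v $ 2))) (box l u)
     = ennreal (\<Prod>b\<in>Basis. (u - l) \<bullet> b)" .
qed simp

text \<open>Multiplication by \<open>deriv h z\<close>, seen as a real 2x2 matrix, has the squared
  modulus of the derivative as determinant, so areas grow at most by the factor \<open>B\<close>
  squared. Only an upper bound is claimed, so overlaps in the image do no harm.\<close>

lemma emeasure_holomorphic_image_le:
  fixes h :: "complex \<Rightarrow> complex"
  assumes "open U" "h holomorphic_on U" "A \<in> sets borel" "A \<subseteq> U" "bounded A"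
    and bd: "\<And>z. z \<in> U \<Longrightarrow> cmod (deriv h z) \<le> B"
    and "h ` A \<in> sets borel"
  shows "emeasure lborel (h ` A) \<le> ennreal (B\<^sup>2) * emeasure lborel A"
proof -
  \<comment> \<open>\<open>j\<close> identifies \<open>real^2\<close> with the plane and preserves
    area by \<open>lborel_complex_eq_distr\<close>; \<open>k\<close> is its inverse. The Jacobian
    estimate is applied to \<open>k \<circ> h \<circ> j\<close>.\<close>
  define j where "j = (\<lambda>v::real^2. Complex (v $ 1) (v $ 2))"
  define k where "k = (\<lambda>z. vector [Re z, Im z] :: real^2)"
  have jk [simp]: "j (k z) = z" for z by (simp add: j_def k_def)
  have kj [simp]: "k (j v) = v" for v by (simp add: j_def k_def vec_eq_iff forall_2)
  have jm [measurable]: "j \<in> borel_measurable borel" unfolding j_def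
    by (intro borel_measurable_continuous_onI) (auto simp: Complex_eq intro!: continuous_intros)
  have linj: "bounded_linear j" unfolding j_def
    by (rule linear_conv_bounded_linear[THEN iffD1], rule linearI) (auto simp: complex_eq_iff)
  have link: "bounded_linear k"
  proof (rule linear_conv_bounded_linear[THEN iffD1], rule linearI)
    show "k (x + y) = k x + k y" for x y unfolding k_def vec_eq_iff forall_2 by simp
    show "k (r *\<^sub>R x) = r *\<^sub>R k x" for r x unfolding k_def vec_eq_iff forall_2 by simp
  qed
  have em: "emeasure lborel X = emeasure lborel (j -` X)" if "X \<in> sets borel" for X
  proof -
    have "emeasure lborel X = emeasure (distr (lborel :: (real^2) measure) borel j) X"
      unfolding j_def by (subst lborel_complex_eq_distr) (rule refl)
    also have "\<dots> = emeasure lborel (j -` X)"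
      using that by (subst emeasure_distr) auto
    finally show ?thesis .
  qed
  have vim: "j -` X = k ` X" for X
    unfolding set_eq_iff vimage_eq image_iff by (metis jk kj)
  define S where "S = j -` A"
  have Sb: "S \<in> sets borel" unfolding S_def using measurable_sets[OF jm assms(3)] by simp
  have "S = k ` A" by (simp add: S_def vim)
  then have "bounded S" using link \<open>bounded A\<close> by (simp add: bounded_linear_image)
  then have Sl: "S \<in> lmeasurable" using Sb by (simp add: bounded_set_imp_lmeasurable)
  define f where "f = k \<circ> h \<circ> j"
  define f' where "f' = (\<lambda>v. k \<circ> ((*) (deriv h (j v))) \<circ> j)"
  have der: "(f has_derivative f' v) (at v within S)" if "v \<in> S" for v
  proof -
    have "j v \<in> U" using that assms S_def by auto
    then have "(h has_field_derivative deriv h (j v)) (at (j v))"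
      using assms holomorphic_derivI by blast
    then have "(h has_derivative (*) (deriv h (j v))) (at (j v))"
      by (simp add: has_field_derivative_def)
    moreover have "(j has_derivative j) (at v)" "\<And>z. (k has_derivative k) (at z)"
      using linj link by (auto intro: bounded_linear_imp_has_derivative)
    ultimately have "(f has_derivative f' v) (at v)" unfolding f_def f'_def
      by (metis comp_assoc diff_chain_at)
    then show ?thesis using has_derivative_at_withinI by blast
  qed
  have det: "det (matrix (f' v)) = (cmod (deriv h (j v)))\<^sup>2" for v
  proof -
    have "det (matrix (f' v)) = (Re (deriv h (j v)))\<^sup>2 + (Im (deriv h (j v)))\<^sup>2"
      by (simp add: det_2 matrix_def f'_def k_def j_def axis_def power2_eq_square)
    then show ?thesis by (simp add: cmod_power2)
  qed
  have ba: "\<bar>det (matrix (f' v))\<bar> \<le> B\<^sup>2" if "v \<in> S" for v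
  proof -
    have "j v \<in> U" using that assms S_def by auto
    then show ?thesis using bd by (simp add: det power_mono)
  qed
  have int: "(\<lambda>v. \<bar>det (matrix (f' v))\<bar>) integrable_on S"
  proof (rule measurable_bounded_by_integrable_imp_integrable)
    have "continuous_on U (deriv h)" using assms holomorphic_deriv holomorphic_on_imp_continuous_on by blast
    then have "continuous_on S (\<lambda>v. \<bar>det (matrix (f' v))\<bar>)" unfolding det
      by (intro continuous_intros continuous_on_compose2[OF \<open>continuous_on U (deriv h)\<close>]
            linear_continuous_on linj) (use assms S_def in auto)
    then show "(\<lambda>v. \<bar>det (matrix (f' v))\<bar>) \<in> borel_measurable (lebesgue_on S)"
      using Sl by (simp add: continuous_imp_measurable_on_sets_lebesgue fmeasurableD)
    show "(\<lambda>v. B\<^sup>2) integrable_on S" using Sl integrable_on_const by blast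
    show "S \<in> sets lebesgue" using Sl by auto
  qed (use ba in auto)
  have fS: "f ` S = j -` (h ` A)"
  proof -
    have "f ` S = k ` h ` A" using \<open>S = k ` A\<close> by (simp add: f_def image_image)
    then show ?thesis by (simp add: vim)
  qed
  have fl: "f ` S \<in> lmeasurable" and fm: "measure lebesgue (f ` S) \<le> B\<^sup>2 * measure lebesgue S"
    using measurable_bounded_differentiable_image[OF Sl der int ba]
      measure_bounded_differentiable_image[OF Sl der int ba] by auto
  have fb: "f ` S \<in> sets borel" unfolding fS using measurable_sets[OF jm assms(7)] by simp
  have "emeasure lborel (h ` A) = emeasure lebesgue (f ` S)"
    using em[OF assms(7)] fb by (simp add: fS)
  also have "\<dots> = ennreal (measure lebesgue (f ` S))" using fl by (simp add: emeasure_eq_measure2)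
  also have "\<dots> \<le> ennreal (B\<^sup>2 * measure lebesgue S)" using fm by (simp add: ennreal_leI)
  also have "\<dots> = ennreal (B\<^sup>2) * emeasure lebesgue S"
    using Sl by (simp add: emeasure_eq_measure2 ennreal_mult)
  also have "emeasure lebesgue S = emeasure lborel A" using Sb em[OF assms(3)] by (simp add: S_def)
  finally show ?thesis .
qed

text \<open>Area on \<open>W\<close>, pushed forward by \<open>k\<close>, assigns to
  \<open>A\<close> the area of the \<open>h\<close>-image of \<open>A \<inter> U\<close>, which is
  at most \<open>B\<close> squared times the area of \<open>A \<inter> U\<close>. The claim thus
  reduces to an inequality between two measures \<open>M\<close> and \<open>N\<close>.\<close>

lemma nn_integral_holomorphic_substitution_le:
  fixes h k :: "complex \<Rightarrow> complex"
  assumes "open U" "bounded U" "open W" and holh: "h holomorphic_on U" and holk: "k holomorphic_on W"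
    and hU: "h ` U \<subseteq> W" and kW: "k ` W \<subseteq> U" and kh: "\<And>z. z \<in> U \<Longrightarrow> k (h z) = z" and hk: "\<And>z. z \<in> W \<Longrightarrow> h (k z) = z"
    and bd: "\<And>z. z \<in> U \<Longrightarrow> cmod (deriv h z) \<le> B"
    and F: "F \<in> borel_measurable borel"
  shows "(\<integral>\<^sup>+v\<in>W. F (k v) \<partial>lborel) \<le> ennreal (B\<^sup>2) * (\<integral>\<^sup>+u\<in>U. F u \<partial>lborel)"
proof -
  have [measurable]: "U \<in> sets borel" "W \<in> sets borel" "F \<in> borel_measurable borel" using assms by auto
  have km: "k \<in> measurable (restrict_space lborel W) borel"
    using holk \<open>open W\<close> by (metis borel_measurable_continuous_on_restrict holomorphic_on_imp_continuous_on
       measurable_cong_sets restrict_space_sets_cong sets_lborel)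
  define M where "M = distr (restrict_space lborel W) borel k"
  define N where "N = density lborel (\<lambda>u. ennreal (B\<^sup>2) * indicator U u)"
  have "(\<integral>\<^sup>+v\<in>W. F (k v) \<partial>lborel) = (\<integral>\<^sup>+v. F (k v) \<partial>restrict_space lborel W)"
    by (subst nn_integral_restrict_space) auto
  also have "\<dots> = (\<integral>\<^sup>+u. F u \<partial>M)" unfolding M_def using km by (subst nn_integral_distr) auto
  also have "\<dots> \<le> (\<integral>\<^sup>+u. F u \<partial>N)"
  proof (rule nn_integral_mono_measure)
    show MN: "sets M = sets N" by (simp add: M_def N_def)
    have "emeasure M A \<le> emeasure N A" for A
    proof (cases "A \<in> sets borel")
      case False
      then show ?thesis by (simp add: M_def N_def emeasure_notin_sets)
    next
      case A: True
      have eq: "k -` A \<inter> W = h ` (A \<inter> U)" using hU kW kh hk by force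
      have "k -` A \<inter> space (restrict_space lborel W) \<in> sets (restrict_space lborel W)"
        using km A by (rule measurable_sets)
      then have s: "k -` A \<inter> W \<in> sets lborel"
        using sets_restrict_space_iff[of W lborel] by (simp add: space_restrict_space)
      have "emeasure M A = emeasure (restrict_space lborel W) (k -` A \<inter> W)"
        unfolding M_def using km A by (subst emeasure_distr) (auto simp: space_restrict_space)
      also have "\<dots> = emeasure lborel (h ` (A \<inter> U))"
        using hU by (subst emeasure_restrict_space) (auto simp: eq)
      also have "\<dots> \<le> ennreal (B\<^sup>2) * emeasure lborel (A \<inter> U)"
        using A s eq \<open>bounded U\<close> by (intro emeasure_holomorphic_image_le[OF \<open>open U\<close> holh _ _ _ bd]) (auto intro: bounded_subset)
      also have "\<dots> = emeasure N A"
      proof -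
        have "emeasure N A = (\<integral>\<^sup>+u. ennreal (B\<^sup>2) * indicator (A \<inter> U) u \<partial>lborel)"
          unfolding N_def using A
          by (subst emeasure_density) (auto intro!: nn_integral_cong simp: indicator_def)
        also have "\<dots> = ennreal (B\<^sup>2) * emeasure lborel (A \<inter> U)"
          using A by (subst nn_integral_cmult_indicator) auto
        finally show "ennreal (B\<^sup>2) * emeasure lborel (A \<inter> U) = emeasure N A" by simp
      qed
      finally show ?thesis .
    qed
    then show "M \<le> N" by (simp add: le_measure[OF MN])
  qed
  also have "\<dots> = ennreal (B\<^sup>2) * (\<integral>\<^sup>+u\<in>U. F u \<partial>lborel)"
  proof -
    have "(\<integral>\<^sup>+u. F u \<partial>N) = (\<integral>\<^sup>+u. ennreal (B\<^sup>2) * (F u * indicator U u) \<partial>lborel)"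
      unfolding N_def by (subst nn_integral_density) (auto intro!: nn_integral_cong simp: mult_ac)
    also have "\<dots> = ennreal (B\<^sup>2) * (\<integral>\<^sup>+u\<in>U. F u \<partial>lborel)"
      by (subst nn_integral_cmult) auto
    finally show "(\<integral>\<^sup>+u. F u \<partial>N) = ennreal (B\<^sup>2) * (\<integral>\<^sup>+u\<in>U. F u \<partial>lborel)" .
  qed
  finally show ?thesis .
qed

text \<open>Cauchy's formula at the centre is the mean value property on the unit circle.
  Nonnegative integrals are used so that Tonelli's theorem applies to the bound later.\<close>

lemma circle_mean_norm_le:
  assumes "g holomorphic_on cball 0 1"
  shows "ennreal (2 * pi * cmod (g 0)) \<le> (\<integral>\<^sup>+t\<in>{0..2*pi}. ennreal (cmod (g (cis t))) \<partial>lborel)"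
proof -
  have "((\<lambda>u. g u / (u - 0)) has_contour_integral (2 * of_real pi * \<i> * g 0)) (circlepath 0 1)"
    by (rule Cauchy_integral_circlepath_simple) (use assms in auto)
  then have "((\<lambda>t. g (cis t) / cis t * \<i> * cis t) has_integral (2 * of_real pi * \<i> * g 0)) {0..2*pi}"
    unfolding circlepath_def by (subst (asm) has_contour_integral_part_circlepath_iff) auto
  then have "((\<lambda>t. \<i> * g (cis t)) has_integral (\<i> * (2 * of_real pi * g 0))) {0..2*pi}"
    by (rule has_integral_eq_rhs[OF has_integral_eq[rotated]]) auto
  then have hi: "((\<lambda>t. g (cis t)) has_integral (2 * of_real pi * g 0)) {0..2*pi}"
    by (drule_tac c = "-\<i>" in has_integral_mult_right) (simp add: mult.assoc[symmetric])
  have "continuous_on (cball 0 1) g" using assms holomorphic_on_imp_continuous_on by blast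
  then have "continuous_on {0..2*pi} (\<lambda>t. g (cis t))"
    by (rule continuous_on_compose2) (auto intro!: continuous_intros)
  then have si: "set_integrable lborel {0..2*pi} (\<lambda>t. g (cis t))"
    by (rule borel_integrable_atLeastAtMost')
  then have "2 * of_real pi * g 0 = (LINT t:{0..2*pi}|lborel. g (cis t))"
    using hi set_borel_integral_eq_integral(2) integral_unique by metis
  then have "2 * pi * cmod (g 0) = norm (LINT t:{0..2*pi}|lborel. g (cis t))"
    by (metis abs_of_nonneg norm_mult norm_numeral norm_of_real pi_ge_zero)
  also have "ennreal \<dots> \<le> (\<integral>\<^sup>+t. norm (indicator {0..2*pi} t *\<^sub>R g (cis t)) \<partial>lborel)"
    using si unfolding set_integrable_def set_lebesgue_integral_def by (rule integral_norm_bound_ennreal)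
  also have "\<dots> = (\<integral>\<^sup>+t\<in>{0..2*pi}. ennreal (cmod (g (cis t))) \<partial>lborel)"
    by (intro nn_integral_cong) (auto simp: indicator_def)
  finally show ?thesis .
qed

text \<open>Integrate the mean value inequality for \<open>f\<^sup>2\<close> on the circle through \<open>w\<close> over all \<open>w\<close> in the
  ball; rotations do not increase area integrals.\<close>

lemma holomorphic_power2_norm_le_nn_integral_ball:
  assumes "f holomorphic_on ball z \<delta>"
  shows "emeasure lborel (ball z \<delta>) * ennreal ((cmod (f z))\<^sup>2) \<le> (\<integral>\<^sup>+w\<in>ball z \<delta>. ennreal ((cmod (f w))\<^sup>2) \<partial>lborel)"
proof -
  \<comment> \<open>Cutting off at the ball makes the integrand Borel on the whole plane, as the
    rotation estimate and the exchange of integrals both require.\<close>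
  define F where "F = (\<lambda>w. indicator (ball z \<delta>) w * ennreal ((cmod (f w))\<^sup>2))"
  have cf: "continuous_on (ball z \<delta>) f" using assms holomorphic_on_imp_continuous_on by blast
  have "(\<lambda>w. indicator (ball z \<delta>) w *\<^sub>R (cmod (f w))\<^sup>2) \<in> borel_measurable borel"
    by (intro borel_measurable_continuous_on_indicator continuous_intros cf) auto
  then have "(\<lambda>w. ennreal (indicator (ball z \<delta>) w *\<^sub>R (cmod (f w))\<^sup>2)) \<in> borel_measurable borel"
    by measurable
  also have "(\<lambda>w. ennreal (indicator (ball z \<delta>) w *\<^sub>R (cmod (f w))\<^sup>2)) = F"
    by (auto simp: F_def indicator_def)
  finally have Fm [measurable]: "F \<in> borel_measurable borel" .
  define r where "r = (\<lambda>t w. z + cis t * (w - z))"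
  have [measurable]: "ball z \<delta> \<in> sets borel" by simp
  have rm [measurable]: "(\<lambda>(w, t). r t w) \<in> borel_measurable (borel \<Otimes>\<^sub>M borel)"
    unfolding r_def borel_prod by (intro borel_measurable_continuous_onI) (auto simp: case_prod_beta intro!: continuous_intros)
  have rb: "r t w \<in> ball z \<delta> \<longleftrightarrow> w \<in> ball z \<delta>" for t w
    by (simp add: r_def dist_norm norm_mult norm_minus_commute)
  have rot: "(\<integral>\<^sup>+w\<in>ball z \<delta>. F (r t w) \<partial>lborel) \<le> (\<integral>\<^sup>+w\<in>ball z \<delta>. F w \<partial>lborel)" for t
  proof -
    have inv: "r t (r (-t) w) = w" "r (-t) (r t w) = w" for w
      by (simp_all add: r_def mult.assoc[symmetric] cis_mult)
    have "(\<integral>\<^sup>+w\<in>ball z \<delta>. F (r t w) \<partial>lborel) \<le> ennreal (1\<^sup>2) * (\<integral>\<^sup>+w\<in>ball z \<delta>. F w \<partial>lborel)"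
    proof (rule nn_integral_holomorphic_substitution_le[where h = "r (-t)"])
      show "cmod (deriv (r (- t)) w) \<le> 1" for w
      proof -
        have "(r (-t) has_field_derivative cis (-t)) (at w)"
          unfolding r_def by (auto intro!: derivative_eq_intros)
        then show ?thesis by (simp add: DERIV_imp_deriv)
      qed
      show "r (- t) holomorphic_on ball z \<delta>" "r t holomorphic_on ball z \<delta>"
        unfolding r_def by (auto intro!: holomorphic_intros)
    qed (use rb inv in auto)
    then show ?thesis by simp
  qed
  have mean: "ennreal (2 * pi) * ennreal ((cmod (f z))\<^sup>2) \<le> (\<integral>\<^sup>+t\<in>{0..2*pi}. F (r t w) \<partial>lborel)" if w: "w \<in> ball z \<delta>" for w
  proof -
    define g where "g = (\<lambda>u. (f (z + u * (w - z)))\<^sup>2)"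
    have "z + u * (w - z) \<in> ball z \<delta>" if "u \<in> cball 0 1" for u
    proof -
      have "cmod (u * (w - z)) \<le> 1 * cmod (w - z)" unfolding norm_mult using that by (intro mult_right_mono) auto
      then show ?thesis using w by (simp add: dist_norm norm_minus_commute)
    qed
    then have "g holomorphic_on cball 0 1" unfolding g_def
      by (intro holomorphic_intros holomorphic_on_compose_gen[OF _ assms, unfolded o_def]) auto
    then have "ennreal (2 * pi * cmod (g 0)) \<le> (\<integral>\<^sup>+t\<in>{0..2*pi}. ennreal (cmod (g (cis t))) \<partial>lborel)"
      by (rule circle_mean_norm_le)
    also have "\<dots> = (\<integral>\<^sup>+t\<in>{0..2*pi}. F (r t w) \<partial>lborel)"
    proof -
      have "F (r t w) = ennreal (cmod (g (cis t)))" for t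
        using rb[of t w] w unfolding F_def by (simp add: g_def r_def norm_power)
      then show ?thesis by simp
    qed
    finally show ?thesis by (simp add: g_def norm_power ennreal_mult)
  qed
  have "ennreal (2 * pi) * (emeasure lborel (ball z \<delta>) * ennreal ((cmod (f z))\<^sup>2))
     = (\<integral>\<^sup>+w. (ennreal (2 * pi) * ennreal ((cmod (f z))\<^sup>2)) * indicator (ball z \<delta>) w \<partial>lborel)"
    by (subst nn_integral_cmult_indicator) (auto simp: mult_ac)
  also have "\<dots> \<le> (\<integral>\<^sup>+w. (\<integral>\<^sup>+t. F (r t w) * indicator {0..2*pi} t * indicator (ball z \<delta>) w \<partial>lborel) \<partial>lborel)"
  proof (rule nn_integral_mono)
    fix w
    show "(ennreal (2 * pi) * ennreal ((cmod (f z))\<^sup>2)) * indicator (ball z \<delta>) w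
      \<le> (\<integral>\<^sup>+t. F (r t w) * indicator {0..2*pi} t * indicator (ball z \<delta>) w \<partial>lborel)"
      using mean[of w] by (cases "w \<in> ball z \<delta>") simp_all
  qed
  also have "\<dots> = (\<integral>\<^sup>+t. (\<integral>\<^sup>+w. F (r t w) * indicator {0..2*pi} t * indicator (ball z \<delta>) w \<partial>lborel) \<partial>lborel)"
  proof (rule lborel_pair.Fubini'[symmetric])
    have "(\<lambda>p. F ((\<lambda>(w, t). r t w) p) * indicator {0..2*pi} (snd p) * indicator (ball z \<delta>) (fst p)) \<in> borel_measurable (borel \<Otimes>\<^sub>M borel)"
      by measurable
    then show "(\<lambda>(w, t). F (r t w) * indicator {0..2*pi} t * indicator (ball z \<delta>) w) \<in> borel_measurable (lborel \<Otimes>\<^sub>M lborel)"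
      unfolding case_prod_beta
      by (subst measurable_cong_sets[OF sets_pair_measure_cong[OF sets_lborel sets_lborel] refl])
  qed
  also have "\<dots> \<le> (\<integral>\<^sup>+t. (\<integral>\<^sup>+w\<in>ball z \<delta>. F w \<partial>lborel) * indicator {0..2*pi} t \<partial>lborel)"
  proof (rule nn_integral_mono)
    fix t
    show "(\<integral>\<^sup>+w. F (r t w) * indicator {0..2*pi} t * indicator (ball z \<delta>) w \<partial>lborel)
      \<le> (\<integral>\<^sup>+w\<in>ball z \<delta>. F w \<partial>lborel) * indicator {0..2*pi} t"
      using rot[of t] by (cases "t \<in> {0..2*pi}") simp_all
  qed
  also have "\<dots> = ennreal (2 * pi) * (\<integral>\<^sup>+w\<in>ball z \<delta>. F w \<partial>lborel)"
    by (subst nn_integral_cmult_indicator) (auto simp: mult.commute)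
  finally have "emeasure lborel (ball z \<delta>) * ennreal ((cmod (f z))\<^sup>2) \<le> (\<integral>\<^sup>+w\<in>ball z \<delta>. F w \<partial>lborel)"
    by (subst (asm) ennreal_mult_le_mult_iff) auto
  also have "\<dots> = (\<integral>\<^sup>+w\<in>ball z \<delta>. ennreal ((cmod (f w))\<^sup>2) \<partial>lborel)"
    by (intro nn_integral_cong) (auto simp: F_def indicator_def)
  finally show ?thesis .
qed

section \<open>The Bergman space\<close>

lemma holomorphic_indicator_measurable:
  assumes "open D" "f holomorphic_on D"
  shows "(\<lambda>u. indicator D u *\<^sub>R f u) \<in> borel_measurable borel"
  using assms by (intro borel_measurable_continuous_on_indicator holomorphic_on_imp_continuous_on) auto

lemma bergman_space_iff_nn_integral:
  assumes "open D"
  shows "f \<in> bergman_space D \<longleftrightarrow> f holomorphic_on D \<and> (\<forall>u. u \<notin> D \<longrightarrow> f u = 0) \<and>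
    (\<integral>\<^sup>+u\<in>D. ennreal ((cmod (f u))\<^sup>2) \<partial>lborel) < \<infinity>"
proof -
  have "set_integrable lborel D (\<lambda>u. (cmod (f u))\<^sup>2) \<longleftrightarrow> (\<integral>\<^sup>+u\<in>D. ennreal ((cmod (f u))\<^sup>2) \<partial>lborel) < \<infinity>"
    if "f holomorphic_on D"
  proof -
    have "(\<lambda>u. (cmod (indicator D u *\<^sub>R f u))\<^sup>2) \<in> borel_measurable borel"
      using holomorphic_indicator_measurable[OF assms that] by measurable
    also have "(\<lambda>u. (cmod (indicator D u *\<^sub>R f u))\<^sup>2) = (\<lambda>u. indicator D u *\<^sub>R (cmod (f u))\<^sup>2)"
      by (auto simp: indicator_def)
    finally have "(\<lambda>u. indicator D u *\<^sub>R (cmod (f u))\<^sup>2) \<in> borel_measurable borel" .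
    moreover have "(\<integral>\<^sup>+u. ennreal (norm (indicator D u *\<^sub>R (cmod (f u))\<^sup>2)) \<partial>lborel) = (\<integral>\<^sup>+u\<in>D. ennreal ((cmod (f u))\<^sup>2) \<partial>lborel)"
      by (intro nn_integral_cong) (auto simp: indicator_def)
    ultimately show ?thesis by (simp add: set_integrable_def integrable_iff_bounded)
  qed
  then show ?thesis unfolding bergman_space_def by auto
qed

lemma bergman_space_holomorphic: "f \<in> bergman_space D \<Longrightarrow> f holomorphic_on D"
  by (simp add: bergman_space_def)

lemma bergman_space_integrable_mult:
  assumes "open D" "f \<in> bergman_space D" "h \<in> bergman_space D"
  shows "set_integrable lborel D (\<lambda>u. f u * cnj (h u))"
proof -
  have f: "set_integrable lborel D (\<lambda>u. (cmod (f u))\<^sup>2)" and h: "set_integrable lborel D (\<lambda>u. (cmod (h u))\<^sup>2)"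
    using assms by (auto simp: bergman_space_def)
  have *: "set_integrable lborel D (\<lambda>u. (cmod (f u))\<^sup>2 + (cmod (h u))\<^sup>2)"
    using f h by (rule set_integral_add)
  show ?thesis
  proof (rule set_integrable_bound[OF *])
    show "AE u in lborel. u \<in> D \<longrightarrow> norm (f u * cnj (h u)) \<le> norm ((cmod (f u))\<^sup>2 + (cmod (h u))\<^sup>2)"
    proof (intro AE_I2 impI)
      fix u
      have "0 \<le> (cmod (f u) - cmod (h u))\<^sup>2" by simp
      then have "2 * (cmod (f u) * cmod (h u)) \<le> (cmod (f u))\<^sup>2 + (cmod (h u))\<^sup>2"
        by (simp add: power2_diff)
      moreover have "0 \<le> cmod (f u) * cmod (h u)" by simp
      ultimately have "cmod (f u) * cmod (h u) \<le> (cmod (f u))\<^sup>2 + (cmod (h u))\<^sup>2" by linarith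
      then show "norm (f u * cnj (h u)) \<le> norm ((cmod (f u))\<^sup>2 + (cmod (h u))\<^sup>2)"
        by (simp add: norm_mult)
    qed
    have "(\<lambda>u. indicator D u *\<^sub>R (f u * cnj (h u))) \<in> borel_measurable borel"
      using assms by (intro borel_measurable_continuous_on_indicator continuous_intros holomorphic_on_imp_continuous_on bergman_space_holomorphic) auto
    then show "set_borel_measurable lborel D (\<lambda>u. f u * cnj (h u))"
      by (simp add: set_borel_measurable_def)
  qed
qed

lemma bergman_inner_same:
  "bergman_inner D f f = of_real (LINT u:D|lborel. (cmod (f u))\<^sup>2)"
proof -
  have "bergman_inner D f f = (LINT u|lborel. of_real (indicator D u *\<^sub>R (cmod (f u))\<^sup>2))"
    unfolding bergman_inner_def set_lebesgue_integral_def
    by (intro Bochner_Integration.integral_cong) (auto simp: indicator_def complex_mult_cnj cmod_power2 complex_eq_iff)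
  then show ?thesis unfolding set_lebesgue_integral_def by (simp only: integral_complex_of_real)
qed

lemma bergman_inner_same_ge_0: "0 \<le> Re (bergman_inner D f f)"
  unfolding bergman_inner_same set_lebesgue_integral_def
  by (simp add: integral_nonneg_AE)

lemma ennreal_bergman_inner_same:
  assumes "open D" "f \<in> bergman_space D"
  shows "ennreal (Re (bergman_inner D f f)) = (\<integral>\<^sup>+u\<in>D. ennreal ((cmod (f u))\<^sup>2) \<partial>lborel)"
proof -
  have "integrable lborel (\<lambda>u. indicator D u *\<^sub>R (cmod (f u))\<^sup>2)"
    using assms by (simp add: bergman_space_def set_integrable_def)
  then have "(\<integral>\<^sup>+u. ennreal (indicator D u *\<^sub>R (cmod (f u))\<^sup>2) \<partial>lborel) = ennreal (LINT u|lborel. indicator D u *\<^sub>R (cmod (f u))\<^sup>2)"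
    by (rule nn_integral_eq_integral) auto
  moreover have "(\<integral>\<^sup>+u. ennreal (indicator D u *\<^sub>R (cmod (f u))\<^sup>2) \<partial>lborel) = (\<integral>\<^sup>+u\<in>D. ennreal ((cmod (f u))\<^sup>2) \<partial>lborel)"
    by (intro nn_integral_cong) (auto simp: indicator_def)
  ultimately show ?thesis by (simp add: bergman_inner_same set_lebesgue_integral_def)
qed

lemma bergman_space_lincomb:
  assumes "open D" "f \<in> bergman_space D" "h \<in> bergman_space D"
  shows "(\<lambda>u. a * f u + b * h u) \<in> bergman_space D"
proof -
  have f: "set_integrable lborel D (\<lambda>u. (cmod (f u))\<^sup>2)" and h: "set_integrable lborel D (\<lambda>u. (cmod (h u))\<^sup>2)"
    using assms by (auto simp: bergman_space_def)
  have *: "set_integrable lborel D (\<lambda>u. (2 * (cmod a)\<^sup>2) * (cmod (f u))\<^sup>2 + (2 * (cmod b)\<^sup>2) * (cmod (h u))\<^sup>2)"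
    using f h by (intro set_integral_add(1) set_integrable_mult_right) auto
  have "set_integrable lborel D (\<lambda>u. (cmod (a * f u + b * h u))\<^sup>2)"
  proof (rule set_integrable_bound[OF *])
    show "AE u in lborel. u \<in> D \<longrightarrow> norm ((cmod (a * f u + b * h u))\<^sup>2)
        \<le> norm ((2 * (cmod a)\<^sup>2) * (cmod (f u))\<^sup>2 + (2 * (cmod b)\<^sup>2) * (cmod (h u))\<^sup>2)"
    proof (intro AE_I2 impI)
      fix u
      have "0 \<le> (cmod (a * f u) - cmod (b * h u))\<^sup>2" by simp
      moreover have "(cmod (a * f u + b * h u))\<^sup>2 \<le> (cmod (a * f u) + cmod (b * h u))\<^sup>2"
        by (intro power_mono norm_triangle_ineq) auto
      ultimately have "(cmod (a * f u + b * h u))\<^sup>2 \<le> 2 * (cmod (a * f u))\<^sup>2 + 2 * (cmod (b * h u))\<^sup>2"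
        by (simp add: power2_diff power2_sum)
      then show "norm ((cmod (a * f u + b * h u))\<^sup>2)
        \<le> norm ((2 * (cmod a)\<^sup>2) * (cmod (f u))\<^sup>2 + (2 * (cmod b)\<^sup>2) * (cmod (h u))\<^sup>2)"
        by (simp add: norm_mult power_mult_distrib mult.assoc)
    qed
    have "(\<lambda>u. indicator D u *\<^sub>R ((cmod (a * f u + b * h u))\<^sup>2)) \<in> borel_measurable borel"
      using assms by (intro borel_measurable_continuous_on_indicator continuous_intros holomorphic_on_imp_continuous_on bergman_space_holomorphic) auto
    then show "set_borel_measurable lborel D (\<lambda>u. (cmod (a * f u + b * h u))\<^sup>2)"
      by (simp add: set_borel_measurable_def)
  qed
  then show ?thesis using assms unfolding bergman_space_def by (auto intro!: holomorphic_intros)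
qed

lemma bergman_inner_lincomb:
  assumes "open D" "f \<in> bergman_space D" "h \<in> bergman_space D" "k \<in> bergman_space D"
  shows "bergman_inner D (\<lambda>u. a * f u + b * h u) k = a * bergman_inner D f k + b * bergman_inner D h k"
proof -
  note i = bergman_space_integrable_mult[OF assms(1) assms(2,4)] bergman_space_integrable_mult[OF assms(1) assms(3,4)]
  have "bergman_inner D (\<lambda>u. a * f u + b * h u) k = (LINT u:D|lborel. a * (f u * cnj (k u)) + b * (h u * cnj (k u)))"
    unfolding bergman_inner_def by (simp add: algebra_simps)
  also have "\<dots> = a * bergman_inner D f k + b * bergman_inner D h k"
    using i by (subst set_integral_add(2)) (auto simp: bergman_inner_def)
  finally show ?thesis .
qed

lemma bergman_inner_cnj: "bergman_inner D h f = cnj (bergman_inner D f h)"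
proof -
  have "cnj (bergman_inner D f h) = (LINT u|lborel. cnj (indicator D u *\<^sub>R (f u * cnj (h u))))"
    unfolding bergman_inner_def set_lebesgue_integral_def by (rule Bochner_Integration.integral_cnj[symmetric])
  also have "\<dots> = bergman_inner D h f"
    unfolding bergman_inner_def set_lebesgue_integral_def
    by (intro Bochner_Integration.integral_cong) (auto simp: mult.commute)
  finally show ?thesis by simp
qed

text \<open>A compact \<open>K\<close> leaves room for balls of one common radius inside
  \<open>D\<close>; the mean value estimate for the squared modulus on such a ball, of area
  \<open>m\<close>, gives the constant \<open>1 / sqrt m\<close>. Completeness and the bounds on
  Taylor coefficients rest on this.\<close>

lemma bergman_point_evaluation_bound:
  assumes "open D" "compact K" "K \<subseteq> D"
  obtains C where "C \<ge> 0" "\<And>f z. f \<in> bergman_space D \<Longrightarrow> z \<in> K \<Longrightarrow> cmod (f z) \<le> C * sqrt (Re (bergman_inner D f f))"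
proof -
  obtain \<delta> where "\<delta> > 0" "(\<Union>z\<in>K. ball z \<delta>) \<subseteq> D"
    using compact_subset_open_imp_ball_epsilon_subset[OF assms(2,1,3)] by metis
  then have \<delta>: "\<delta> > 0" "\<And>z. z \<in> K \<Longrightarrow> ball z \<delta> \<subseteq> D" by auto
  define m where "m = measure lborel (ball (0::complex) \<delta>)"
  have m: "measure lborel (ball z \<delta>) = m" for z :: complex
    unfolding m_def using \<delta>(1) by (simp add: content_ball)
  have m0: "m > 0" unfolding m_def using \<delta>(1) by simp
  have "cmod (f z) \<le> 1 / sqrt m * sqrt (Re (bergman_inner D f f))" if f: "f \<in> bergman_space D" and z: "z \<in> K" for f z
  proof -
    have "ennreal (m * (cmod (f z))\<^sup>2) = emeasure lborel (ball z \<delta>) * ennreal ((cmod (f z))\<^sup>2)"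
    proof -
      have "emeasure lborel (ball z \<delta>) = ennreal (measure lborel (ball z \<delta>))"
        using emeasure_bounded_finite[of "ball z \<delta>"] by (intro emeasure_eq_ennreal_measure) auto
      then show ?thesis using m0 by (simp add: m ennreal_mult)
    qed
    also have "\<dots> \<le> (\<integral>\<^sup>+w\<in>ball z \<delta>. ennreal ((cmod (f w))\<^sup>2) \<partial>lborel)"
      using bergman_space_holomorphic[OF f] \<delta>(2)[OF z]
      by (intro holomorphic_power2_norm_le_nn_integral_ball) (auto intro: holomorphic_on_subset)
    also have "\<dots> \<le> (\<integral>\<^sup>+w\<in>D. ennreal ((cmod (f w))\<^sup>2) \<partial>lborel)"
      using \<delta>(2)[OF z] by (intro nn_set_integral_set_mono) auto
    also have "\<dots> = ennreal (Re (bergman_inner D f f))"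
      using ennreal_bergman_inner_same[OF assms(1) f] by simp
    finally have "m * (cmod (f z))\<^sup>2 \<le> Re (bergman_inner D f f)"
      using bergman_inner_same_ge_0 by (simp add: ennreal_le_iff)
    then have "sqrt (m * (cmod (f z))\<^sup>2) \<le> sqrt (Re (bergman_inner D f f))" by simp
    then show ?thesis using m0 by (simp add: real_sqrt_mult field_simps)
  qed
  then show ?thesis using m0 that[of "1 / sqrt m"] by simp
qed

text \<open>Members are functions vanishing off \<open>D\<close> and not classes modulo null sets,
  so definiteness comes from the bound on point evaluations.\<close>

lemma bergman_inner_same_eq_0:
  assumes "open D" "f \<in> bergman_space D" "Re (bergman_inner D f f) = 0"
  shows "f = (\<lambda>_. 0)"
proof
  fix u show "f u = 0"
  proof (cases "u \<in> D")
    case True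
    obtain C where "\<And>f z. f \<in> bergman_space D \<Longrightarrow> z \<in> {u} \<Longrightarrow> cmod (f z) \<le> C * sqrt (Re (bergman_inner D f f))"
      by (rule bergman_point_evaluation_bound[OF assms(1), of "{u}"]) (use True in auto)
    from this[OF assms(2), of u] show ?thesis by (simp add: assms(3))
  qed (use assms in \<open>auto simp: bergman_space_def\<close>)
qed

text \<open>Bounded point evaluations make a norm Cauchy sequence converge locally uniformly, so the
  limit is holomorphic; Fatou's lemma then controls the norm of the difference. Pointwise
  convergence is part of the conclusion because closedness of the isotypic spaces is checked with
  it.\<close>

lemma bergman_space_complete:
  assumes "open D" and X: "\<And>n. X n \<in> bergman_space D"
    and Cauchy: "\<And>e. e > 0 \<Longrightarrow> \<exists>M. \<forall>m\<ge>M. \<forall>n\<ge>M. Re (bergman_inner D (\<lambda>u. X m u - X n u) (\<lambda>u. X m u - X n u)) < e"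
  obtains f where "f \<in> bergman_space D" "\<And>u. (\<lambda>n. X n u) \<longlonglongrightarrow> f u"
    "(\<lambda>n. Re (bergman_inner D (\<lambda>u. X n u - f u) (\<lambda>u. X n u - f u))) \<longlonglongrightarrow> 0"
proof -
  have diff: "(\<lambda>u. g u - h u) \<in> bergman_space D" if "g \<in> bergman_space D" "h \<in> bergman_space D" for g h
    using bergman_space_lincomb[OF assms(1) that, of 1 "-1"] by simp
  have unif: "uniformly_Cauchy_on K X" if K: "compact K" "K \<subseteq> D" for K
  proof (rule uniformly_Cauchy_onI)
    fix e :: real assume "e > 0"
    obtain C where C: "C \<ge> 0" "\<And>f z. f \<in> bergman_space D \<Longrightarrow> z \<in> K \<Longrightarrow> cmod (f z) \<le> C * sqrt (Re (bergman_inner D f f))"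
      using bergman_point_evaluation_bound[OF assms(1) K] by metis
    have "(e / (C + 1))\<^sup>2 > 0" using \<open>e > 0\<close> C by simp
    then obtain M where M: "\<forall>m\<ge>M. \<forall>n\<ge>M. Re (bergman_inner D (\<lambda>u. X m u - X n u) (\<lambda>u. X m u - X n u)) < (e / (C + 1))\<^sup>2"
      using Cauchy by blast
    show "\<exists>M. \<forall>x\<in>K. \<forall>m\<ge>M. \<forall>n\<ge>M. dist (X m x) (X n x) < e"
    proof (intro exI ballI allI impI)
      fix x m n assume x: "x \<in> K" and mn: "m \<ge> M" "n \<ge> M"
      have "dist (X m x) (X n x) \<le> C * sqrt (Re (bergman_inner D (\<lambda>u. X m u - X n u) (\<lambda>u. X m u - X n u)))"
        using C(2)[OF diff[OF X X] x, of m n] by (simp add: dist_norm)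
      also have "\<dots> \<le> C * (e / (C + 1))"
        using M mn C \<open>e > 0\<close> by (intro mult_left_mono real_le_lsqrt) (auto intro: less_imp_le)
      also have "\<dots> < e" using \<open>e > 0\<close> C by (simp add: field_simps)
      finally show "dist (X m x) (X n x) < e" .
    qed
  qed
  define f where "f = (\<lambda>u. lim (\<lambda>n. X n u))"
  have lim: "(\<lambda>n. X n u) \<longlonglongrightarrow> f u" for u
  proof (cases "u \<in> D")
    case True
    then have "uniformly_Cauchy_on {u} X" using unif by simp
    then have "convergent (\<lambda>n. X n u)"
      by (simp add: Cauchy_convergent uniformly_Cauchy_imp_Cauchy)
    then show ?thesis unfolding f_def by (simp add: convergent_LIMSEQ_iff)
  next
    case False
    then have "X n u = 0" for n using X by (auto simp: bergman_space_def)
    then show ?thesis unfolding f_def by simp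
  qed
  have hol: "f holomorphic_on D"
  proof (rule holomorphic_uniform_sequence[OF assms(1)])
    show "X n holomorphic_on D" for n using X bergman_space_holomorphic by blast
    fix x assume "x \<in> D"
    then obtain d where d: "d > 0" "cball x d \<subseteq> D" using assms(1) open_contains_cball by blast
    have "uniformly_convergent_on (cball x d) X"
      using unif[OF compact_cball d(2)] Cauchy_uniformly_convergent by blast
    then obtain l where l: "uniform_limit (cball x d) X l sequentially" by (auto simp: uniformly_convergent_on_def)
    have "l u = f u" if "u \<in> cball x d" for u
      using tendsto_uniform_limitI[OF l that] lim[of u] LIMSEQ_unique by blast
    then have "uniform_limit (cball x d) X f sequentially"
      using l uniform_limit_cong'[of "cball x d" X X l f sequentially] by simp
    then show "\<exists>d>0. cball x d \<subseteq> D \<and> uniform_limit (cball x d) X f sequentially" using d by blast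
  qed
  have zero: "f u = 0" if "u \<notin> D" for u
    using lim[of u] that X by (auto simp: bergman_space_def LIMSEQ_const_iff)
  have fatou: "(\<integral>\<^sup>+u\<in>D. ennreal ((cmod (X n u - f u))\<^sup>2) \<partial>lborel) \<le> ennreal e"
    if "\<forall>m\<ge>M. Re (bergman_inner D (\<lambda>u. X m u - X n u) (\<lambda>u. X m u - X n u)) < e" for n M e
  proof -
    have "(\<integral>\<^sup>+u\<in>D. ennreal ((cmod (X n u - f u))\<^sup>2) \<partial>lborel)
      = (\<integral>\<^sup>+u. liminf (\<lambda>m. ennreal ((cmod (X m u - X n u))\<^sup>2) * indicator D u) \<partial>lborel)"
    proof (rule nn_integral_cong)
      fix u
      have "(\<lambda>m. ennreal ((cmod (X m u - X n u))\<^sup>2) * indicator D u) \<longlonglongrightarrow> ennreal ((cmod (f u - X n u))\<^sup>2) * indicator D u"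
        by (cases "u \<in> D") (auto intro!: tendsto_intros lim)
      then show "ennreal ((cmod (X n u - f u))\<^sup>2) * indicator D u = liminf (\<lambda>m. ennreal ((cmod (X m u - X n u))\<^sup>2) * indicator D u)"
        by (simp add: lim_imp_Liminf norm_minus_commute)
    qed
    also have "\<dots> \<le> liminf (\<lambda>m. \<integral>\<^sup>+u\<in>D. ennreal ((cmod (X m u - X n u))\<^sup>2) \<partial>lborel)"
    proof (rule nn_integral_liminf)
      fix m
      have "(\<lambda>u. ennreal (indicator D u *\<^sub>R (cmod (X m u - X n u))\<^sup>2)) \<in> borel_measurable borel"
        using assms(1) X by (intro measurable_compose[OF _ measurable_ennreal] borel_measurable_continuous_on_indicator continuous_intros holomorphic_on_imp_continuous_on bergman_space_holomorphic) auto
      also have "(\<lambda>u. ennreal (indicator D u *\<^sub>R (cmod (X m u - X n u))\<^sup>2)) = (\<lambda>u. ennreal ((cmod (X m u - X n u))\<^sup>2) * indicator D u)"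
        by (auto simp: indicator_def)
      finally show "(\<lambda>u. ennreal ((cmod (X m u - X n u))\<^sup>2) * indicator D u) \<in> borel_measurable lborel" by simp
    qed
    also have "\<dots> = liminf (\<lambda>m. ennreal (Re (bergman_inner D (\<lambda>u. X m u - X n u) (\<lambda>u. X m u - X n u))))"
      using ennreal_bergman_inner_same[OF assms(1) diff[OF X X]] by simp
    also have "\<dots> \<le> liminf (\<lambda>m. ennreal e)"
    proof (intro Liminf_mono eventually_sequentiallyI[of M])
      fix m assume "m \<ge> M"
      then show "ennreal (Re (bergman_inner D (\<lambda>u. X m u - X n u) (\<lambda>u. X m u - X n u))) \<le> ennreal e"
        using that by (intro ennreal_leI less_imp_le) simp
    qed
    finally show ?thesis by (simp add: Liminf_const)
  qed
  obtain M1 where M1: "\<forall>m\<ge>M1. \<forall>n\<ge>M1. Re (bergman_inner D (\<lambda>u. X m u - X n u) (\<lambda>u. X m u - X n u)) < 1"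
    using Cauchy[of 1] by auto
  have XB: "(\<lambda>u. X n u - f u) \<in> bergman_space D" if "n \<ge> M1" for n
  proof -
    have "(\<integral>\<^sup>+u\<in>D. ennreal ((cmod (X n u - f u))\<^sup>2) \<partial>lborel) < \<infinity>"
      using fatou[of M1 n 1] M1 that by (auto simp: le_less_trans)
    moreover have "(\<lambda>u. X n u - f u) holomorphic_on D"
      using bergman_space_holomorphic[OF X] hol by (rule holomorphic_on_diff)
    moreover have "X n u - f u = 0" if "u \<notin> D" for u
      using zero[OF that] X[of n] that by (simp add: bergman_space_def)
    ultimately show ?thesis unfolding bergman_space_iff_nn_integral[OF assms(1)] by blast
  qed
  \<comment> \<open>Fatou's lemma only places the difference in the space; subtracting it from one
    late term recovers \<open>f\<close>.\<close>
  have "(\<lambda>u. X M1 u - (X M1 u - f u)) \<in> bergman_space D" by (rule diff[OF X XB]) simp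
  then have fB: "f \<in> bergman_space D" by simp
  have "(\<lambda>n. Re (bergman_inner D (\<lambda>u. X n u - f u) (\<lambda>u. X n u - f u))) \<longlonglongrightarrow> 0"
  proof (rule LIMSEQ_I)
    fix e :: real assume "e > 0"
    then obtain M where M: "\<forall>m\<ge>M. \<forall>n\<ge>M. Re (bergman_inner D (\<lambda>u. X m u - X n u) (\<lambda>u. X m u - X n u)) < e / 2"
      using Cauchy[of "e / 2"] by auto
    show "\<exists>no. \<forall>n\<ge>no. norm (Re (bergman_inner D (\<lambda>u. X n u - f u) (\<lambda>u. X n u - f u)) - 0) < e"
    proof (intro exI allI impI)
      fix n assume "n \<ge> M"
      then have "ennreal (Re (bergman_inner D (\<lambda>u. X n u - f u) (\<lambda>u. X n u - f u))) \<le> ennreal (e / 2)"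
        using fatou[of M n "e / 2"] M ennreal_bergman_inner_same[OF assms(1) diff[OF X fB]] by simp
      then show "norm (Re (bergman_inner D (\<lambda>u. X n u - f u) (\<lambda>u. X n u - f u)) - 0) < e"
        using \<open>e > 0\<close> bergman_inner_same_ge_0 by (simp add: ennreal_le_iff)
    qed
  qed
  then show ?thesis using that fB lim by blast
qed

section \<open>Hilbert spaces on a carrier set\<close>

text \<open>The Hilbert space is a subset of an ambient vector space, because
  \<open>isotypic_space\<close> depends on the scheme, the group and the representation; all axioms
  on \<open>ip\<close> are relative to \<open>H\<close>. Completeness is phrased with the squared
  norm since \<open>nrm\<close> is only defined afterwards.\<close>

locale carrier_hilbert = vector_space scale
  for scale :: "complex \<Rightarrow> 'v::ab_group_add \<Rightarrow> 'v" (infixr "*\<^sub>C" 75) +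
  fixes H :: "'v set" and ip :: "'v \<Rightarrow> 'v \<Rightarrow> complex"
  assumes subspace_H: "subspace H"
    and ip_add: "\<lbrakk>x \<in> H; y \<in> H; z \<in> H\<rbrakk> \<Longrightarrow> ip (x + y) z = ip x z + ip y z"
    and ip_scale: "\<lbrakk>x \<in> H; z \<in> H\<rbrakk> \<Longrightarrow> ip (a *\<^sub>C x) z = a * ip x z"
    and ip_cnj: "\<lbrakk>x \<in> H; y \<in> H\<rbrakk> \<Longrightarrow> ip y x = cnj (ip x y)"
    and ip_ge_0: "x \<in> H \<Longrightarrow> 0 \<le> Re (ip x x)"
    and ip_eq_0: "\<lbrakk>x \<in> H; Re (ip x x) = 0\<rbrakk> \<Longrightarrow> x = 0"
    and complete: "\<lbrakk>\<And>n. X n \<in> H; \<And>e. e > 0 \<Longrightarrow> \<exists>M. \<forall>m\<ge>M. \<forall>n\<ge>M. Re (ip (X m - X n) (X m - X n)) < e\<rbrakk>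
       \<Longrightarrow> \<exists>x\<in>H. (\<lambda>n. Re (ip (X n - x) (X n - x))) \<longlonglongrightarrow> 0"
begin

definition nrm :: "'v \<Rightarrow> real" where "nrm x = sqrt (Re (ip x x))"

definition functional :: "('v \<Rightarrow> complex) \<Rightarrow> bool" where
  "functional \<mu> \<longleftrightarrow> (\<forall>x\<in>H. \<forall>y\<in>H. \<mu> (x + y) = \<mu> x + \<mu> y) \<and> (\<forall>a. \<forall>x\<in>H. \<mu> (a *\<^sub>C x) = a * \<mu> x)"

text \<open>An indexed family instead of a set: bases use \<open>id\<close>, while the estimate of
  the singular values needs the family of normalized images of basis vectors.\<close>

definition orthonormal :: "('i \<Rightarrow> 'v) \<Rightarrow> 'i set \<Rightarrow> bool" where
  "orthonormal f F \<longleftrightarrow> f ` F \<subseteq> H \<and> (\<forall>i\<in>F. \<forall>j\<in>F. ip (f i) (f j) = (if i = j then 1 else 0))"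

definition onb :: "'v set \<Rightarrow> bool" where
  "onb E \<longleftrightarrow> orthonormal id E \<and> (\<forall>x\<in>H. (\<forall>e\<in>E. ip x e = 0) \<longrightarrow> x = 0)"

lemma H_add [simp, intro]: "x \<in> H \<Longrightarrow> y \<in> H \<Longrightarrow> x + y \<in> H"
  using subspace_H subspace_add by blast
lemma H_scale [simp, intro]: "x \<in> H \<Longrightarrow> a *\<^sub>C x \<in> H"
  using subspace_H subspace_scale by blast
lemma H_0 [simp, intro]: "0 \<in> H"
  using subspace_H subspace_0 by blast
lemma H_diff [simp, intro]: "x \<in> H \<Longrightarrow> y \<in> H \<Longrightarrow> x - y \<in> H"
  using subspace_H subspace_diff by blast
lemma H_sum [intro]: "(\<And>i. i \<in> F \<Longrightarrow> f i \<in> H) \<Longrightarrow> sum f F \<in> H"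
  using subspace_H subspace_sum by blast

lemma functional_add: "functional \<mu> \<Longrightarrow> x \<in> H \<Longrightarrow> y \<in> H \<Longrightarrow> \<mu> (x + y) = \<mu> x + \<mu> y"
  and functional_scale: "functional \<mu> \<Longrightarrow> x \<in> H \<Longrightarrow> \<mu> (a *\<^sub>C x) = a * \<mu> x"
  by (auto simp: functional_def)

lemma functional_0: "functional \<mu> \<Longrightarrow> \<mu> 0 = 0"
  using functional_scale[of \<mu> 0 0] by simp

lemma functional_diff: "functional \<mu> \<Longrightarrow> x \<in> H \<Longrightarrow> y \<in> H \<Longrightarrow> \<mu> (x - y) = \<mu> x - \<mu> y"
  using functional_add[of \<mu> "x - y" y] by simp

lemma functional_sum:
  assumes "functional \<mu>" "\<And>i. i \<in> F \<Longrightarrow> f i \<in> H"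
  shows "\<mu> (sum f F) = (\<Sum>i\<in>F. \<mu> (f i))"
proof (cases "finite F")
  case True
  then show ?thesis using assms(2)
    by (induction) (auto simp: functional_0[OF assms(1)] functional_add[OF assms(1)] H_sum)
qed (use functional_0[OF assms(1)] in auto)

lemma functional_ip: "z \<in> H \<Longrightarrow> functional (\<lambda>x. ip x z)"
  by (simp add: functional_def ip_add ip_scale)

lemmas ip_diff = functional_diff[OF functional_ip]
lemmas ip_0 = functional_0[OF functional_ip]
lemmas ip_sum = functional_sum[OF functional_ip]

lemma ip_0_right: "x \<in> H \<Longrightarrow> ip x 0 = 0" 
  using ip_cnj[of 0 x] ip_0[of x] by simp
lemma ip_add_right: "\<lbrakk>x \<in> H; y \<in> H; z \<in> H\<rbrakk> \<Longrightarrow> ip z (x + y) = ip z x + ip z y"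
  using ip_cnj[of "x + y" z] ip_cnj[of x z] ip_cnj[of y z] by (simp add: ip_add)
lemma ip_diff_right: "\<lbrakk>x \<in> H; y \<in> H; z \<in> H\<rbrakk> \<Longrightarrow> ip z (x - y) = ip z x - ip z y"
  using ip_cnj[of "x - y" z] ip_cnj[of x z] ip_cnj[of y z] by (simp add: ip_diff)
lemma ip_scale_right: "\<lbrakk>x \<in> H; z \<in> H\<rbrakk> \<Longrightarrow> ip z (a *\<^sub>C x) = cnj a * ip z x"
  using ip_cnj[of "a *\<^sub>C x" z] ip_cnj[of x z] by (simp add: ip_scale)

lemma nrm_ge_0 [simp]: "x \<in> H \<Longrightarrow> 0 \<le> nrm x"
  by (simp add: nrm_def ip_ge_0)

lemma nrm_power2: "x \<in> H \<Longrightarrow> (nrm x)\<^sup>2 = Re (ip x x)"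
  by (simp add: nrm_def ip_ge_0)

lemma ip_same: "x \<in> H \<Longrightarrow> ip x x = of_real ((nrm x)\<^sup>2)"
  using ip_cnj[of x x] by (simp add: nrm_power2 complex_eq_iff)

lemma nrm_eq_0: "x \<in> H \<Longrightarrow> nrm x = 0 \<longleftrightarrow> x = 0"
  using ip_eq_0 nrm_power2 ip_0[of 0] by (auto simp: nrm_def)

lemma nrm_0 [simp]: "nrm 0 = 0"
  by (simp add: nrm_eq_0)

lemma nrm_scale: "x \<in> H \<Longrightarrow> nrm (a *\<^sub>C x) = cmod a * nrm x"
proof -
  assume x: "x \<in> H"
  have "ip (a *\<^sub>C x) (a *\<^sub>C x) = (a * cnj a) * ip x x"
    using x by (simp add: ip_scale ip_scale_right)
  also have "a * cnj a = of_real ((cmod a)\<^sup>2)" by (simp only: complex_norm_square)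
  finally have "Re (ip (a *\<^sub>C x) (a *\<^sub>C x)) = (cmod a)\<^sup>2 * Re (ip x x)" by simp
  then show ?thesis by (simp add: nrm_def real_sqrt_mult)
qed

lemma nrm_add_power2: "x \<in> H \<Longrightarrow> y \<in> H \<Longrightarrow> (nrm (x + y))\<^sup>2 = (nrm x)\<^sup>2 + (nrm y)\<^sup>2 + 2 * Re (ip x y)"
  using ip_cnj[of x y] by (simp add: nrm_power2 ip_add ip_add_right)

lemma nrm_diff_power2: "x \<in> H \<Longrightarrow> y \<in> H \<Longrightarrow> (nrm (x - y))\<^sup>2 = (nrm x)\<^sup>2 + (nrm y)\<^sup>2 - 2 * Re (ip x y)"
  using ip_cnj[of x y] by (simp add: nrm_power2 ip_diff ip_diff_right)

lemma nrm_diff_commute: "x \<in> H \<Longrightarrow> y \<in> H \<Longrightarrow> nrm (x - y) = nrm (y - x)"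
  using nrm_scale[of "x - y" "-1"] by simp

lemma orthonormal_subset: "orthonormal f E \<Longrightarrow> F \<subseteq> E \<Longrightarrow> orthonormal f F"
  unfolding orthonormal_def by (meson image_mono subset_trans subsetD)

lemma orthonormalD: "orthonormal f E \<Longrightarrow> i \<in> E \<Longrightarrow> j \<in> E \<Longrightarrow> ip (f i) (f j) = (if i = j then 1 else 0)"
  and orthonormal_in_H: "orthonormal f E \<Longrightarrow> i \<in> E \<Longrightarrow> f i \<in> H"
  by (auto simp: orthonormal_def)

lemma orthonormal_sum_nrm:
  assumes "orthonormal f F" "finite F"
  shows "(nrm (\<Sum>i\<in>F. c i *\<^sub>C f i))\<^sup>2 = (\<Sum>i\<in>F. (cmod (c i))\<^sup>2)"
    and "j \<in> F \<Longrightarrow> ip (\<Sum>i\<in>F. c i *\<^sub>C f i) (f j) = c j"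
proof -
  have fH: "i \<in> F \<Longrightarrow> f i \<in> H" for i using assms by (auto simp: orthonormal_def)
  show *: "ip (\<Sum>i\<in>F. c i *\<^sub>C f i) (f j) = c j" if "j \<in> F" for j
  proof -
    have "ip (\<Sum>i\<in>F. c i *\<^sub>C f i) (f j) = (\<Sum>i\<in>F. c i * ip (f i) (f j))"
      using fH that by (simp add: ip_sum ip_scale)
    also have "\<dots> = (\<Sum>i\<in>F. if i = j then c i else 0)"
      using assms that by (intro sum.cong) (auto simp: orthonormal_def)
    finally show ?thesis using that assms by simp
  qed
  define v where "v = (\<Sum>i\<in>F. c i *\<^sub>C f i)"
  have vH: "v \<in> H" unfolding v_def using fH by auto
  have "ip v v = (\<Sum>i\<in>F. c i * ip (f i) v)"
    using vH fH by (subst (1) v_def) (simp add: ip_sum ip_scale)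
  then have "ip v v = cnj (\<Sum>i\<in>F. c i * ip (f i) v)"
    using ip_cnj[OF vH vH] by simp
  also have "\<dots> = (\<Sum>i\<in>F. cnj (c i) * ip v (f i))"
    using vH fH by (simp add: ip_cnj[of v])
  also have "\<dots> = (\<Sum>i\<in>F. of_real ((cmod (c i))\<^sup>2))"
    using * by (intro sum.cong) (auto simp: v_def complex_norm_square mult.commute simp del: of_real_power)
  finally have "Re (ip v v) = (\<Sum>i\<in>F. (cmod (c i))\<^sup>2)" by simp
  then show "(nrm v)\<^sup>2 = (\<Sum>i\<in>F. (cmod (c i))\<^sup>2)" using vH by (simp add: nrm_power2)
qed

lemma Bessel_identity:
  assumes "orthonormal f F" "finite F" "x \<in> H"
  shows "(nrm (x - (\<Sum>i\<in>F. ip x (f i) *\<^sub>C f i)))\<^sup>2 = (nrm x)\<^sup>2 - (\<Sum>i\<in>F. (cmod (ip x (f i)))\<^sup>2)"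
proof -
  define v where "v = (\<Sum>i\<in>F. ip x (f i) *\<^sub>C f i)"
  have fH: "i \<in> F \<Longrightarrow> f i \<in> H" for i using assms by (auto simp: orthonormal_def)
  then have vH: "v \<in> H" unfolding v_def by auto
  have "ip v x = (\<Sum>i\<in>F. ip x (f i) * ip (f i) x)"
    unfolding v_def using fH assms by (simp add: ip_sum ip_scale)
  also have "\<dots> = (\<Sum>i\<in>F. of_real ((cmod (ip x (f i)))\<^sup>2))"
    using fH assms ip_cnj[of x] by (intro sum.cong) (auto simp: complex_norm_square simp del: of_real_power)
  finally have "Re (ip v x) = (\<Sum>i\<in>F. (cmod (ip x (f i)))\<^sup>2)" by simp
  moreover have "Re (ip x v) = Re (ip v x)" using ip_cnj[of v x] vH assms by simp
  ultimately show ?thesis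
    using nrm_diff_power2[OF assms(3) vH] orthonormal_sum_nrm(1)[OF assms(1,2), of "\<lambda>i. ip x (f i)"]
    by (simp add: v_def)
qed

lemma Bessel_inequality:
  assumes "orthonormal f F" "finite F" "x \<in> H"
  shows "(\<Sum>i\<in>F. (cmod (ip x (f i)))\<^sup>2) \<le> (nrm x)\<^sup>2"
  using Bessel_identity[OF assms] by (metis diff_ge_0_iff_ge zero_le_power2)

text \<open>Bessel's inequality for the single unit vector \<open>y / nrm y\<close>.\<close>

lemma Cauchy_Schwarz: 
  assumes "x \<in> H" "y \<in> H" shows "cmod (ip x y) \<le> nrm x * nrm y"
proof (cases "y = 0")
  case False
  then have n: "nrm y > 0" using assms nrm_eq_0[of y] by (simp add: order.not_eq_order_implies_strict)
  define z where "z = (1 / of_real (nrm y)) *\<^sub>C y"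
  have zH: "z \<in> H" using assms by (simp add: z_def)
  have "nrm z = 1" using n assms by (simp add: z_def nrm_scale norm_divide)
  then have "orthonormal (\<lambda>_::unit. z) {()}" using zH by (simp add: orthonormal_def ip_same)
  then have "(cmod (ip x z))\<^sup>2 \<le> (nrm x)\<^sup>2" using Bessel_inequality[of "\<lambda>_. z" "{()}" x] assms by simp
  then have "cmod (ip x z) \<le> nrm x" using assms by (simp add: power2_le_iff_abs_le)
  moreover have "ip x z = ip x y / of_real (nrm y)" using assms by (simp add: z_def ip_scale_right)
  ultimately show ?thesis using n by (simp add: norm_divide field_simps)
qed (use assms in \<open>simp add: ip_0_right\<close>)

lemma nrm_triangle: assumes "x \<in> H" "y \<in> H" shows "nrm (x + y) \<le> nrm x + nrm y"
proof (rule power2_le_imp_le)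
  have "Re (ip x y) \<le> nrm x * nrm y"
    using Cauchy_Schwarz[OF assms] complex_Re_le_cmod order_trans by blast
  then show "(nrm (x + y))\<^sup>2 \<le> (nrm x + nrm y)\<^sup>2"
    using assms by (simp add: nrm_add_power2 power2_sum)
qed (use assms in simp)

lemma nrm_triangle_diff: assumes "x \<in> H" "y \<in> H" shows "\<bar>nrm x - nrm y\<bar> \<le> nrm (x - y)"
  using nrm_triangle[of "x - y" y] nrm_triangle[of "y - x" x] assms nrm_diff_commute[of x y] by simp

lemma complete_nrm:
  assumes "\<And>n. X n \<in> H" "\<And>e. e > 0 \<Longrightarrow> \<exists>M. \<forall>m\<ge>M. \<forall>n\<ge>M. nrm (X m - X n) < e"
  obtains x where "x \<in> H" "(\<lambda>n. nrm (X n - x)) \<longlonglongrightarrow> 0"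
proof -
  have "\<exists>M. \<forall>m\<ge>M. \<forall>n\<ge>M. Re (ip (X m - X n) (X m - X n)) < e" if "e > 0" for e
  proof -
    obtain M where M: "\<forall>m\<ge>M. \<forall>n\<ge>M. nrm (X m - X n) < sqrt e" using assms(2)[of "sqrt e"] \<open>e > 0\<close> by (metis real_sqrt_gt_0_iff)
    have "Re (ip (X m - X n) (X m - X n)) < e" if "m \<ge> M" "n \<ge> M" for m n
      using M that unfolding nrm_def by (simp add: real_sqrt_less_iff)
    then show ?thesis by blast
  qed
  note c = this
  have "\<exists>x\<in>H. (\<lambda>n. Re (ip (X n - x) (X n - x))) \<longlonglongrightarrow> 0"
    by (rule complete[OF assms(1) c])
  then obtain x where x: "x \<in> H" "(\<lambda>n. Re (ip (X n - x) (X n - x))) \<longlonglongrightarrow> 0" by auto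
  from tendsto_real_sqrt[OF x(2)] have "(\<lambda>n. nrm (X n - x)) \<longlonglongrightarrow> 0" by (simp add: nrm_def)
  then show ?thesis using x that by blast
qed

lemma functional_tendsto:
  assumes "functional \<mu>" "\<And>x. x \<in> H \<Longrightarrow> cmod (\<mu> x) \<le> C * nrm x" "\<And>n. X n \<in> H" "x \<in> H"
    "(\<lambda>n. nrm (X n - x)) \<longlonglongrightarrow> 0"
  shows "(\<lambda>n. \<mu> (X n)) \<longlonglongrightarrow> \<mu> x"
proof (rule LIM_zero_cancel, rule Lim_null_comparison)
  show "\<forall>\<^sub>F n in sequentially. norm (\<mu> (X n) - \<mu> x) \<le> C * nrm (X n - x)"
    using assms(2)[OF H_diff[OF assms(3,4)]] assms by (simp add: functional_diff)
  show "(\<lambda>n. C * nrm (X n - x)) \<longlonglongrightarrow> 0"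
    using tendsto_mult_right_zero[OF assms(5)] by simp
qed

lemma ip_tendsto:
  assumes "\<And>n. X n \<in> H" "x \<in> H" "(\<lambda>n. nrm (X n - x)) \<longlonglongrightarrow> 0" "z \<in> H"
  shows "(\<lambda>n. ip (X n) z) \<longlonglongrightarrow> ip x z"
  by (rule functional_tendsto[OF functional_ip[OF assms(4)] _ assms(1,2,3), of "nrm z"])
     (use Cauchy_Schwarz assms(4) in \<open>auto simp: mult.commute\<close>)

lemma nrm_tendsto:
  assumes "\<And>n. X n \<in> H" "x \<in> H" "(\<lambda>n. nrm (X n - x)) \<longlonglongrightarrow> 0"
  shows "(\<lambda>n. nrm (X n)) \<longlonglongrightarrow> nrm x"
proof (rule LIM_zero_cancel, rule Lim_null_comparison)
  show "\<forall>\<^sub>F n in sequentially. norm (nrm (X n) - nrm x) \<le> nrm (X n - x)"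
    using nrm_triangle_diff assms by simp
qed (rule assms)

text \<open>Suitable finite partial sums form a Cauchy sequence, since the mass they miss tends to
  zero. The last clause encodes that \<open>y\<close> lies in the closed span of the family: every
  bounded functional that kills the family kills \<open>y\<close>. It is used to split a vector into
  a part along a family and a part orthogonal to it.\<close>

lemma Riesz_Fischer:
  assumes E: "orthonormal f E" and c: "(\<lambda>e. (cmod (c e))\<^sup>2) summable_on E"
  obtains y where "y \<in> H" "\<And>e. e \<in> E \<Longrightarrow> ip y (f e) = c e"
    "(nrm y)\<^sup>2 = (\<Sum>\<^sub>\<infinity>e\<in>E. (cmod (c e))\<^sup>2)"
    "\<forall>\<mu> C. functional \<mu> \<longrightarrow> (\<forall>x\<in>H. cmod (\<mu> x) \<le> C * nrm x) \<longrightarrow> (\<forall>e\<in>E. \<mu> (f e) = 0) \<longrightarrow> \<mu> y = 0"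
proof -
  define s where "s = (\<Sum>\<^sub>\<infinity>e\<in>E. (cmod (c e))\<^sup>2)"
  have le: "(\<Sum>e\<in>F. (cmod (c e))\<^sup>2) \<le> s" if "finite F" "F \<subseteq> E" for F
    unfolding s_def using that by (intro finite_sum_le_infsum c) auto
  \<comment> \<open>\<open>E\<close> may be uncountable, so a sequence of finite subsets is selected
    whose sums come within \<open>1 / Suc n\<close> of the total; the unions \<open>G n\<close> make
    it increasing.\<close>
  have "\<exists>F. finite F \<and> F \<subseteq> E \<and> s - 1 / real (Suc n) < (\<Sum>e\<in>F. (cmod (c e))\<^sup>2)" for n
  proof -
    have "(sum (\<lambda>e. (cmod (c e))\<^sup>2) \<longlongrightarrow> s) (finite_subsets_at_top E)"
      using c unfolding s_def by (simp add: infsum_tendsto)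
    then have "\<forall>\<^sub>F F in finite_subsets_at_top E. s - 1 / real (Suc n) < (\<Sum>e\<in>F. (cmod (c e))\<^sup>2)"
      by (rule order_tendstoD) simp
    then show ?thesis unfolding eventually_finite_subsets_at_top by blast
  qed
  then obtain F where F: "\<And>n. finite (F n)" "\<And>n. F n \<subseteq> E" "\<And>n. s - 1 / real (Suc n) < (\<Sum>e\<in>F n. (cmod (c e))\<^sup>2)"
    by metis
  define G where "G n = (\<Union>k\<le>n. F k)" for n
  have G: "finite (G n)" "G n \<subseteq> E" for n using F by (auto simp: G_def)
  have Gmono: "m \<le> n \<Longrightarrow> G m \<subseteq> G n" for m n by (force simp: G_def)
  have Gs: "s - 1 / real (Suc n) < (\<Sum>e\<in>G n. (cmod (c e))\<^sup>2)" for n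
  proof -
    have "(\<Sum>e\<in>F n. (cmod (c e))\<^sup>2) \<le> (\<Sum>e\<in>G n. (cmod (c e))\<^sup>2)"
      using F(1) by (intro sum_mono2) (auto simp: G_def)
    then show ?thesis using F(3)[of n] by simp
  qed
  have Gon: "orthonormal f K" if "K \<subseteq> E" for K using E that by (rule orthonormal_subset)
  define Y where "Y n = (\<Sum>e\<in>G n. c e *\<^sub>C f e)" for n
  have fH: "e \<in> E \<Longrightarrow> f e \<in> H" for e using E by (auto simp: orthonormal_def)
  have YH: "Y n \<in> H" for n unfolding Y_def using G fH by blast
  have Ydiff: "(nrm (Y n - Y m))\<^sup>2 < 1 / real (Suc m)" if "m \<le> n" for m n
  proof -
    have "Y n - Y m = (\<Sum>e\<in>G n - G m. c e *\<^sub>C f e)"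
      unfolding Y_def using G Gmono[OF that] by (simp add: sum_diff)
    then have "(nrm (Y n - Y m))\<^sup>2 = (\<Sum>e\<in>G n - G m. (cmod (c e))\<^sup>2)"
      using G by (subst orthonormal_sum_nrm(1)[symmetric]) (auto intro!: Gon)
    also have "\<dots> = (\<Sum>e\<in>G n. (cmod (c e))\<^sup>2) - (\<Sum>e\<in>G m. (cmod (c e))\<^sup>2)"
      using G Gmono[OF that] by (simp add: sum_diff)
    also have "\<dots> < 1 / real (Suc m)" using Gs[of m] le[OF G(1,2), of n] by linarith
    finally show ?thesis .
  qed
  have "\<exists>M. \<forall>m\<ge>M. \<forall>n\<ge>M. nrm (Y m - Y n) < e" if e: "e > 0" for e
  proof -
    obtain M where M: "1 / real (Suc M) < e\<^sup>2" using e by (metis nat_approx_posE zero_less_power)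
    have *: "nrm (Y n - Y m) < e" if "m \<ge> M" "m \<le> n" for m n
    proof (rule power2_less_imp_less)
      have "(nrm (Y n - Y m))\<^sup>2 < 1 / real (Suc m)" using Ydiff that by blast
      also have "\<dots> \<le> 1 / real (Suc M)" using that by (simp add: frac_le)
      also note M
      finally show "(nrm (Y n - Y m))\<^sup>2 < e\<^sup>2" .
    qed (use e in simp)
    have "nrm (Y m - Y n) < e" if "m \<ge> M" "n \<ge> M" for m n
      using *[of m n] *[of n m] that nrm_diff_commute[OF YH YH, of m n] by (cases "m \<le> n") auto
    then show ?thesis by blast
  qed
  then obtain y where y: "y \<in> H" "(\<lambda>n. nrm (Y n - y)) \<longlonglongrightarrow> 0"
    using complete_nrm[of Y] YH by metis
  have inv: "(\<lambda>n. 1 / real (Suc n)) \<longlonglongrightarrow> 0"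
    using LIMSEQ_inverse_real_of_nat by (simp add: inverse_eq_divide)
  have 1: "ip y (f e) = c e" if e: "e \<in> E" for e
  proof (rule LIMSEQ_unique[OF ip_tendsto[OF YH y fH[OF e]]])
    \<comment> \<open>The error is zero once \<open>e\<close> lies in \<open>G n\<close>; before
      that, the squared coefficient of \<open>e\<close> is part of the mass missed by
      \<open>G n\<close>.\<close>
    have "(cmod (ip (Y n) (f e) - c e))\<^sup>2 \<le> 1 / real (Suc n)" for n
    proof (cases "e \<in> G n")
      case True
      then have "ip (Y n) (f e) = c e" unfolding Y_def using G Gon by (intro orthonormal_sum_nrm(2)) auto
      then show ?thesis by simp
    next
      case False
      have "ip (f i) (f e) = 0" if "i \<in> G n" for i
      proof -
        have "i \<in> E" "i \<noteq> e" using that G(2)[of n] False by auto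
        then show ?thesis using orthonormalD[OF E _ e, of i] by simp
      qed
      then have "ip (Y n) (f e) = 0" unfolding Y_def
        using G fH e by (subst ip_sum) (auto simp: ip_scale subset_iff)
      moreover have "(\<Sum>e\<in>G n. (cmod (c e))\<^sup>2) + (cmod (c e))\<^sup>2 \<le> s"
        using le[of "insert e (G n)"] G e False by (simp add: add.commute)
      ultimately show ?thesis using Gs[of n] by simp
    qed
    then have "(\<lambda>n. (cmod (ip (Y n) (f e) - c e))\<^sup>2) \<longlonglongrightarrow> 0"
      by (intro tendsto_sandwich[OF _ _ tendsto_const inv]) auto
    then have "(\<lambda>n. ip (Y n) (f e) - c e) \<longlonglongrightarrow> 0"
      by (drule_tac tendsto_real_sqrt) (auto intro: tendsto_norm_zero_cancel)
    then show "(\<lambda>n. ip (Y n) (f e)) \<longlonglongrightarrow> c e" by (rule LIM_zero_cancel)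
  qed
  have 2: "(nrm y)\<^sup>2 = s"
  proof (rule LIMSEQ_unique[OF tendsto_power[OF nrm_tendsto[OF YH y]]])
    have "(nrm (Y n))\<^sup>2 = (\<Sum>e\<in>G n. (cmod (c e))\<^sup>2)" for n
      unfolding Y_def using G by (intro orthonormal_sum_nrm(1) Gon) auto
    then have sw: "s - 1 / real (Suc n) \<le> (nrm (Y n))\<^sup>2" "(nrm (Y n))\<^sup>2 \<le> s" for n
      using Gs[of n] le[OF G(1,2), of n] by auto
    have "(\<lambda>n. s - 1 / real (Suc n)) \<longlonglongrightarrow> s"
      using tendsto_diff[OF tendsto_const[of s] inv] by (simp only: diff_0_right)
    then show "(\<lambda>n. (nrm (Y n))\<^sup>2) \<longlonglongrightarrow> s"
      by (rule tendsto_sandwich[OF _ _ _ tendsto_const, rotated 2]) (use sw in \<open>auto intro!: always_eventually\<close>)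
  qed
  have 3: "\<mu> y = 0" if \<mu>: "functional \<mu>" "\<And>x. x \<in> H \<Longrightarrow> cmod (\<mu> x) \<le> C * nrm x" "\<And>e. e \<in> E \<Longrightarrow> \<mu> (f e) = 0" for \<mu> C
  proof (rule LIMSEQ_unique[OF functional_tendsto[OF \<mu>(1,2) YH y]])
    have "\<mu> (Y n) = 0" for n unfolding Y_def
      using G fH \<mu>(3) by (subst functional_sum[OF \<mu>(1)]) (auto simp: functional_scale[OF \<mu>(1)] subset_iff)
    then show "(\<lambda>n. \<mu> (Y n)) \<longlonglongrightarrow> 0" by simp
  qed
  show ?thesis
    by (rule that[OF y(1) 1]) (use 2 3 in \<open>auto simp: s_def\<close>)
qed

lemma Bessel_summable:
  assumes "orthonormal f E" "x \<in> H"
  shows "(\<lambda>e. (cmod (ip x (f e)))\<^sup>2) summable_on E"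
proof (rule nonneg_bdd_above_summable_on)
  have "orthonormal f F" if "F \<subseteq> E" for F using assms that orthonormal_subset by blast
  then show "bdd_above (sum (\<lambda>e. (cmod (ip x (f e)))\<^sup>2) ` {F. F \<subseteq> E \<and> finite F})"
    using Bessel_inequality assms(2) by (intro bdd_aboveI[of _ "(nrm x)\<^sup>2"]) auto
qed auto

text \<open>The Riesz-Fischer vector built from the coefficients of \<open>x\<close> has the
  required norm, and its difference from \<open>x\<close> is orthogonal to the basis, hence
  zero.\<close>

lemma Parseval:
  assumes "onb E" "x \<in> H"
  shows "((\<lambda>e. (cmod (ip x e))\<^sup>2) has_sum (nrm x)\<^sup>2) E"
proof -
  have on: "orthonormal id E" using assms by (simp add: onb_def)
  have su: "(\<lambda>e. (cmod (ip x e))\<^sup>2) summable_on E" using Bessel_summable[OF on assms(2)] by simp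
  obtain y where y: "y \<in> H" "\<And>e. e \<in> E \<Longrightarrow> ip y e = ip x e" "(nrm y)\<^sup>2 = (\<Sum>\<^sub>\<infinity>e\<in>E. (cmod (ip x e))\<^sup>2)"
    by (rule Riesz_Fischer[OF on su]) simp
  have "ip (x - y) e = 0" if "e \<in> E" for e
    using that y assms on by (subst ip_diff) (auto simp: orthonormal_def)
  then have "x - y = 0" using assms y unfolding onb_def by blast
  then show ?thesis using y(3) su by simp
qed

text \<open>The error of a finite partial sum is \<open>\<mu>\<close> applied to the remainder of
  \<open>x\<close>, whose norm is given by Bessel's identity and tends to zero by Parseval.\<close>

lemma functional_expansion:
  assumes "onb E" "x \<in> H" and \<mu>: "functional \<mu>" "\<And>x. x \<in> H \<Longrightarrow> cmod (\<mu> x) \<le> C * nrm x"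
  shows "((\<lambda>e. ip x e * \<mu> e) has_sum \<mu> x) E"
  unfolding has_sum_def
proof (rule LIM_zero_cancel, rule Lim_null_comparison)
  have on: "orthonormal id E" using assms by (simp add: onb_def)
  show "\<forall>\<^sub>F F in finite_subsets_at_top E. norm ((\<Sum>e\<in>F. ip x e * \<mu> e) - \<mu> x)
      \<le> C * sqrt ((nrm x)\<^sup>2 - (\<Sum>e\<in>F. (cmod (ip x e))\<^sup>2))"
  proof (rule eventually_finite_subsets_at_top_weakI)
    fix F assume F: "finite F" "F \<subseteq> E"
    have onF: "orthonormal id F" using on F(2) by (rule orthonormal_subset)
    have EH: "F \<subseteq> H" using onF by (auto simp: orthonormal_def)
    define v where "v = (\<Sum>e\<in>F. ip x e *\<^sub>C e)"
    have vH: "v \<in> H" unfolding v_def using EH by blast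
    have "\<mu> v = (\<Sum>e\<in>F. ip x e * \<mu> e)"
      unfolding v_def using EH by (subst functional_sum[OF \<mu>(1)]) (auto simp: functional_scale[OF \<mu>(1)] subset_iff)
    then have "norm ((\<Sum>e\<in>F. ip x e * \<mu> e) - \<mu> x) = cmod (\<mu> (x - v))"
      using vH assms by (simp add: functional_diff norm_minus_commute)
    also have "\<dots> \<le> C * nrm (x - v)" using \<mu>(2) vH assms by blast
    also have "nrm (x - v) = sqrt ((nrm x)\<^sup>2 - (\<Sum>e\<in>F. (cmod (ip x e))\<^sup>2))"
      using Bessel_identity[OF onF F(1) assms(2)] vH assms(2) by (simp add: v_def real_sqrt_unique)
    finally show "norm ((\<Sum>e\<in>F. ip x e * \<mu> e) - \<mu> x)
      \<le> C * sqrt ((nrm x)\<^sup>2 - (\<Sum>e\<in>F. (cmod (ip x e))\<^sup>2))" .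
  qed
  have "((\<lambda>F. \<Sum>e\<in>F. (cmod (ip x e))\<^sup>2) \<longlongrightarrow> (nrm x)\<^sup>2) (finite_subsets_at_top E)"
    using Parseval[OF assms(1,2)] by (simp add: has_sum_def)
  then have "((\<lambda>F. C * sqrt ((nrm x)\<^sup>2 - (\<Sum>e\<in>F. (cmod (ip x e))\<^sup>2))) \<longlongrightarrow> C * sqrt ((nrm x)\<^sup>2 - (nrm x)\<^sup>2)) (finite_subsets_at_top E)"
    by (intro tendsto_intros)
  then show "((\<lambda>F. C * sqrt ((nrm x)\<^sup>2 - (\<Sum>e\<in>F. (cmod (ip x e))\<^sup>2))) \<longlongrightarrow> 0) (finite_subsets_at_top E)" by simp
qed

lemma Parseval_ip:
  assumes "onb E" "x \<in> H" "y \<in> H"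
  shows "((\<lambda>e. ip x e * cnj (ip y e)) has_sum ip x y) E"
proof -
  have "((\<lambda>e. ip x e * ip e y) has_sum ip x y) E"
    by (rule functional_expansion[OF assms(1,2) functional_ip[OF assms(3)], of "nrm y"])
       (use Cauchy_Schwarz assms(3) in \<open>auto simp: mult.commute\<close>)
  then show ?thesis
  proof (rule has_sum_cong[THEN iffD1, rotated])
    fix e assume "e \<in> E"
    then have "e \<in> H" using assms(1) by (auto simp: onb_def orthonormal_def)
    then show "ip x e * ip e y = ip x e * cnj (ip y e)" using ip_cnj[OF assms(3), of e] by simp
  qed
qed

text \<open>Test \<open>\<mu>\<close> on \<open>v\<close>, the combination of the \<open>f e\<close>
  with coefficients \<open>cnj (\<mu> (f e))\<close>. Its value is the sum \<open>S\<close> in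
  question while \<open>nrm v = sqrt S\<close>, so the bound on \<open>\<mu>\<close> reads
  \<open>S \<le> C * sqrt S\<close>.\<close>

lemma functional_Bessel:
  assumes \<mu>: "functional \<mu>" "\<And>x. x \<in> H \<Longrightarrow> cmod (\<mu> x) \<le> C * nrm x" and "C \<ge> 0"
    and "orthonormal f F" "finite F"
  shows "(\<Sum>e\<in>F. (cmod (\<mu> (f e)))\<^sup>2) \<le> C\<^sup>2"
proof -
  define S where "S = (\<Sum>e\<in>F. (cmod (\<mu> (f e)))\<^sup>2)"
  define v where "v = (\<Sum>e\<in>F. cnj (\<mu> (f e)) *\<^sub>C f e)"
  have fH: "e \<in> F \<Longrightarrow> f e \<in> H" for e using assms by (auto simp: orthonormal_def)
  have vH: "v \<in> H" unfolding v_def using fH by blast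
  have S0: "S \<ge> 0" unfolding S_def by (simp add: sum_nonneg)
  have "\<mu> v = (\<Sum>e\<in>F. cnj (\<mu> (f e)) * \<mu> (f e))"
    unfolding v_def using fH by (subst functional_sum[OF \<mu>(1)]) (auto simp: functional_scale[OF \<mu>(1)])
  also have "\<dots> = of_real S" unfolding S_def of_real_sum
    by (intro sum.cong) (auto simp: complex_norm_square mult.commute simp del: of_real_power)
  finally have "cmod (\<mu> v) = S" using S0 by simp
  moreover have "nrm v = sqrt S"
    using orthonormal_sum_nrm(1)[OF assms(4,5), of "\<lambda>e. cnj (\<mu> (f e))"] vH by (simp add: v_def S_def real_sqrt_unique)
  ultimately have "S \<le> C * sqrt S" using \<mu>(2)[OF vH] by simp
  then have *: "sqrt S * sqrt S \<le> C * sqrt S" using S0 by simp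
  have "sqrt S \<le> C"
  proof (cases "S = 0")
    case False
    then have "sqrt S > 0" using S0 by simp
    then show ?thesis using * by (simp only: mult_le_cancel_right_pos)
  qed (use assms(3) in simp)
  then have "(sqrt S)\<^sup>2 \<le> C\<^sup>2" by (intro power_mono) (use S0 in auto)
  then show ?thesis using S0 by (simp add: S_def)
qed

end

section \<open>Nuclear operators\<close>

text \<open>\<open>T\<close> is a sum of rank one maps \<open>la i x\<close> times
  \<open>a i\<close>, with \<open>c i\<close> any bound for the norm of \<open>la i\<close>. The
  series is required only in weak form, against each \<open>y\<close>; linearity and boundedness of
  \<open>T\<close> are derived from it. Countability of \<open>I\<close> serves the diagonal
  argument for compactness.\<close>

locale nuclear_op = carrier_hilbert scale H ip
  for scale :: "complex \<Rightarrow> 'v::ab_group_add \<Rightarrow> 'v" (infixr "*\<^sub>C" 75) and H ip +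
  fixes T :: "'v \<Rightarrow> 'v" and I :: "'i set" and la :: "'i \<Rightarrow> 'v \<Rightarrow> complex" and a :: "'i \<Rightarrow> 'v" and c :: "'i \<Rightarrow> real"
  assumes countable_I: "countable I"
    and T_H [simp, intro]: "x \<in> H \<Longrightarrow> T x \<in> H"
    and functional_la: "i \<in> I \<Longrightarrow> functional (la i)"
    and la_bound: "i \<in> I \<Longrightarrow> x \<in> H \<Longrightarrow> cmod (la i x) \<le> c i * nrm x"
    and c_ge_0: "i \<in> I \<Longrightarrow> 0 \<le> c i"
    and a_H [simp, intro]: "i \<in> I \<Longrightarrow> a i \<in> H"
    and summable_ca: "(\<lambda>i. c i * nrm (a i)) summable_on I"
    and T_rep: "x \<in> H \<Longrightarrow> y \<in> H \<Longrightarrow> ((\<lambda>i. la i x * ip (a i) y) has_sum ip (T x) y) I"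
begin

text \<open>An upper bound for the nuclear norm of \<open>T\<close>; it dominates both the operator
  norm and the sum of the singular values.\<close>

definition B :: real where "B = (\<Sum>\<^sub>\<infinity>i\<in>I. c i * nrm (a i))"

lemma eq_by_ip: "x \<in> H \<Longrightarrow> y \<in> H \<Longrightarrow> (\<And>z. z \<in> H \<Longrightarrow> ip x z = ip y z) \<Longrightarrow> x = y"
  using ip_eq_0[of "x - y"] ip_diff[of "x - y" x y] by simp

lemma T_add: "x \<in> H \<Longrightarrow> y \<in> H \<Longrightarrow> T (x + y) = T x + T y"
proof (rule eq_by_ip)
  fix z assume H: "x \<in> H" "y \<in> H" "z \<in> H"
  have 1: "((\<lambda>i. la i x * ip (a i) z + la i y * ip (a i) z) has_sum (ip (T x) z + ip (T y) z)) I"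
    using H by (intro has_sum_add T_rep)
  have 2: "((\<lambda>i. la i (x + y) * ip (a i) z) has_sum ip (T (x + y)) z) I"
    using H by (intro T_rep) auto
  have 3: "la i (x + y) * ip (a i) z = la i x * ip (a i) z + la i y * ip (a i) z" if "i \<in> I" for i
    using functional_add[OF functional_la[OF that]] H by (simp add: algebra_simps)
  have "ip (T (x + y)) z = ip (T x) z + ip (T y) z"
    by (rule has_sum_unique[OF 2 has_sum_cong[THEN iffD2, OF 3 1]])
  then show "ip (T (x + y)) z = ip (T x + T y) z" using H by (simp add: ip_add)
qed auto

lemma T_scale: "x \<in> H \<Longrightarrow> T (b *\<^sub>C x) = b *\<^sub>C T x"
proof (rule eq_by_ip)
  fix z assume H: "x \<in> H" "z \<in> H"
  have 1: "((\<lambda>i. b * (la i x * ip (a i) z)) has_sum (b * ip (T x) z)) I"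
    using H by (intro has_sum_cmult_right T_rep)
  have 2: "((\<lambda>i. la i (b *\<^sub>C x) * ip (a i) z) has_sum ip (T (b *\<^sub>C x)) z) I"
    using H by (intro T_rep) auto
  have 3: "la i (b *\<^sub>C x) * ip (a i) z = b * (la i x * ip (a i) z)" if "i \<in> I" for i
    using functional_scale[OF functional_la[OF that]] H by (simp add: algebra_simps)
  have "ip (T (b *\<^sub>C x)) z = b * ip (T x) z"
    by (rule has_sum_unique[OF 2 has_sum_cong[THEN iffD2, OF 3 1]])
  then show "ip (T (b *\<^sub>C x)) z = ip (b *\<^sub>C T x) z" using H by (simp add: ip_scale)
qed auto

lemma T_0: "T 0 = 0"
  using T_scale[of 0 0] by simp

lemma T_diff: "x \<in> H \<Longrightarrow> y \<in> H \<Longrightarrow> T (x - y) = T x - T y"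
  using T_add[of "x - y" y] by simp

lemma functional_ip_T: "z \<in> H \<Longrightarrow> functional (\<lambda>x. ip (T x) z)"
  by (simp add: functional_def T_add T_scale ip_add ip_scale)

lemma la_a_summable:
  assumes "x \<in> H" shows "(\<lambda>i. cmod (la i x) * nrm (a i)) summable_on I"
proof (rule summable_on_comparison_test)
  show "(\<lambda>i. nrm x * (c i * nrm (a i))) summable_on I"
    using summable_ca by (rule summable_on_cmult_right)
  fix i assume i: "i \<in> I"
  then have "cmod (la i x) * nrm (a i) \<le> (c i * nrm x) * nrm (a i)"
    using la_bound[OF i assms] by (intro mult_right_mono) auto
  then show "cmod (la i x) * nrm (a i) \<le> nrm x * (c i * nrm (a i))" by (simp add: mult_ac)
  show "0 \<le> cmod (la i x) * nrm (a i)" using i by simp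
qed

text \<open>Pairing the representation with \<open>T x\<close> itself gives the squared norm, and
  one factor \<open>nrm (T x)\<close> cancels.\<close>

lemma nrm_T_le_infsum:
  assumes "x \<in> H" shows "nrm (T x) \<le> (\<Sum>\<^sub>\<infinity>i\<in>I. cmod (la i x) * nrm (a i))"
proof (cases "nrm (T x) = 0")
  case True
  then show ?thesis using \<open>x \<in> H\<close> by (auto intro!: infsum_nonneg)
next
  case False
  then have pos: "nrm (T x) > 0" using nrm_ge_0[OF T_H[OF assms]] by linarith
  have rep: "((\<lambda>i. la i x * ip (a i) (T x)) has_sum ip (T x) (T x)) I"
    using assms by (intro T_rep) auto
  have su: "(\<lambda>i. nrm (T x) * (cmod (la i x) * nrm (a i))) summable_on I"
    using la_a_summable[OF assms] by (rule summable_on_cmult_right)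
  have "(nrm (T x))\<^sup>2 = norm (ip (T x) (T x))" using assms by (simp add: ip_same norm_power)
  also have "\<dots> \<le> (\<Sum>\<^sub>\<infinity>i\<in>I. nrm (T x) * (cmod (la i x) * nrm (a i)))"
  proof (rule norm_infsum_le[OF rep has_sum_infsum[OF su]])
    fix i assume i: "i \<in> I"
    have "cmod (la i x) * cmod (ip (a i) (T x)) \<le> cmod (la i x) * (nrm (a i) * nrm (T x))"
      using i assms by (intro mult_left_mono Cauchy_Schwarz) auto
    then show "norm (la i x * ip (a i) (T x)) \<le> nrm (T x) * (cmod (la i x) * nrm (a i))"
      by (simp add: norm_mult mult_ac)
  qed
  also have "\<dots> = nrm (T x) * (\<Sum>\<^sub>\<infinity>i\<in>I. cmod (la i x) * nrm (a i))"
    using la_a_summable[OF assms] by (rule infsum_cmult_right)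
  finally show ?thesis using pos by (simp add: power2_eq_square)
qed

lemma B_ge_0: "0 \<le> B"
  unfolding B_def using c_ge_0 by (intro infsum_nonneg) auto

lemma nrm_T_le: "x \<in> H \<Longrightarrow> nrm (T x) \<le> B * nrm x"
proof -
  assume x: "x \<in> H"
  have "nrm (T x) \<le> (\<Sum>\<^sub>\<infinity>i\<in>I. cmod (la i x) * nrm (a i))" using nrm_T_le_infsum[OF x] .
  also have "\<dots> \<le> (\<Sum>\<^sub>\<infinity>i\<in>I. nrm x * (c i * nrm (a i)))"
  proof (rule infsum_mono[OF la_a_summable[OF x] summable_on_cmult_right[OF summable_ca]])
    fix i assume i: "i \<in> I"
    have "cmod (la i x) * nrm (a i) \<le> (c i * nrm x) * nrm (a i)"
      using la_bound[OF i x] i by (intro mult_right_mono) auto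
    then show "cmod (la i x) * nrm (a i) \<le> nrm x * (c i * nrm (a i))" by (simp add: mult_ac)
  qed
  also have "\<dots> = B * nrm x" unfolding B_def using summable_ca by (subst infsum_cmult_right) auto
  finally show ?thesis .
qed

lemma functional_ip_T_bound: "x \<in> H \<Longrightarrow> z \<in> H \<Longrightarrow> cmod (ip (T x) z) \<le> (B * nrm z) * nrm x"
  using Cauchy_Schwarz[of "T x" z] nrm_T_le[of x] mult_right_mono[of "nrm (T x)" "B * nrm x" "nrm z"]
  by (simp add: mult_ac)

text \<open>A diagonal subsequence makes every \<open>la i (X n)\<close> converge. Finitely many
  indices carry all but \<open>e / 4\<close> of \<open>B\<close>, and on these the differences
  become small; on the other indices the difference of two vectors of the unit ball has norm at most
  2, which costs at most \<open>e / 2\<close>.\<close>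

lemma T_compact:
  assumes X: "\<And>n. X n \<in> H" "\<And>n. nrm (X n) \<le> 1"
  obtains r :: "nat \<Rightarrow> nat" where "strict_mono r"
    "\<And>e. e > 0 \<Longrightarrow> \<exists>M. \<forall>m\<ge>M. \<forall>n\<ge>M. nrm (T (X (r m)) - T (X (r n))) < e"
proof -
  obtain r :: "nat \<Rightarrow> nat" where r: "strict_mono r" "\<And>i. i \<in> I \<Longrightarrow> convergent (\<lambda>n. la i (X (r n)))"
  proof (cases "I = {}")
    case True
    then show ?thesis using that[of id] by (simp add: strict_mono_id)
  next
    case False
    define P where "P = (\<lambda>k (s::nat \<Rightarrow> nat). convergent (\<lambda>n. la (from_nat_into I k) (X (s n))))"
    interpret subseqs P
    proof
      fix k and s :: "nat \<Rightarrow> nat" assume "strict_mono s"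
      define i where "i = from_nat_into I k"
      have i: "i \<in> I" unfolding i_def using False by (rule from_nat_into)
      have "cmod (la i (X (s n))) \<le> c i" for n
        using la_bound[OF i X(1)[of "s n"]] mult_left_mono[OF X(2)[of "s n"] c_ge_0[OF i]] by linarith
      then have "bounded (range (\<lambda>n. la i (X (s n))))" by (auto simp: bounded_iff)
      from bounded_imp_convergent_subsequence[OF this]
      obtain l r' where "strict_mono r'" "((\<lambda>n. la i (X (s n))) \<circ> r') \<longlonglongrightarrow> l" by metis
      then show "\<exists>r'. strict_mono r' \<and> P k (s \<circ> r')"
        unfolding P_def i_def by (auto simp: o_def convergent_def)
    qed
    have stable: "P k (s \<circ> r')" if "strict_mono r'" "P k s" for r' s k
    proof -
      from that(2) obtain l where "(\<lambda>n. la (from_nat_into I k) (X (s n))) \<longlonglongrightarrow> l"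
        unfolding P_def convergent_def by blast
      from LIMSEQ_subseq_LIMSEQ[OF this that(1)] show ?thesis
        unfolding P_def convergent_def by (auto simp: o_def)
    qed
    have "convergent (\<lambda>n. la i (X (diagseq n)))" if i: "i \<in> I" for i
    proof -
      obtain k where k: "i = from_nat_into I k" using countable_I i by (metis from_nat_into_surj)
      \<comment> \<open>The diagonal sequence is known to refine the \<open>k\<close>-th selection
        only from index \<open>Suc k\<close> on, hence the shift.\<close>
      have "P k (diagseq \<circ> (+) (Suc k))" by (rule diagseq_holds) (rule stable)
      then have "convergent (\<lambda>n. la i (X (diagseq (n + Suc k))))"
        unfolding P_def k by (simp add: o_def add.commute)
      then show ?thesis by (rule convergent_ignore_initial_segment[THEN iffD1])
    qed
    then show ?thesis using that subseq_diagseq by blast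
  qed
  have "\<exists>M. \<forall>m\<ge>M. \<forall>n\<ge>M. nrm (T (X (r m)) - T (X (r n))) < e" if e: "e > 0" for e
  proof -
    have "((\<lambda>F. \<Sum>i\<in>F. c i * nrm (a i)) \<longlongrightarrow> B) (finite_subsets_at_top I)"
      unfolding B_def using summable_ca by (rule infsum_tendsto)
    then have "\<forall>\<^sub>F F in finite_subsets_at_top I. B - e / 4 < (\<Sum>i\<in>F. c i * nrm (a i))"
      by (rule order_tendstoD) (use e in simp)
    then obtain F where F: "finite F" "F \<subseteq> I" "B - e / 4 < (\<Sum>i\<in>F. c i * nrm (a i))"
      unfolding eventually_finite_subsets_at_top by blast
    have suF: "(\<lambda>i. c i * nrm (a i)) summable_on (I - F)"
      using summable_ca by (rule summable_on_subset_banach) auto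
    have "B = (\<Sum>i\<in>F. c i * nrm (a i)) + (\<Sum>\<^sub>\<infinity>i\<in>I - F. c i * nrm (a i))"
      unfolding B_def using F suF infsum_Un_disjoint[of "\<lambda>i. c i * nrm (a i)" F "I - F"]
      by (simp add: summable_on_finite Un_absorb1)
    then have tail: "(\<Sum>\<^sub>\<infinity>i\<in>I - F. c i * nrm (a i)) < e / 4" using F(3) by linarith
    \<comment> \<open>The summand 1 keeps \<open>K\<close> positive even if all norms over
      \<open>F\<close> vanish.\<close>
    define K where "K = (\<Sum>i\<in>F. nrm (a i)) + 1"
    have K: "K > 0" unfolding K_def using F by (intro add_nonneg_pos sum_nonneg) auto
    have "\<forall>i\<in>F. \<exists>M. \<forall>m\<ge>M. \<forall>n\<ge>M. cmod (la i (X (r m)) - la i (X (r n))) < e / (2 * K)"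
    proof
      fix i assume "i \<in> F"
      then have "Cauchy (\<lambda>n. la i (X (r n)))" using r(2) F convergent_Cauchy by blast
      then show "\<exists>M. \<forall>m\<ge>M. \<forall>n\<ge>M. cmod (la i (X (r m)) - la i (X (r n))) < e / (2 * K)"
        using CauchyD[of _ "e / (2 * K)"] e K by simp
    qed
    then obtain M where M: "\<And>i m n. i \<in> F \<Longrightarrow> m \<ge> M i \<Longrightarrow> n \<ge> M i \<Longrightarrow> cmod (la i (X (r m)) - la i (X (r n))) < e / (2 * K)"
      by metis
    \<comment> \<open>The sum of the thresholds \<open>M i\<close> serves as a common upper bound
      for them.\<close>
    have "nrm (T (X (r m)) - T (X (r n))) < e" if mn: "m \<ge> (\<Sum>i\<in>F. M i)" "n \<ge> (\<Sum>i\<in>F. M i)" for m n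
    proof -
      define d where "d = X (r m) - X (r n)"
      have dH: "d \<in> H" unfolding d_def using X by auto
      have d2: "nrm d \<le> 2" unfolding d_def
        using nrm_triangle[of "X (r m)" "(-1) *\<^sub>C X (r n)"] X nrm_scale[OF X(1), of "-1" "r n"] H_scale[OF X(1), of "-1" "r n"]
          add_mono[OF X(2)[of "r m"] X(2)[of "r n"]] by simp
      have "nrm (T (X (r m)) - T (X (r n))) = nrm (T d)" unfolding d_def using X by (simp add: T_diff)
      also have "\<dots> \<le> (\<Sum>\<^sub>\<infinity>i\<in>I. cmod (la i d) * nrm (a i))" using dH by (rule nrm_T_le_infsum)
      also have "\<dots> = (\<Sum>i\<in>F. cmod (la i d) * nrm (a i)) + (\<Sum>\<^sub>\<infinity>i\<in>I - F. cmod (la i d) * nrm (a i))"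
      proof -
        have "(\<lambda>i. cmod (la i d) * nrm (a i)) summable_on (I - F)"
          using la_a_summable[OF dH] by (rule summable_on_subset_banach) auto
        then show ?thesis using F infsum_Un_disjoint[of "\<lambda>i. cmod (la i d) * nrm (a i)" F "I - F"]
          by (simp add: summable_on_finite Un_absorb1)
      qed
      also have "(\<Sum>i\<in>F. cmod (la i d) * nrm (a i)) \<le> (\<Sum>i\<in>F. e / (2 * K) * nrm (a i))"
      proof (intro sum_mono mult_right_mono)
        fix i assume i: "i \<in> F"
        have "M i \<le> (\<Sum>i\<in>F. M i)" using F i by (intro member_le_sum) auto
        then have "cmod (la i (X (r m)) - la i (X (r n))) < e / (2 * K)" using M[OF i] mn by auto
        then show "cmod (la i d) \<le> e / (2 * K)" unfolding d_def
          using functional_diff[OF functional_la] i F X by (auto simp: subset_iff)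
        show "0 \<le> nrm (a i)" using i F by auto
      qed
      also have "\<dots> = e / (2 * K) * (K - 1)" by (simp add: K_def sum_distrib_left)
      also have "\<dots> \<le> e / (2 * K) * K" using e K by (intro mult_left_mono) auto
      also have "\<dots> = e / 2" using K by simp
      also have "(\<Sum>\<^sub>\<infinity>i\<in>I - F. cmod (la i d) * nrm (a i)) \<le> (\<Sum>\<^sub>\<infinity>i\<in>I - F. 2 * (c i * nrm (a i)))"
      proof (rule infsum_mono)
        show "(\<lambda>i. cmod (la i d) * nrm (a i)) summable_on (I - F)"
          using la_a_summable[OF dH] by (rule summable_on_subset_banach) auto
        show "(\<lambda>i. 2 * (c i * nrm (a i))) summable_on (I - F)" using suF by (rule summable_on_cmult_right)
        fix i assume i: "i \<in> I - F"
        have "cmod (la i d) \<le> c i * 2"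
          using la_bound[of i d] mult_left_mono[OF d2 c_ge_0[of i]] i dH by auto
        then have "cmod (la i d) * nrm (a i) \<le> c i * 2 * nrm (a i)"
          using i by (intro mult_right_mono) auto
        then show "cmod (la i d) * nrm (a i) \<le> 2 * (c i * nrm (a i))" by (simp add: mult_ac)
      qed
      also have "\<dots> = 2 * (\<Sum>\<^sub>\<infinity>i\<in>I - F. c i * nrm (a i))" using suF by (rule infsum_cmult_right)
      finally show ?thesis using tail by linarith
    qed
    then show ?thesis by blast
  qed
  then show ?thesis using r(1) that by blast
qed

text \<open>By the parallelogram law a maximizing sequence \<open>x\<^sub>k\<close> is Cauchy as soon as \<open>T x\<^sub>k\<close> converges.\<close>

lemma maximizer:
  assumes "O' \<subseteq> H" and x0: "x0 \<in> H" "\<And>z. z \<in> O' \<Longrightarrow> ip x0 z = 0" "T x0 \<noteq> 0"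
  obtains e where "e \<in> H" "\<And>z. z \<in> O' \<Longrightarrow> ip e z = 0" "nrm e = 1"
    "\<And>x. \<lbrakk>x \<in> H; \<And>z. z \<in> O' \<Longrightarrow> ip x z = 0\<rbrakk> \<Longrightarrow> nrm (T x) \<le> nrm (T e) * nrm x"
proof -
  define K where "K = {x \<in> H. \<forall>z\<in>O'. ip x z = 0}"
  have KH: "x \<in> K \<Longrightarrow> x \<in> H" for x by (simp add: K_def)
  have Ka: "x + y \<in> K" if "x \<in> K" "y \<in> K" for x y
    using that assms(1) by (auto simp: K_def ip_add subset_iff)
  have Ks: "b *\<^sub>C x \<in> K" if "x \<in> K" for x b
    using that assms(1) by (auto simp: K_def ip_scale subset_iff)
  define R where "R = (\<lambda>x. nrm (T x)) ` {x \<in> K. nrm x = 1}"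
  define M where "M = Sup R"
  have bdd: "bdd_above R"
  proof (rule bdd_aboveI[of _ B])
    fix b assume "b \<in> R"
    then obtain x where "x \<in> K" "nrm x = 1" "b = nrm (T x)" by (auto simp: R_def)
    then show "b \<le> B" using nrm_T_le[OF KH, of x] by simp
  qed
  have le: "nrm (T x) \<le> M * nrm x" if x: "x \<in> K" for x
  proof (cases "nrm x = 0")
    case True
    then show ?thesis using nrm_eq_0[OF KH[OF x]] by (simp add: T_0)
  next
    case False
    then have pos: "nrm x > 0" using nrm_ge_0[OF KH[OF x]] by linarith
    define y where "y = (1 / of_real (nrm x)) *\<^sub>C x"
    have "nrm y = 1" unfolding y_def using pos KH[OF x] by (simp add: nrm_scale norm_divide)
    moreover have "y \<in> K" unfolding y_def using Ks x by blast
    ultimately have "nrm (T y) \<le> M" unfolding M_def R_def using bdd[unfolded R_def] by (intro cSup_upper) auto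
    moreover have "nrm (T y) = nrm (T x) / nrm x" unfolding y_def using KH[OF x] pos
      by (simp add: T_scale nrm_scale norm_divide)
    ultimately show ?thesis using pos by (simp add: field_simps)
  qed
  have x0K: "x0 \<in> K" using x0 by (simp add: K_def)
  have "nrm (T x0) > 0" using x0 nrm_eq_0[of "T x0"] nrm_ge_0[of "T x0"] by (auto simp: less_le)
  then have Mx: "0 < M * nrm x0" using le[OF x0K] by linarith
  then have M: "M > 0" and nx0: "nrm x0 > 0" using nrm_ge_0[OF x0(1)] by (auto simp: zero_less_mult_iff)
  have "(1 / of_real (nrm x0)) *\<^sub>C x0 \<in> {x \<in> K. nrm x = 1}"
    using Ks[OF x0K] nx0 x0 by (simp add: nrm_scale norm_divide)
  then have Rne: "R \<noteq> {}" unfolding R_def by blast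
  have "\<exists>x. x \<in> K \<and> nrm x = 1 \<and> M - 1 / real (Suc n) < nrm (T x)" for n
  proof -
    have "M - 1 / real (Suc n) < Sup R" by (simp add: M_def)
    then show ?thesis using less_cSup_iff[OF Rne bdd] unfolding R_def by auto
  qed
  then obtain X where X: "\<And>n. X n \<in> K" "\<And>n. nrm (X n) = 1" "\<And>n. M - 1 / real (Suc n) < nrm (T (X n))" by metis
  obtain r :: "nat \<Rightarrow> nat" where r: "strict_mono r"
    "\<And>e. e > 0 \<Longrightarrow> \<exists>N. \<forall>m\<ge>N. \<forall>n\<ge>N. nrm (T (X (r m)) - T (X (r n))) < e"
    by (rule T_compact[of X]) (use X KH in auto)
  define Y where "Y n = X (r n)" for n
  have Y: "Y n \<in> H" "Y n \<in> K" "nrm (Y n) = 1" for n using X KH by (auto simp: Y_def)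
  have inv: "(\<lambda>n. 1 / real (Suc n)) \<longlonglongrightarrow> 0"
    using LIMSEQ_inverse_real_of_nat by (simp add: inverse_eq_divide)
  have Ylim: "(\<lambda>n. nrm (T (Y n))) \<longlonglongrightarrow> M"
  proof -
    have sw: "M - 1 / real (Suc n) \<le> nrm (T (X n))" "nrm (T (X n)) \<le> M" for n
      using X(3)[of n] le[OF X(1)[of n]] X(2)[of n] by auto
    have "(\<lambda>n. M - 1 / real (Suc n)) \<longlonglongrightarrow> M"
      using tendsto_diff[OF tendsto_const[of M] inv] by (simp only: diff_0_right)
    then have "(\<lambda>n. nrm (T (X n))) \<longlonglongrightarrow> M"
      by (rule tendsto_sandwich[OF _ _ _ tendsto_const, rotated 2]) (use sw in \<open>auto intro!: always_eventually\<close>)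
    from LIMSEQ_subseq_LIMSEQ[OF this r(1)] show ?thesis by (simp add: Y_def o_def)
  qed
  have "\<exists>N. \<forall>m\<ge>N. \<forall>n\<ge>N. nrm (Y m - Y n) < e" if e: "e > 0" for e
  proof -
    \<comment> \<open>The lower bound \<open>2 - 3 * \<delta> / M\<close> for
      \<open>nrm (Y m + Y n)\<close> is squared and subtracted from 4 in the parallelogram law,
      which leaves at most \<open>12 * \<delta> / M\<close>. The first bound on
      \<open>\<delta>\<close> makes this at most \<open>e\<^sup>2\<close>; the second keeps the
      lower bound positive, so that squaring is monotone.\<close>
    define \<delta> where "\<delta> = min (e\<^sup>2 * M / 12) (M / 2)"
    have \<delta>: "\<delta> > 0" "\<delta> \<le> e\<^sup>2 * M / 12" "2 * \<delta> \<le> M" using e M by (auto simp: \<delta>_def)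
    obtain N1 where N1: "\<And>n. n \<ge> N1 \<Longrightarrow> M - \<delta> < nrm (T (Y n))"
      using order_tendstoD(1)[OF Ylim, of "M - \<delta>"] \<delta>(1) by (auto simp: eventually_sequentially)
    obtain N2 where N2: "\<forall>m\<ge>N2. \<forall>n\<ge>N2. nrm (T (Y m) - T (Y n)) < \<delta>"
      using r(2)[OF \<delta>(1)] by (auto simp: Y_def)
    have "nrm (Y m - Y n) < e" if mn: "m \<ge> max N1 N2" "n \<ge> max N1 N2" for m n
    proof -
      have "2 * nrm (T (Y m)) = nrm (2 *\<^sub>C T (Y m))" using Y by (simp add: nrm_scale)
      also have "2 *\<^sub>C T (Y m) = T (Y m + Y n) + (T (Y m) - T (Y n))"
        using Y scale_left_distrib[of 1 1 "T (Y m)"] by (simp add: T_add)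
      also have "nrm \<dots> \<le> nrm (T (Y m + Y n)) + nrm (T (Y m) - T (Y n))" using Y by (intro nrm_triangle) auto
      also have "nrm (T (Y m + Y n)) \<le> M * nrm (Y m + Y n)" using Y Ka by (intro le) auto
      finally have "2 * M - 3 * \<delta> < M * nrm (Y m + Y n)"
        using N1[of m] N2 mn by fastforce
      then have "2 - 3 * \<delta> / M < nrm (Y m + Y n)" using M by (simp add: field_simps)
      then have "(2 - 3 * \<delta> / M)\<^sup>2 < (nrm (Y m + Y n))\<^sup>2"
        using \<delta> M by (intro power_strict_mono) (auto simp: field_simps)
      moreover have "(nrm (Y m + Y n))\<^sup>2 + (nrm (Y m - Y n))\<^sup>2 = 4"
        using Y by (simp add: nrm_add_power2 nrm_diff_power2)
      moreover have "4 - 12 * \<delta> / M \<le> (2 - 3 * \<delta> / M)\<^sup>2" by (simp add: power2_diff)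
      moreover have "12 * \<delta> / M \<le> e\<^sup>2" using \<delta>(2) M by (simp add: field_simps)
      ultimately have "(nrm (Y m - Y n))\<^sup>2 < e\<^sup>2" by linarith
      then show ?thesis by (rule power2_less_imp_less) (use e in simp)
    qed
    then show ?thesis by blast
  qed
  then obtain e where e: "e \<in> H" "(\<lambda>n. nrm (Y n - e)) \<longlonglongrightarrow> 0"
    using complete_nrm[of Y] Y by metis
  have e0: "ip e z = 0" if z: "z \<in> O'" for z
  proof -
    have "(\<lambda>n. ip (Y n) z) \<longlonglongrightarrow> ip e z" using Y e z assms(1) by (intro ip_tendsto) auto
    moreover have "ip (Y n) z = 0" for n using Y(2)[of n] z by (simp add: K_def)
    ultimately show ?thesis by (simp add: LIMSEQ_const_iff)
  qed
  have "(\<lambda>n. nrm (Y n)) \<longlonglongrightarrow> nrm e" using Y e by (intro nrm_tendsto) auto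
  then have e1: "nrm e = 1" using Y(3) by (simp add: LIMSEQ_const_iff)
  have "(\<lambda>n. nrm (T (Y n) - T e)) \<longlonglongrightarrow> 0"
  proof (rule Lim_null_comparison)
    have "nrm (T (Y n) - T e) \<le> B * nrm (Y n - e)" for n
      using nrm_T_le[of "Y n - e"] Y e by (simp add: T_diff)
    then show "\<forall>\<^sub>F n in sequentially. norm (nrm (T (Y n) - T e)) \<le> B * nrm (Y n - e)" using Y e by simp
    show "(\<lambda>n. B * nrm (Y n - e)) \<longlonglongrightarrow> 0" using tendsto_mult_right_zero[OF e(2)] by simp
  qed
  then have "(\<lambda>n. nrm (T (Y n))) \<longlonglongrightarrow> nrm (T e)" using Y e by (intro nrm_tendsto) auto
  then have "nrm (T e) = M" using Ylim LIMSEQ_unique by blast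
  then show ?thesis using that[of e] e(1) e0 e1 le unfolding K_def by blast
qed

text \<open>\<open>singular e\<close> says that \<open>e\<close> is an eigenvector of \<open>T\<^sup>*T\<close>, without mentioning the adjoint.\<close>

definition singular :: "'v \<Rightarrow> bool" where
  "singular e \<longleftrightarrow> (\<forall>y\<in>H. ip e y = 0 \<longrightarrow> ip (T e) (T y) = 0)"

text \<open>First-order optimality: perturb a maximizer of \<open>\<parallel>T x\<parallel>\<close> in the direction \<open>y\<close>.\<close>

lemma maximizer_orthogonal:
  assumes e: "e \<in> H" "nrm e = 1" and y: "y \<in> H" "ip e y = 0"
    and max: "\<And>t. nrm (T (e + t *\<^sub>C y)) \<le> nrm (T e) * nrm (e + t *\<^sub>C y)"
  shows "ip (T e) (T y) = 0"
proof (rule ccontr)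
  define p where "p = ip (T e) (T y)"
  assume "ip (T e) (T y) \<noteq> 0"
  then have p: "(cmod p)\<^sup>2 > 0" by (simp add: p_def)
  define Q where "Q = (nrm (T e))\<^sup>2 * (nrm y)\<^sup>2"
  have Q: "Q \<ge> 0" by (simp add: Q_def)
  \<comment> \<open>Moving by \<open>t = s p\<close> gains \<open>2 s\<close> times the squared
    modulus of \<open>p\<close> to first order and loses at most \<open>s * s * Q\<close> times it
    to second order, so any positive \<open>s\<close> with \<open>s * Q < 2\<close> contradicts
    maximality.\<close>
  define s where "s = 1 / (Q + 1)"
  have s: "s > 0" "s * Q < 2" using Q by (auto simp: s_def field_simps)
  define t where "t = of_real s * p"
  have "(nrm (T (e + t *\<^sub>C y)))\<^sup>2 \<le> (nrm (T e) * nrm (e + t *\<^sub>C y))\<^sup>2"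
    using max e y by (intro power_mono) auto
  also have "\<dots> = (nrm (T e))\<^sup>2 * (1 + (cmod t)\<^sup>2 * (nrm y)\<^sup>2)"
    using e y by (simp add: power_mult_distrib nrm_add_power2 ip_scale_right nrm_scale)
  also have "(nrm (T (e + t *\<^sub>C y)))\<^sup>2 = (nrm (T e))\<^sup>2 + (cmod t)\<^sup>2 * (nrm (T y))\<^sup>2 + 2 * Re (cnj t * p)"
    using e y by (simp add: T_add T_scale nrm_add_power2 ip_scale_right nrm_scale power_mult_distrib p_def)
  also have "Re (cnj t * p) = s * (cmod p)\<^sup>2"
  proof -
    have "cnj t * p = of_real s * (p * cnj p)" by (simp add: t_def mult_ac)
    also have "p * cnj p = of_real ((cmod p)\<^sup>2)" by (simp only: complex_norm_square)
    finally show ?thesis by simp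
  qed
  finally have "2 * s * (cmod p)\<^sup>2 + (cmod t)\<^sup>2 * (nrm (T y))\<^sup>2 \<le> (cmod t)\<^sup>2 * Q"
    by (simp add: Q_def algebra_simps)
  moreover have "0 \<le> (cmod t)\<^sup>2 * (nrm (T y))\<^sup>2" by simp
  moreover have "(cmod t)\<^sup>2 * Q = s * (cmod p)\<^sup>2 * (s * Q)"
    by (simp add: t_def norm_mult power_mult_distrib power2_eq_square)
  moreover have "s * (cmod p)\<^sup>2 * (s * Q) < s * (cmod p)\<^sup>2 * 2"
    using s p by (intro mult_strict_left_mono) auto
  ultimately show False by linarith
qed

text \<open>A maximal orthonormal set of singular vectors is a basis, since a maximizer on its orthogonal
  complement could be added to it.\<close>

lemma singular_onb_exists:
  obtains E where "onb E" "\<forall>e\<in>E. singular e"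
proof -
  define \<A> where "\<A> = {E. orthonormal id E \<and> (\<forall>e\<in>E. singular e)}"
  have "\<exists>E\<in>\<A>. \<forall>X\<in>\<A>. E \<subseteq> X \<longrightarrow> X = E"
  proof (rule subset_Zorn')
    fix C assume C: "subset.chain \<A> C"
    have "\<exists>X\<in>C. x \<in> X \<and> y \<in> X" if xy: "x \<in> \<Union>C" "y \<in> \<Union>C" for x y
    proof -
      obtain X1 X2 where X: "X1 \<in> C" "X2 \<in> C" "x \<in> X1" "y \<in> X2" using xy by blast
      then have "X1 \<subseteq> X2 \<or> X2 \<subseteq> X1" using C by (auto simp: subset_chain_def)
      then show ?thesis using X by blast
    qed
    note common = this
    have X: "orthonormal id X" "\<And>e. e \<in> X \<Longrightarrow> singular e" if "X \<in> C" for X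
      using C that unfolding subset_chain_def \<A>_def by blast+
    have "ip x y = (if x = y then 1 else 0)" if "x \<in> \<Union>C" "y \<in> \<Union>C" for x y
    proof -
      obtain Y where Y: "Y \<in> C" "x \<in> Y" "y \<in> Y" using common \<open>x \<in> \<Union>C\<close> \<open>y \<in> \<Union>C\<close> by blast
      show ?thesis using orthonormalD[OF X(1)[OF Y(1)] Y(2,3)] by simp
    qed
    moreover have "\<Union>C \<subseteq> H" using X(1) by (auto simp: orthonormal_def)
    ultimately have "orthonormal id (\<Union>C)" by (simp add: orthonormal_def)
    then show "\<Union>C \<in> \<A>" unfolding \<A>_def using X(2) by blast
  qed
  then obtain E where E\<A>: "E \<in> \<A>" and maxE: "\<And>X. X \<in> \<A> \<Longrightarrow> E \<subseteq> X \<Longrightarrow> X = E" by blast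
  have E: "orthonormal id E" "\<And>e. e \<in> E \<Longrightarrow> singular e" using E\<A> by (auto simp: \<A>_def)
  have EH: "E \<subseteq> H" using E by (auto simp: orthonormal_def)
  have "x = 0" if x: "x \<in> H" "\<forall>e\<in>E. ip x e = 0" for x
  proof (rule ccontr)
    assume "x \<noteq> 0"
    then have nx: "nrm x > 0" using nrm_eq_0[OF x(1)] nrm_ge_0[OF x(1)] by linarith
    have "\<exists>e\<in>H. nrm e = 1 \<and> (\<forall>z\<in>E. ip e z = 0) \<and> singular e"
    proof (cases "\<exists>x0\<in>H. (\<forall>z\<in>E. ip x0 z = 0) \<and> T x0 \<noteq> 0")
      case True
      then obtain x0 where x0: "x0 \<in> H" "\<And>z. z \<in> E \<Longrightarrow> ip x0 z = 0" "T x0 \<noteq> 0" by blast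
      obtain e where e: "e \<in> H" "\<And>z. z \<in> E \<Longrightarrow> ip e z = 0" "nrm e = 1"
        and max: "\<And>x. \<lbrakk>x \<in> H; \<And>z. z \<in> E \<Longrightarrow> ip x z = 0\<rbrakk> \<Longrightarrow> nrm (T x) \<le> nrm (T e) * nrm x"
        using maximizer[OF EH x0] by metis
      have "ip (T e) (T y) = 0" if y: "y \<in> H" "ip e y = 0" for y
      proof -
        \<comment> \<open>Maximality of \<open>e\<close> only concerns directions orthogonal to
          \<open>E\<close>. So \<open>y\<close> is split into \<open>y2\<close> in the closed span
          of \<open>E\<close>, where singularity of the members of \<open>E\<close> applies, and
          \<open>y1\<close> orthogonal to \<open>E\<close>.\<close>
        have suy: "(\<lambda>z. (cmod (ip y z))\<^sup>2) summable_on E" using Bessel_summable[OF E(1) y(1)] by simp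
        obtain y2 where y2: "y2 \<in> H" "\<And>z. z \<in> E \<Longrightarrow> ip y2 (id z) = ip y z" "(nrm y2)\<^sup>2 = (\<Sum>\<^sub>\<infinity>z\<in>E. (cmod (ip y z))\<^sup>2)"
          and y2': "\<forall>\<mu> C. functional \<mu> \<longrightarrow> (\<forall>x\<in>H. cmod (\<mu> x) \<le> C * nrm x) \<longrightarrow> (\<forall>z\<in>E. \<mu> (id z) = 0) \<longrightarrow> \<mu> y2 = 0"
          by (rule Riesz_Fischer[OF E(1) suy]) (rule that)
        note y2 = y2[unfolded id_apply]
        have y2f: "\<mu> y2 = 0" if "functional \<mu>" "\<And>x. x \<in> H \<Longrightarrow> cmod (\<mu> x) \<le> C * nrm x" "\<And>z. z \<in> E \<Longrightarrow> \<mu> z = 0" for \<mu> C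
          using y2'[rule_format, OF that(1), of C] that(2,3) by simp
        have ez: "ip z e = 0" if "z \<in> E" for z using e(2)[OF that] ip_cnj[of e z] e(1) EH that by auto
        have "ip y2 e = 0"
        proof (rule y2f[OF functional_ip[OF e(1)] _ ez])
          show "cmod (ip x e) \<le> 1 * nrm x" if "x \<in> H" for x using Cauchy_Schwarz[OF that e(1)] e(3) by simp
        qed
        then have ey2: "ip e y2 = 0" using ip_cnj[OF y2(1) e(1)] by simp
        have "ip (T y2) (T e) = 0"
        proof (rule y2f[OF functional_ip_T[OF T_H[OF e(1)]] functional_ip_T_bound[OF _ T_H[OF e(1)]]])
          fix z assume z: "z \<in> E"
          then show "ip (T z) (T e) = 0" using E(2)[OF z] ez[OF z] e(1) unfolding singular_def by blast
        qed
        then have Ty2: "ip (T e) (T y2) = 0" using ip_cnj[of "T y2" "T e"] y2(1) e(1) by simp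
        define y1 where "y1 = y - y2"
        have y1: "y1 \<in> H" "ip e y1 = 0" unfolding y1_def using y y2(1) e(1) ey2 by (auto simp: ip_diff_right)
        have y1z: "ip y1 z = 0" if "z \<in> E" for z unfolding y1_def using y y2 that EH by (subst ip_diff) auto
        have "ip (T e) (T y1) = 0"
        proof (rule maximizer_orthogonal[OF e(1,3) y1])
          fix t show "nrm (T (e + t *\<^sub>C y1)) \<le> nrm (T e) * nrm (e + t *\<^sub>C y1)"
          proof (rule max)
            show "ip (e + t *\<^sub>C y1) z = 0" if "z \<in> E" for z
              using e(1) e(2)[OF that] y1(1) y1z[OF that] EH that by (subst ip_add) (auto simp: ip_scale)
          qed (use e(1) y1(1) in auto)
        qed
        moreover have "T y = T y1 + T y2" unfolding y1_def using y y2(1) by (simp add: T_diff)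
        ultimately show ?thesis using Ty2 e(1) y1(1) y2(1) by (simp add: ip_add_right)
      qed
      then show ?thesis using e unfolding singular_def by blast
    next
      \<comment> \<open>Here \<open>T\<close> vanishes on the orthogonal complement of
        \<open>E\<close>, so every unit vector of it is singular.\<close>
      case False
      define e where "e = (1 / of_real (nrm x)) *\<^sub>C x"
      have "e \<in> H" "nrm e = 1" unfolding e_def using nx x by (auto simp: nrm_scale norm_divide)
      moreover have ez: "\<forall>z\<in>E. ip e z = 0" unfolding e_def using x EH by (auto simp: ip_scale subset_iff)
      moreover have "T e = 0" using False ez \<open>e \<in> H\<close> by blast
      ultimately show ?thesis unfolding singular_def by (auto simp: ip_0)
    qed
    then obtain e where e: "e \<in> H" "nrm e = 1" "\<And>z. z \<in> E \<Longrightarrow> ip e z = 0" "singular e" by blast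
    have ee: "ip e e = 1" using e by (simp add: ip_same)
    have ez: "ip z e = 0" if "z \<in> E" for z using e(3)[OF that] ip_cnj[of e z] e(1) EH that by auto
    have "e \<notin> E" using e(3)[of e] ee by auto
    moreover have "orthonormal id (insert e E)"
      using E(1) e ez ee \<open>e \<notin> E\<close> unfolding orthonormal_def by auto
    then have "insert e E \<in> \<A>" unfolding \<A>_def using E(2) e(4) by auto
    then have "insert e E = E" using maxE by blast
    ultimately show False by blast
  qed
  then have "onb E" unfolding onb_def using E(1) by blast
  then show ?thesis using that E(2) by blast
qed

end

section \<open>Singular values, absolute value and trace of a nuclear operator\<close>

context nuclear_op begin

text \<open>The eigenvector equation of T*T in weak form: the part of \<open>x\<close> orthogonal to
  \<open>e\<close> contributes nothing by \<open>singular\<close>, and the part along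
  \<open>e\<close> gives the eigenvalue.\<close>

lemma T_ip_singular:
  assumes "singular e" "e \<in> H" "nrm e = 1" "x \<in> H"
  shows "ip (T x) (T e) = of_real ((nrm (T e))\<^sup>2) * ip x e"
proof -
  define y where "y = x - ip x e *\<^sub>C e"
  have y: "y \<in> H" unfolding y_def using assms by auto
  have "ip y e = 0" unfolding y_def using assms by (simp add: ip_diff ip_scale ip_same)
  then have "ip e y = 0" using ip_cnj[OF y assms(2)] by simp
  then have "ip (T e) (T y) = 0" using assms(1) y by (simp add: singular_def)
  then have "ip (T y) (T e) = 0" using ip_cnj[of "T e" "T y"] y assms by simp
  moreover have "T y = T x - ip x e *\<^sub>C T e" unfolding y_def using assms by (simp add: T_diff T_scale)
  ultimately show ?thesis using assms by (simp add: ip_diff ip_scale ip_same)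
qed

text \<open>Images of distinct members of \<open>E\<close> are orthogonal, so the normalized images
  \<open>g e\<close> are again orthonormal, and \<open>nrm (T e)\<close> equals
  \<open>ip (T e) (g e)\<close>. After inserting the nuclear representation, the Cauchy-Schwarz
  inequality over \<open>e\<close> and two Bessel bounds estimate the \<open>i\<close>-th term by
  \<open>c i * nrm (a i)\<close>.\<close>

lemma singular_values_summable:
  assumes "onb E" "\<And>e. e \<in> E \<Longrightarrow> singular e"
  shows "(\<lambda>e. nrm (T e)) summable_on E"
proof (rule nonneg_bdd_above_summable_on)
  have on: "orthonormal id E" using assms by (simp add: onb_def)
  have EH: "e \<in> H" if "e \<in> E" for e using orthonormal_in_H[OF on that] by simp
  show "0 \<le> nrm (T e)" if "e \<in> E" for e using EH[OF that] by auto
  have "(\<Sum>e\<in>F. nrm (T e)) \<le> B" if F: "F \<subseteq> E" "finite F" for F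
  proof -
    \<comment> \<open>Vectors with \<open>T e = 0\<close> cannot be normalized and contribute
      nothing to the sum.\<close>
    define F' where "F' = {e \<in> F. T e \<noteq> 0}"
    have F': "finite F'" "F' \<subseteq> E" using F by (auto simp: F'_def)
    define g where "g e = (1 / of_real (nrm (T e))) *\<^sub>C T e" for e
    have pos: "nrm (T e) > 0" if "e \<in> F'" for e
      using that F' EH nrm_eq_0[of "T e"] nrm_ge_0[of "T e"] unfolding F'_def by (force simp: less_le)
    have gH: "g e \<in> H" if "e \<in> F'" for e unfolding g_def using EH F' that by auto
    have "ip (g e) (g e') = (if e = e' then 1 else 0)" if e: "e \<in> F'" "e' \<in> F'" for e e'
    proof (cases "e = e'")
      case True
      have "nrm (g e) = 1" unfolding g_def using pos[OF e(1)] EH F' e by (subst nrm_scale) (auto simp: norm_divide)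
      then show ?thesis using True gH e by (simp add: ip_same)
    next
      case False
      have eE: "e \<in> E" "e' \<in> E" using e F' by auto
      then have "ip e e' = 0" using orthonormalD[OF on eE] False by simp
      then have "ip (T e) (T e') = 0" using assms(2)[OF eE(1)] EH[OF eE(2)] by (simp add: singular_def)
      then show ?thesis using False EH eE by (simp add: g_def ip_scale ip_scale_right)
    qed
    then have gon: "orthonormal g F'" using gH by (auto simp: orthonormal_def)
    have Tg: "ip (T e) (g e) = of_real (nrm (T e))" if "e \<in> F'" for e
      using pos[OF that] EH F' that by (simp add: g_def ip_scale_right ip_same power2_eq_square subset_iff)
    have rep: "((\<lambda>i. \<Sum>e\<in>F''. la i e * ip (a i) (g e)) has_sum (\<Sum>e\<in>F''. ip (T e) (g e))) I" if "F'' \<subseteq> F'" for F''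
      using finite_subset[OF that F'(1)] that
    proof (induction F'')
      case (insert x F'')
      then have "((\<lambda>i. la i x * ip (a i) (g x) + (\<Sum>e\<in>F''. la i e * ip (a i) (g e))) has_sum (ip (T x) (g x) + (\<Sum>e\<in>F''. ip (T e) (g e)))) I"
        using gH EH F' by (intro has_sum_add T_rep) auto
      then show ?case using insert by simp
    qed simp
    have "(\<Sum>e\<in>F. nrm (T e)) = (\<Sum>e\<in>F'. nrm (T e))"
      unfolding F'_def using F by (intro sum.mono_neutral_right) auto
    also have "\<dots> = norm (\<Sum>e\<in>F'. ip (T e) (g e))"
    proof -
      have "(\<Sum>e\<in>F'. ip (T e) (g e)) = of_real (\<Sum>e\<in>F'. nrm (T e))" by (simp add: Tg)
      moreover have "0 \<le> (\<Sum>e\<in>F'. nrm (T e))" using pos by (intro sum_nonneg less_imp_le)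
      ultimately show ?thesis by (simp only: norm_of_real abs_of_nonneg)
    qed
    also have "\<dots> \<le> B"
    proof (rule norm_infsum_le[OF rep[OF subset_refl]])
      show "((\<lambda>i. c i * nrm (a i)) has_sum B) I" unfolding B_def using summable_ca by (rule has_sum_infsum)
      fix i assume i: "i \<in> I"
      have "norm (\<Sum>e\<in>F'. la i e * ip (a i) (g e)) \<le> (\<Sum>e\<in>F'. cmod (la i e) * cmod (ip (a i) (g e)))"
        using norm_sum[of "\<lambda>e. la i e * ip (a i) (g e)" F'] by (simp add: norm_mult)
      also have "\<dots> \<le> L2_set (\<lambda>e. cmod (la i e)) F' * L2_set (\<lambda>e. cmod (ip (a i) (g e))) F'"
        using L2_set_mult_ineq[of "\<lambda>e. cmod (la i e)" "\<lambda>e. cmod (ip (a i) (g e))" F'] by simp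
      also have "\<dots> \<le> c i * nrm (a i)"
      proof (intro mult_mono)
        have "(\<Sum>e\<in>F'. (cmod (la i (id e)))\<^sup>2) \<le> (c i)\<^sup>2"
          by (rule functional_Bessel[OF functional_la[OF i] la_bound[OF i] c_ge_0[OF i] orthonormal_subset[OF on F'(2)] F'(1)])
        then show "L2_set (\<lambda>e. cmod (la i e)) F' \<le> c i"
          using c_ge_0[OF i] by (simp add: L2_set_def real_le_lsqrt sum_nonneg)
        have "(\<Sum>e\<in>F'. (cmod (ip (a i) (g e)))\<^sup>2) \<le> (nrm (a i))\<^sup>2"
          by (rule Bessel_inequality[OF gon F'(1) a_H[OF i]])
        then show "L2_set (\<lambda>e. cmod (ip (a i) (g e))) F' \<le> nrm (a i)"
          using i by (simp add: L2_set_def real_le_lsqrt sum_nonneg)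
      qed (use c_ge_0[OF i] in auto)
      finally show "norm (\<Sum>e\<in>F'. la i e * ip (a i) (g e)) \<le> c i * nrm (a i)" .
    qed
    finally show ?thesis .
  qed
  then show "bdd_above (sum (\<lambda>e. nrm (T e)) ` {F. F \<subseteq> E \<and> finite F})"
    by (intro bdd_aboveI[of _ B]) auto
qed

lemma onb_eqI:
  assumes "onb E" "x \<in> H" "y \<in> H" "\<And>e. e \<in> E \<Longrightarrow> ip x e = ip y e"
  shows "x = y"
proof -
  have "ip (x - y) e = 0" if "e \<in> E" for e
    using assms that by (subst ip_diff) (auto simp: onb_def orthonormal_def)
  then have "x - y = 0" using assms unfolding onb_def by blast
  then show ?thesis by simp
qed

text \<open>\<open>P\<close> is diagonal in a basis of singular vectors with entries
  \<open>nrm (T e)\<close>; Riesz-Fischer provides \<open>P x\<close> because the entries are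
  bounded by \<open>B\<close>. Positivity and the identity between P squared and T*T are checked on
  coefficients, and the diagonal of \<open>P\<close> is the summable family of singular
  values.\<close>

lemma abs_op_exists:
  obtains P E where "\<And>x. x \<in> H \<Longrightarrow> P x \<in> H"
    "\<And>x y. x \<in> H \<Longrightarrow> y \<in> H \<Longrightarrow> P (x + y) = P x + P y"
    "\<And>b x. x \<in> H \<Longrightarrow> P (b *\<^sub>C x) = b *\<^sub>C P x"
    "\<And>x. x \<in> H \<Longrightarrow> nrm (P x) \<le> B * nrm x"
    "\<And>x. x \<in> H \<Longrightarrow> Im (ip (P x) x) = 0 \<and> 0 \<le> Re (ip (P x) x)"
    "\<And>x y. x \<in> H \<Longrightarrow> y \<in> H \<Longrightarrow> ip (P (P x)) y = ip (T x) (T y)"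
    "onb E" "(\<lambda>e. ip (P e) e) summable_on E"
proof -
  obtain E where E: "onb E" "\<forall>e\<in>E. singular e" by (rule singular_onb_exists)
  note E = E(1) E(2)[rule_format]
  have on: "orthonormal id E" using E by (simp add: onb_def)
  have EH: "e \<in> H" if "e \<in> E" for e using orthonormal_in_H[OF on that] by simp
  have e1: "nrm e = 1" if "e \<in> E" for e
    using orthonormalD[OF on that that] EH[OF that] by (simp add: nrm_def)
  define s where "s e = nrm (T e)" for e
  have s: "0 \<le> s e" "s e \<le> B" if "e \<in> E" for e
    using nrm_T_le[OF EH[OF that]] e1[OF that] EH[OF that] by (auto simp: s_def)
  have "\<exists>y. y \<in> H \<and> (\<forall>e\<in>E. ip y e = of_real (s e) * ip x e)" if x: "x \<in> H" for x
  proof -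
    have "(\<lambda>e. (cmod (of_real (s e) * ip x e))\<^sup>2) summable_on E"
    proof (rule summable_on_comparison_test)
      show "(\<lambda>e. B\<^sup>2 * (cmod (ip x e))\<^sup>2) summable_on E"
        using Bessel_summable[OF on x] by (intro summable_on_cmult_right) simp
      fix e assume e: "e \<in> E"
      show "(cmod (of_real (s e) * ip x e))\<^sup>2 \<le> B\<^sup>2 * (cmod (ip x e))\<^sup>2"
        using s[OF e] by (auto simp: norm_mult power_mult_distrib intro!: mult_right_mono power_mono)
    qed auto
    from Riesz_Fischer[OF on this] show ?thesis by (metis id_apply)
  qed
  then obtain P where P0: "\<forall>x\<in>H. P x \<in> H \<and> (\<forall>e\<in>E. ip (P x) e = of_real (s e) * ip x e)"
    by metis
  have P: "P x \<in> H" "\<And>e. e \<in> E \<Longrightarrow> ip (P x) e = of_real (s e) * ip x e" if "x \<in> H" for x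
    using P0 that by auto
  show ?thesis
  proof (rule that[of P E])
    show "P (x + y) = P x + P y" if "x \<in> H" "y \<in> H" for x y
      by (rule onb_eqI[OF E(1)]) (use that P EH in \<open>auto simp: ip_add algebra_simps\<close>)
    show "P (b *\<^sub>C x) = b *\<^sub>C P x" if "x \<in> H" for x b
      by (rule onb_eqI[OF E(1)]) (use that P EH in \<open>auto simp: ip_scale algebra_simps\<close>)
    show "nrm (P x) \<le> B * nrm x" if x: "x \<in> H" for x
    proof (rule power2_le_imp_le)
      have "(nrm (P x))\<^sup>2 \<le> B\<^sup>2 * (nrm x)\<^sup>2"
      proof (rule has_sum_mono[OF Parseval[OF E(1) P(1)[OF x]] has_sum_cmult_right[OF Parseval[OF E(1) x]]])
        fix e assume e: "e \<in> E"
        show "(cmod (ip (P x) e))\<^sup>2 \<le> B\<^sup>2 * (cmod (ip x e))\<^sup>2"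
          using s[OF e] by (auto simp: P[OF x] e norm_mult power_mult_distrib intro!: mult_right_mono power_mono)
      qed
      then show "(nrm (P x))\<^sup>2 \<le> (B * nrm x)\<^sup>2" by (simp add: power_mult_distrib)
    qed (use B_ge_0 x in simp)
    show "Im (ip (P x) x) = 0 \<and> 0 \<le> Re (ip (P x) x)" if x: "x \<in> H" for x
    proof -
      have "((\<lambda>e. ip (P x) e * cnj (ip x e)) has_sum ip (P x) x) E"
        by (rule Parseval_ip[OF E(1) P(1)[OF x] x])
      moreover have "ip (P x) e * cnj (ip x e) = of_real (s e * (cmod (ip x e))\<^sup>2)" if "e \<in> E" for e
        using P(2)[OF x that] by (simp add: mult.assoc complex_norm_square del: of_real_power)
      ultimately have hs: "((\<lambda>e. of_real (s e * (cmod (ip x e))\<^sup>2) :: complex) has_sum ip (P x) x) E"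
        by (simp cong: has_sum_cong)
      have "((\<lambda>e. Im (of_real (s e * (cmod (ip x e))\<^sup>2))) has_sum 0) E" by (rule has_sum_0) simp
      with has_sum_Im[OF hs] have "Im (ip (P x) x) = 0" by (rule has_sum_unique)
      moreover from has_sum_Re[OF hs] have "0 \<le> Re (ip (P x) x)"
        by (rule has_sum_nonneg) (use s in auto)
      ultimately show ?thesis by blast
    qed
    show "ip (P (P x)) y = ip (T x) (T y)" if xy: "x \<in> H" "y \<in> H" for x y
    proof -
      have "((\<lambda>e. ip (P (P x)) e * cnj (ip y e)) has_sum ip (P (P x)) y) E"
        by (rule Parseval_ip[OF E(1) P(1)[OF P(1)[OF xy(1)]] xy(2)])
      then have 1: "((\<lambda>e. of_real ((s e)\<^sup>2) * ip x e * cnj (ip y e)) has_sum ip (P (P x)) y) E"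
        using P xy by (simp add: power2_eq_square mult.assoc cong: has_sum_cong)
      \<comment> \<open>Expanding \<open>y\<close> leaves the factors \<open>ip (T e) (T x)\<close>,
        which \<open>T_ip_singular\<close> evaluates after conjugation.\<close>
      have "((\<lambda>e. ip y e * ip (T e) (T x)) has_sum ip (T y) (T x)) E"
        by (rule functional_expansion[OF E(1) xy(2) functional_ip_T functional_ip_T_bound]) (use xy in auto)
      moreover have "ip (T x) (T y) = cnj (ip (T y) (T x))" using xy ip_cnj[of "T y" "T x"] by simp
      ultimately have 2: "((\<lambda>e. cnj (ip y e * ip (T e) (T x))) has_sum ip (T x) (T y)) E"
        by (simp only: has_sum_cnj_iff)
      have "cnj (ip y e * ip (T e) (T x)) = of_real ((s e)\<^sup>2) * ip x e * cnj (ip y e)" if "e \<in> E" for e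
        using T_ip_singular[OF E(2)[OF that] EH[OF that] e1[OF that] xy(1)] ip_cnj[of "T e" "T x"] EH[OF that] xy
        by (simp add: s_def mult_ac)
      from has_sum_cong[THEN iffD1, OF this 2]
      have "((\<lambda>e. of_real ((s e)\<^sup>2) * ip x e * cnj (ip y e)) has_sum ip (T x) (T y)) E" .
      then show ?thesis using 1 has_sum_unique by blast
    qed
    have "(\<lambda>e. of_real (s e) :: complex) summable_on E"
      using singular_values_summable[OF E] unfolding s_def[symmetric] by (rule summable_on_of_real)
    then show "(\<lambda>e. ip (P e) e) summable_on E"
      using P EH e1 by (simp add: ip_same cong: summable_on_cong)
  qed (use P E in auto)
qed

text \<open>The double family \<open>la i e * ip (a i) e\<close> is absolutely summable by
  Cauchy-Schwarz and Bessel. Summed over \<open>e\<close> first it gives \<open>la i (a i)\<close>,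
  summed over \<open>i\<close> first it gives \<open>ip (T e) e\<close>; the value does not depend
  on the basis.\<close>

lemma trace_has_sum:
  assumes E: "onb E"
  shows "((\<lambda>e. ip (T e) e) has_sum (\<Sum>\<^sub>\<infinity>i\<in>I. la i (a i))) E"
proof -
  have on: "orthonormal id E" using E by (simp add: onb_def)
  have EH: "e \<in> H" if "e \<in> E" for e using orthonormal_in_H[OF on that] by simp
  define f where "f = (\<lambda>(i, e). la i e * ip (a i) e)"
  have finle: "(\<Sum>e\<in>F. norm (f (i, e))) \<le> c i * nrm (a i)" if F: "finite F" "F \<subseteq> E" and i: "i \<in> I" for F i
  proof -
    have onF: "orthonormal id F" using on F(2) by (rule orthonormal_subset)
    have "(\<Sum>e\<in>F. norm (f (i, e))) \<le> L2_set (\<lambda>e. cmod (la i e)) F * L2_set (\<lambda>e. cmod (ip (a i) e)) F"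
      using L2_set_mult_ineq[of "\<lambda>e. cmod (la i e)" "\<lambda>e. cmod (ip (a i) e)" F] by (simp add: f_def norm_mult)
    also have "\<dots> \<le> c i * nrm (a i)"
    proof (intro mult_mono)
      show "L2_set (\<lambda>e. cmod (la i e)) F \<le> c i"
        using functional_Bessel[OF functional_la[OF i] la_bound[OF i] c_ge_0[OF i] onF F(1)] c_ge_0[OF i]
        by (simp add: L2_set_def real_le_lsqrt sum_nonneg)
      show "L2_set (\<lambda>e. cmod (ip (a i) e)) F \<le> nrm (a i)"
        using Bessel_inequality[OF onF F(1) a_H[OF i]] i by (simp add: L2_set_def real_le_lsqrt sum_nonneg)
    qed (use c_ge_0[OF i] in auto)
    finally show ?thesis .
  qed
  have "(\<lambda>p. norm (f p)) summable_on (I \<times> E)"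
  proof (rule nonneg_bdd_above_summable_on)
    have "(\<Sum>p\<in>F. norm (f p)) \<le> B" if F: "F \<subseteq> I \<times> E" "finite F" for F
    proof -
      \<comment> \<open>A finite set of pairs is enlarged to a rectangle, on which the sum over
        \<open>e\<close> is bounded for each \<open>i\<close>.\<close>
      have "(\<Sum>p\<in>F. norm (f p)) \<le> (\<Sum>p\<in>fst ` F \<times> snd ` F. norm (f p))"
        using F by (intro sum_mono2) (auto simp: image_iff, force+)
      also have "\<dots> = (\<Sum>i\<in>fst ` F. \<Sum>e\<in>snd ` F. norm (f (i, e)))" by (simp add: sum.cartesian_product)
      also have "\<dots> \<le> (\<Sum>i\<in>fst ` F. c i * nrm (a i))" using F by (intro sum_mono finle) auto
      also have "\<dots> \<le> B" unfolding B_def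
        using F c_ge_0 by (intro finite_sum_le_infsum summable_ca) auto
      finally show ?thesis .
    qed
    then show "bdd_above (sum (\<lambda>p. norm (f p)) ` {F. F \<subseteq> I \<times> E \<and> finite F})"
      by (intro bdd_aboveI[of _ B]) auto
  qed auto
  then have "f summable_on (I \<times> E)" by (rule abs_summable_summable)
  then have hs: "(f has_sum infsum f (I \<times> E)) (I \<times> E)" by (rule has_sum_infsum)
  have inner: "((\<lambda>e. f (i, e)) has_sum la i (a i)) E" if i: "i \<in> I" for i
    using functional_expansion[OF E a_H[OF i] functional_la[OF i] la_bound[OF i]]
    by (simp add: f_def mult.commute)
  have "((\<lambda>i. la i (a i)) has_sum infsum f (I \<times> E)) I"
    using has_sum_SigmaD[OF hs inner] by simp
  then have t: "infsum f (I \<times> E) = (\<Sum>\<^sub>\<infinity>i\<in>I. la i (a i))" by (simp add: infsumI)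
  have hs': "((\<lambda>(e, i). f (i, e)) has_sum infsum f (I \<times> E)) (E \<times> I)"
    using hs by (subst has_sum_swap) simp
  have "((\<lambda>i. (\<lambda>(e, i). f (i, e)) (e, i)) has_sum ip (T e) e) I" if "e \<in> E" for e
    using T_rep[OF EH[OF that] EH[OF that]] by (simp add: f_def)
  from has_sum_SigmaD[OF hs' this] show ?thesis unfolding t by simp
qed

end

section \<open>Orthogonality of matrix coefficients\<close>

text \<open>The characteristic polynomial has a root once it is nonconstant. Were it constant, then
  \<open>q w\<close>, the determinant of 1 - w M, would be \<open>w ^ CARD('n)\<close> times a
  constant for nonzero \<open>w\<close> and tend to 0, whereas by continuity it tends to
  \<open>q 0 = 1\<close>.\<close>

lemma matrix_eigenvector_exists:
  fixes M :: "complex^'n^'n"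
  obtains z v where "v \<noteq> 0" "M *v v = z *s v"
proof -
  define p where "p = det (\<chi> i j. (if i = j then [:0, 1:] else 0) - [:M $ i $ j:])"
  have p: "poly p z = det (mat z - M)" for z
    unfolding p_def det_def by (simp add: poly_sum poly_prod mat_def, intro sum.cong refl arg_cong2[where f = "(*)"] prod.cong, auto)
  have "degree p \<noteq> 0"
  proof
    assume "degree p = 0"
    then obtain a where "p = [:a:]" by (rule degree_eq_zeroE)
    then have c: "det (mat z - M) = poly p 0" for z unfolding p[symmetric] by simp
    define q where "q = (\<lambda>w. det (\<chi> i j. (if i = j then 1 else 0) - w * M $ i $ j))"
    have q: "q w = w ^ CARD('n) * poly p 0" if "w \<noteq> 0" for w
    proof -
      have "q w = det (\<chi> i. w *s ((mat (1 / w) - M) $ i))"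
        unfolding q_def by (rule arg_cong[where f = det]) (use that in \<open>auto simp: vec_eq_iff mat_def algebra_simps\<close>)
      also have "\<dots> = w ^ CARD('n) * det (mat (1 / w) - M)"
        by (subst det_rows_mul) simp
      finally show ?thesis by (simp add: c)
    qed
    have "isCont q 0" unfolding q_def det_def by (auto intro!: continuous_intros)
    then have "q \<midarrow>0\<rightarrow> q 0" by (simp add: isCont_def)
    moreover have "((\<lambda>w. w ^ CARD('n) * poly p 0) \<longlongrightarrow> 0 ^ CARD('n) * poly p 0) (at 0)"
      by (intro tendsto_intros)
    then have "q \<midarrow>0\<rightarrow> 0 ^ CARD('n) * poly p 0"
      by (rule Lim_transform_eventually) (auto simp: eventually_at_filter q)
    ultimately have "q 0 = 0" using LIM_unique by fastforce
    moreover have "q 0 = 1"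
      using det_I[where 'a = complex and 'n = 'n] unfolding q_def mat_def by simp
    ultimately show False by simp
  qed
  then obtain z where "poly p z = 0" using Fundamental_Theorem_Algebra.fundamental_theorem_of_algebra_alt[of p] by (metis degree_pCons_0)
  then have "\<not> invertible (mat z - M)" using p invertible_det_nz by metis
  then have "\<not> (\<exists>B. B ** (mat z - M) = mat 1)" by (simp add: invertible_left_inverse)
  then obtain v where "v \<noteq> 0" "(mat z - M) *v v = 0" using matrix_left_invertible_ker by blast
  moreover have "mat z *v v = z *s v"
    by (simp add: matrix_vector_mult_def mat_def vec_eq_iff if_distrib if_distribR cong: if_cong)
  ultimately have "M *v v = z *s v" by (simp add: matrix_vector_mult_diff_rdistrib)
  then show ?thesis using that \<open>v \<noteq> 0\<close> by blast
qed

text \<open>An eigenspace of \<open>M\<close> is nonzero and invariant under the representation,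
  hence everything.\<close>

lemma Schur_lemma:
  fixes \<rho> :: "'g \<Rightarrow> complex^'n^'n"
  assumes irr: "irreducible_unitary_rep G \<rho>"
    and comm: "\<And>g. g \<in> carrier G \<Longrightarrow> M ** \<rho> g = \<rho> g ** M"
  obtains z where "M = mat z"
proof -
  obtain z v where v: "v \<noteq> 0" "M *v v = z *s v" using matrix_eigenvector_exists by blast
  define U where "U = {x. M *v x = z *s x}"
  have "vec.subspace U"
    unfolding vec.subspace_def U_def
    by (auto simp: matrix_vector_right_distrib vec.scale_right_distrib vector_scalar_commute mult.commute vector_smult_assoc)
  moreover have "\<rho> g *v x \<in> U" if "g \<in> carrier G" "x \<in> U" for g x
  proof -
    have "M *v (\<rho> g *v x) = \<rho> g *v (M *v x)"
      using comm[OF that(1)] by (simp add: matrix_vector_mul_assoc)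
    then show ?thesis using that(2) by (simp add: U_def vector_scalar_commute)
  qed
  ultimately have "U = {0} \<or> U = UNIV" using irr unfolding irreducible_unitary_rep_def by blast
  moreover have "v \<in> U" using v by (simp add: U_def)
  ultimately have "U = UNIV" using v by auto
  then have "M *v x = mat z *v x" for x
    unfolding U_def
    by (simp add: set_eq_iff matrix_vector_mult_def mat_def vec_eq_iff if_distrib if_distribR cong: if_cong)
  then have "M = mat z" by (metis matrix_eq)
  then show ?thesis using that by blast
qed

context
  fixes G :: "('g, 'm) monoid_scheme" (structure) and \<rho> :: "'g \<Rightarrow> complex^'n^'n"
  assumes G: "group G" "finite (carrier G)" and irr: "irreducible_unitary_rep G \<rho>"
begin

interpretation group G by (rule G)

lemma rep_mult: "g \<in> carrier G \<Longrightarrow> h \<in> carrier G \<Longrightarrow> \<rho> (g \<otimes> h) = \<rho> g ** \<rho> h"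
  and rep_one: "\<rho> \<one> = mat 1"
  and rep_unitary: "g \<in> carrier G \<Longrightarrow> unitary_matrix (\<rho> g)"
  using irr by (auto simp: irreducible_unitary_rep_def unitary_rep_def)

lemma rep_inv: "g \<in> carrier G \<Longrightarrow> \<rho> (inv g) = hermitian_conjugate (\<rho> g)"
proof -
  assume g: "g \<in> carrier G"
  have "\<rho> (inv g) = \<rho> (inv g) ** (\<rho> g ** hermitian_conjugate (\<rho> g))"
    using rep_unitary[OF g] by (simp add: unitary_matrix_def)
  also have "\<dots> = (\<rho> (inv g) ** \<rho> g) ** hermitian_conjugate (\<rho> g)"
    by (simp add: matrix_mul_assoc)
  also have "\<rho> (inv g) ** \<rho> g = mat 1" using rep_mult[of "inv g" g] g by (simp add: rep_one)
  also have "mat 1 ** hermitian_conjugate (\<rho> g) = hermitian_conjugate (\<rho> g)" by simp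
  finally show ?thesis .
qed

lemma character_inv: "g \<in> carrier G \<Longrightarrow> character \<rho> (inv g) = cnj (character \<rho> g)"
  by (simp add: character_def rep_inv hermitian_conjugate_def trace_def)

text \<open>Averaging the matrix unit at position \<open>j\<close>, \<open>k\<close> over the group
  gives a matrix that commutes with the representation. By Schur's lemma it is scalar, and its trace
  determines the scalar.\<close>

lemma Schur_orthogonality:
  "(\<Sum>h\<in>carrier G. \<rho> h $ i $ j * \<rho> (inv h) $ k $ l)
    = of_nat (card (carrier G)) / of_nat CARD('n) * (if j = k \<and> i = l then 1 else 0)"
proof -
  define E :: "complex^'n^'n" where "E = (\<chi> a b. if a = j \<and> b = k then 1 else 0)"
  define A where "A = (\<Sum>h\<in>carrier G. \<rho> h ** E ** \<rho> (inv h))"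
  have sum_l: "M ** (\<Sum>h\<in>carrier G. f h) = (\<Sum>h\<in>carrier G. M ** f h)" for M :: "complex^'n^'n" and f
    by (simp add: matrix_matrix_mult_def vec_eq_iff sum_component sum_distrib_left sum.swap[of _ "carrier G"])
  have sum_r: "(\<Sum>h\<in>carrier G. f h) ** M = (\<Sum>h\<in>carrier G. f h ** M)" for M :: "complex^'n^'n" and f
    by (simp add: matrix_matrix_mult_def vec_eq_iff sum_component sum_distrib_right sum.swap[of _ "carrier G"])
  have comm: "A ** \<rho> g = \<rho> g ** A" if g: "g \<in> carrier G" for g
  proof -
    have "\<rho> g ** A = (\<Sum>h\<in>carrier G. \<rho> (g \<otimes> h) ** E ** \<rho> (inv h))"
      unfolding A_def sum_l using g by (intro sum.cong) (auto simp: rep_mult matrix_mul_assoc)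
    also have "\<dots> = (\<Sum>h\<in>carrier G. \<rho> (g \<otimes> h) ** E ** \<rho> (inv (g \<otimes> h)) ** \<rho> g)"
    proof (intro sum.cong refl)
      fix h assume h: "h \<in> carrier G"
      have "\<rho> (inv h) = \<rho> (inv (g \<otimes> h) \<otimes> g)" using g h by (simp add: inv_mult_group m_assoc)
      also have "\<dots> = \<rho> (inv (g \<otimes> h)) ** \<rho> g" using g h by (intro rep_mult) auto
      finally show "\<rho> (g \<otimes> h) ** E ** \<rho> (inv h) = \<rho> (g \<otimes> h) ** E ** \<rho> (inv (g \<otimes> h)) ** \<rho> g"
        by (simp add: matrix_mul_assoc)
    qed
    also have "\<dots> = (\<Sum>h\<in>carrier G. \<rho> h ** E ** \<rho> (inv h) ** \<rho> g)"
      using g by (intro sum.reindex_bij_witness[where i = "\<lambda>h. inv g \<otimes> h" and j = "\<lambda>h. g \<otimes> h"])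
        (auto simp: m_assoc[symmetric])
    also have "\<dots> = A ** \<rho> g" unfolding A_def sum_r ..
    finally show ?thesis by simp
  qed
  obtain z where z: "A = mat z" using Schur_lemma[OF irr comm] by blast
  have entry: "A $ a $ b = (\<Sum>h\<in>carrier G. \<rho> h $ a $ j * \<rho> (inv h) $ k $ b)" for a b
  proof -
    have "(\<rho> h ** E ** \<rho> (inv h)) $ a $ b = \<rho> h $ a $ j * \<rho> (inv h) $ k $ b" for h
    proof -
      have e: "(\<rho> h ** E) $ a $ x = (if x = k then \<rho> h $ a $ j else 0)" for x
        by (simp add: matrix_matrix_mult_def E_def if_distrib if_distribR cong: if_cong)
      show ?thesis
        unfolding matrix_matrix_mult_def[of "\<rho> h ** E"] by (simp add: e if_distrib if_distribR cong: if_cong)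
    qed
    then show ?thesis unfolding A_def by (simp add: sum_component)
  qed
  \<comment> \<open>The trace of \<open>A\<close>, with the factors reordered cyclically so that
    \<open>\<rho> (inv h) ** \<rho> h\<close> collapses to the identity.\<close>
  have "of_nat CARD('n) * z = (\<Sum>a\<in>UNIV. A $ a $ a)" by (simp add: z mat_def)
  also have "\<dots> = (\<Sum>h\<in>carrier G. \<Sum>a\<in>UNIV. \<rho> (inv h) $ k $ a * \<rho> h $ a $ j)"
    unfolding entry by (subst sum.swap) (simp add: mult.commute)
  also have "\<dots> = (\<Sum>h\<in>carrier G. (\<rho> (inv h) ** \<rho> h) $ k $ j)"
    by (simp add: matrix_matrix_mult_def)
  also have "\<dots> = (\<Sum>h\<in>carrier G. (mat 1 :: complex^'n^'n) $ k $ j)"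
    by (intro sum.cong) (auto simp: rep_mult[symmetric] rep_one)
  also have "\<dots> = of_nat (card (carrier G)) * (if j = k then 1 else 0)" by (simp add: mat_def)
  finally have zz: "z = of_nat (card (carrier G)) / of_nat CARD('n) * (if j = k then 1 else 0)"
    by (simp add: field_simps)
  have "A $ i $ l = (if i = l then z else 0)" by (simp add: z mat_def)
  then have "(\<Sum>h\<in>carrier G. \<rho> h $ i $ j * \<rho> (inv h) $ k $ l) = (if i = l then z else 0)" by (simp only: entry)
  then show ?thesis unfolding zz by (cases "i = l"; cases "j = k"; simp)
qed

text \<open>Expanding both characters into matrix entries leaves, by orthogonality, only diagonal
  terms. This identity makes \<open>isotypic_proj\<close> idempotent.\<close>

lemma character_convolution:
  assumes g: "g \<in> carrier G"
  shows "(\<Sum>h\<in>carrier G. character \<rho> h * character \<rho> (inv h \<otimes> g))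
    = of_nat (card (carrier G)) / of_nat CARD('n) * character \<rho> g"
proof -
  have "(\<Sum>h\<in>carrier G. character \<rho> h * character \<rho> (inv h \<otimes> g))
    = (\<Sum>h\<in>carrier G. \<Sum>i\<in>UNIV. \<Sum>k\<in>UNIV. \<Sum>l\<in>UNIV. \<rho> g $ l $ k * (\<rho> h $ i $ i * \<rho> (inv h) $ k $ l))"
  proof (intro sum.cong refl)
    fix h assume h: "h \<in> carrier G"
    have c: "character \<rho> (inv h \<otimes> g) = (\<Sum>k\<in>UNIV. \<Sum>l\<in>UNIV. \<rho> (inv h) $ k $ l * \<rho> g $ l $ k)"
      using h g by (simp add: character_def rep_mult trace_def matrix_matrix_mult_def)
    have "character \<rho> h * character \<rho> (inv h \<otimes> g) = (\<Sum>i\<in>UNIV. \<rho> h $ i $ i * character \<rho> (inv h \<otimes> g))"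
      unfolding character_def[of _ h] trace_def by (rule sum_distrib_right)
    then show "character \<rho> h * character \<rho> (inv h \<otimes> g)
      = (\<Sum>i\<in>UNIV. \<Sum>k\<in>UNIV. \<Sum>l\<in>UNIV. \<rho> g $ l $ k * (\<rho> h $ i $ i * \<rho> (inv h) $ k $ l))"
      unfolding c by (simp add: sum_distrib_left mult_ac)
  qed
  also have "\<dots> = (\<Sum>i\<in>UNIV. \<Sum>k\<in>UNIV. \<Sum>l\<in>UNIV. \<rho> g $ l $ k * (\<Sum>h\<in>carrier G. \<rho> h $ i $ i * \<rho> (inv h) $ k $ l))"
    unfolding sum_distrib_left
    by (subst sum.swap, intro sum.cong refl, subst sum.swap, intro sum.cong refl, subst sum.swap) simp
  also have "\<dots> = (\<Sum>i\<in>UNIV. \<Sum>k\<in>UNIV. \<Sum>l\<in>UNIV. if l = i then if k = i then \<rho> g $ l $ k * (of_nat (card (carrier G)) / of_nat CARD('n)) else 0 else 0)"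
    unfolding Schur_orthogonality by (intro sum.cong refl) auto
  also have "\<dots> = of_nat (card (carrier G)) / of_nat CARD('n) * character \<rho> g"
    by (simp add: character_def trace_def sum_distrib_left mult.commute)
  finally show ?thesis .
qed

end

section \<open>Automorphisms of disks\<close>

text \<open>The derivative is \<open>(1 - cnj a * a) / (1 - cnj a * z)\<^sup>2\<close>, and its
  denominator stays away from 0 because \<open>cmod (cnj a * z) \<le> cmod a\<close>.\<close>

lemma Moebius_deriv_bounded:
  assumes "cmod a < 1" "cmod z < 1"
  shows "cmod (deriv (Moebius_function 0 a) z) \<le> 1 / (1 - cmod a)\<^sup>2"
proof -
  have "cmod (cnj a * z) \<le> cmod a * 1" unfolding norm_mult using assms by (intro mult_mono) auto
  then have le: "1 - cmod a \<le> cmod (1 - cnj a * z)"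
    using norm_triangle_ineq2[of 1 "cnj a * z"] by simp
  then have nz: "1 - cnj a * z \<noteq> 0" using assms(1) by (metis diff_gt_0_iff_gt norm_zero not_less)
  have "(Moebius_function 0 a has_field_derivative (1 - cnj a * a) / (1 - cnj a * z)\<^sup>2) (at z)"
    unfolding Moebius_function_simple[abs_def]
    by (rule derivative_eq_intros refl nz)+ (use nz in \<open>simp add: field_simps power2_eq_square\<close>)
  then have "deriv (Moebius_function 0 a) z = (1 - cnj a * a) / (1 - cnj a * z)\<^sup>2"
    by (rule DERIV_imp_deriv)
  then have "cmod (deriv (Moebius_function 0 a) z) = cmod (1 - cnj a * a) / (cmod (1 - cnj a * z))\<^sup>2"
    by (simp add: norm_divide norm_power)
  also have "\<dots> \<le> 1 / (1 - cmod a)\<^sup>2"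
  proof (rule frac_le)
    have "1 - cnj a * a = of_real (1 - (cmod a)\<^sup>2)"
      unfolding of_real_diff complex_norm_square by (simp add: mult.commute)
    then have "cmod (1 - cnj a * a) = \<bar>1 - (cmod a)\<^sup>2\<bar>" by (simp only: norm_of_real)
    then show "cmod (1 - cnj a * a) \<le> 1" using assms(1) by (simp add: abs_le_iff power_le_one)
    show "(1 - cmod a)\<^sup>2 \<le> (cmod (1 - cnj a * z))\<^sup>2" using le assms(1) by (intro power_mono) auto
  qed (use assms(1) in auto)
  finally show ?thesis .
qed

text \<open>By the Schwarz lemma an automorphism of the unit disk is a rotation composed with a Moebius map.\<close>

lemma unit_disc_automorphism_deriv_bounded:
  assumes f: "f holomorphic_on ball 0 1" "f ` ball 0 1 \<subseteq> ball 0 1"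
    and g: "g holomorphic_on ball 0 1" "g ` ball 0 1 \<subseteq> ball 0 1"
    and gf: "\<And>z. z \<in> ball 0 1 \<Longrightarrow> g (f z) = z" and fg: "\<And>z. z \<in> ball 0 1 \<Longrightarrow> f (g z) = z"
  shows "\<exists>B. \<forall>z\<in>ball 0 1. cmod (deriv f z) \<le> B"
proof -
  define a where "a = g 0"
  have a: "cmod a < 1" using g(2) by (force simp: a_def)
  have fa: "f a = 0" using fg[of 0] by (simp add: a_def)
  define m where "m = Moebius_function 0 a"
  define m' where "m' = Moebius_function 0 (- a)"
  have m: "m holomorphic_on ball 0 1" "m' holomorphic_on ball 0 1"
    unfolding m_def m'_def using a by (auto intro: Moebius_function_holomorphic)
  have mb: "cmod (m z) < 1" "cmod (m' z) < 1" if "cmod z < 1" for z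
    unfolding m_def m'_def using a that by (auto intro: Moebius_function_norm_lt_1)
  have mm: "m (m' z) = z" "m' (m z) = z" if "cmod z < 1" for z
    unfolding m_def m'_def using a that by (auto intro!: Moebius_function_compose)
  have m0: "m a = 0" "m' 0 = a" by (auto simp: m_def m'_def Moebius_function_eq_zero Moebius_function_of_zero)
  have fb: "cmod (f z) < 1" and gb: "cmod (g z) < 1" if "cmod z < 1" for z
    using subsetD[OF f(2) imageI, of z] subsetD[OF g(2) imageI, of z] that by auto
  define h where "h = f \<circ> m'"
  define k where "k = m \<circ> g"
  have h: "h holomorphic_on ball 0 1" unfolding h_def
    by (rule holomorphic_on_compose_gen[OF m(2) f(1)]) (use mb in auto)
  have k: "k holomorphic_on ball 0 1" unfolding k_def
    by (rule holomorphic_on_compose_gen[OF g(1) m(1)]) (use gb in auto)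
  have h0: "h 0 = 0" "k 0 = 0" using fa m0 by (auto simp: h_def k_def a_def)
  have hb: "cmod (h z) < 1" "cmod (k z) < 1" if "cmod z < 1" for z
    using mb fb gb that by (auto simp: h_def k_def)
  \<comment> \<open>\<open>h\<close> and its inverse \<open>k\<close> both fix 0, so the Schwarz
    lemma applies in both directions. At the sample point 1/2 this forces equality, and the equality
    case makes \<open>h\<close> a rotation.\<close>
  have "cmod (h (1/2)) \<le> 1/2" using Schwarz_Lemma(1)[OF h h0(1) hb(1), of "1/2"] by simp
  moreover have "cmod (k (h (1/2))) \<le> cmod (h (1/2))"
    using Schwarz_Lemma(1)[OF k h0(2) hb(2), of "h (1/2)"] hb(1)[of "1/2"] by simp
  moreover have "k (h (1/2)) = 1/2"
    using gf[of "m' (1/2)"] mb(2)[of "1/2"] mm(1)[of "1/2"] by (simp add: h_def k_def)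
  ultimately have "cmod (h (1/2)) = cmod (1/2)" by simp
  then have "\<exists>\<alpha>. (\<forall>z. norm z < 1 \<longrightarrow> h z = \<alpha> * z) \<and> norm \<alpha> = 1"
    by (intro Schwarz_Lemma(3)[OF h h0(1) hb(1), of 0] disjI1 exI[of _ "1/2"]) auto
  then obtain \<alpha> where \<alpha>: "\<And>z. cmod z < 1 \<Longrightarrow> h z = \<alpha> * z" "cmod \<alpha> = 1" by blast
  have fm: "f z = \<alpha> * m z" if "z \<in> ball 0 1" for z
    using \<alpha>(1)[of "m z"] mb(1)[of z] mm(2)[of z] that by (simp add: h_def)
  have "cmod (deriv f z) \<le> 1 / (1 - cmod a)\<^sup>2" if z: "z \<in> ball 0 1" for z
  proof -
    have "deriv f z = deriv (\<lambda>w. \<alpha> * m w) z"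
      by (rule complex_derivative_transform_within_open[of _ "ball 0 1"])
         (use f(1) m(1) fm z in \<open>auto intro!: holomorphic_intros\<close>)
    also have "\<dots> = \<alpha> * deriv m z"
      using m(1) z holomorphic_on_imp_differentiable_at[of m "ball 0 1"] by (intro deriv_cmult) auto
    finally show ?thesis using Moebius_deriv_bounded[OF a, of z] z \<alpha>(2) by (simp add: norm_mult m_def)
  qed
  then show ?thesis by blast
qed

text \<open>Affine rescaling to the unit disk; the chain rule contributes the factor
  \<open>r' / r\<close>. Group elements are such isomorphisms between disks, and the bound lets them
  act on square integrable functions.\<close>

lemma disc_biholomorphism_deriv_bounded:
  fixes c c' :: complex and r r' :: real
  assumes r: "r > 0" "r' > 0"
    and f: "f holomorphic_on ball c r" "f ` ball c r \<subseteq> ball c' r'"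
    and g: "g holomorphic_on ball c' r'" "g ` ball c' r' \<subseteq> ball c r"
    and gf: "\<And>z. z \<in> ball c r \<Longrightarrow> g (f z) = z" and fg: "\<And>z. z \<in> ball c' r' \<Longrightarrow> f (g z) = z"
  shows "\<exists>B. \<forall>z\<in>ball c r. cmod (deriv f z) \<le> B"
proof -
  define s where "s = (\<lambda>c (r::real) z. c + of_real r * z :: complex)"
  define s' where "s' = (\<lambda>c (r::real) z. (z - c) / of_real r :: complex)"
  have ss: "s c r (s' c r z) = z" "s' c r (s c r z) = z" if "r > 0" for c r z
    using that by (auto simp: s_def s'_def)
  have sb: "s c r z \<in> ball c r \<longleftrightarrow> z \<in> ball 0 1" if "r > 0" for c r z
    using that by (auto simp: s_def dist_norm norm_mult)
  have s'b: "s' c r z \<in> ball 0 1 \<longleftrightarrow> z \<in> ball c r" if "r > 0" for c r z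
    using sb[OF that, of c "s' c r z"] ss[OF that] by simp
  have sh: "s c r holomorphic_on X" "s' c r holomorphic_on X" if "r > 0" for c r X
    unfolding s_def s'_def using that by (auto intro!: holomorphic_intros)
  define F where "F = s' c' r' \<circ> f \<circ> s c r"
  define G where "G = s' c r \<circ> g \<circ> s c' r'"
  have fb: "f z \<in> ball c' r'" if "z \<in> ball c r" for z using f(2) that by blast
  have gb: "g z \<in> ball c r" if "z \<in> ball c' r'" for z using g(2) that by blast
  have "\<exists>B. \<forall>z\<in>ball 0 1. cmod (deriv F z) \<le> B"
  proof (rule unit_disc_automorphism_deriv_bounded[of F G])
    show F: "F holomorphic_on ball 0 1" unfolding F_def
      by (intro holomorphic_on_compose_gen[OF _ holomorphic_on_compose_gen[OF f(1) sh(2)[OF r(2), of _ UNIV]], unfolded o_assoc] sh r)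
         (use sb[OF r(1)] in auto)
    show "G holomorphic_on ball 0 1" unfolding G_def
      by (intro holomorphic_on_compose_gen[OF _ holomorphic_on_compose_gen[OF g(1) sh(2)[OF r(1), of _ UNIV]], unfolded o_assoc] sh r)
         (use sb[OF r(2)] in auto)
    show "F ` ball 0 1 \<subseteq> ball 0 1"
      unfolding F_def by (rule image_subsetI) (use fb sb[OF r(1)] s'b[OF r(2)] in simp)
    show "G ` ball 0 1 \<subseteq> ball 0 1"
      unfolding G_def by (rule image_subsetI) (use gb sb[OF r(2)] s'b[OF r(1)] in simp)
    show "G (F z) = z" if "z \<in> ball 0 1" for z
      using that gf[of "s c r z"] sb[OF r(1)] ss r by (simp add: F_def G_def)
    show "F (G z) = z" if "z \<in> ball 0 1" for z
      using that fg[of "s c' r' z"] sb[OF r(2)] ss r by (simp add: F_def G_def)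
  qed
  then obtain B where B: "\<And>z. z \<in> ball 0 1 \<Longrightarrow> cmod (deriv F z) \<le> B" by blast
  have "cmod (deriv f z) \<le> r' / r * B" if z: "z \<in> ball c r" for z
  proof -
    define w where "w = s' c r z"
    have w: "w \<in> ball 0 1" "s c r w = z" using z s'b[OF r(1)] ss r by (auto simp: w_def)
    have d: "(f has_field_derivative deriv f z) (at (s c r w))"
      using f(1) z w holomorphic_derivI[of f "ball c r"] by auto
    have "(s c r has_field_derivative of_real r) (at w)"
      unfolding s_def by (auto intro!: derivative_eq_intros)
    from DERIV_chain[OF d this] have "(f \<circ> s c r has_field_derivative deriv f z * of_real r) (at w)" .
    then have "(F has_field_derivative deriv f z * of_real r / of_real r') (at w)"
      unfolding F_def s'_def o_def using r by (auto intro!: derivative_eq_intros)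
    then have "deriv F w = deriv f z * of_real r / of_real r'" by (rule DERIV_imp_deriv)
    then have "cmod (deriv f z) * r / r' \<le> B" using B[OF w(1)] r by (simp add: norm_mult norm_divide)
    then show ?thesis using r by (simp add: field_simps)
  qed
  then show ?thesis by blast
qed

section \<open>Holomorphic maps of a disk strictly into itself\<close>

context
  fixes c :: complex and r R :: real and \<Phi> :: "complex \<Rightarrow> complex"
  assumes r: "0 < r" "r < R"
    and \<Phi>: "\<Phi> holomorphic_on ball c R"
    and \<Phi>_le: "\<And>z. z \<in> ball c R \<Longrightarrow> dist c (\<Phi> z) \<le> r"
begin

text \<open>On a circle with radius between \<open>r\<close> and \<open>R\<close>,
  \<open>z - c\<close> dominates \<open>c - \<Phi> z\<close>, so \<open>z - \<Phi> z\<close> has one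
  zero counted with multiplicity. Simplicity of this zero yields
  \<open>deriv \<Phi> p \<noteq> 1\<close>, the nonvanishing of the denominator in the trace
  formula.\<close>

lemma strict_self_map_fixpoint:
  obtains p where "p \<in> cball c r" "\<Phi> p = p" "deriv \<Phi> p \<noteq> 1"
    "\<And>q. q \<in> ball c R \<Longrightarrow> \<Phi> q = q \<Longrightarrow> q = p"
proof -
  define \<rho> where "\<rho> = (r + R) / 2"
  have \<rho>: "r < \<rho>" "\<rho> < R" "0 < \<rho>" using r by (auto simp: \<rho>_def)
  \<comment> \<open>Written as the sum of the two functions that Rouche's theorem compares.\<close>
  define h where "h = (\<lambda>z. (z - c) + (c - \<Phi> z))"
  have h_eq: "h z = z - \<Phi> z" for z by (simp add: h_def)
  have hh: "h holomorphic_on ball c R" unfolding h_def using \<Phi> by (intro holomorphic_intros)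
  have zr: "dist c z \<le> r" if "z \<in> ball c R" "h z = 0" for z
    using \<Phi>_le[OF that(1)] that(2) by (simp add: h_eq)
  \<comment> \<open>A point at distance \<open>\<rho>\<close> from \<open>c\<close> is too far out
    to be a fixed point; it shows that \<open>h\<close> does not vanish identically.\<close>
  define b where "b = c + of_real \<rho>"
  have b: "b \<in> ball c R" "h b \<noteq> 0" using \<rho> zr[of b] by (auto simp: b_def dist_norm)
  define Z where "Z = {z \<in> ball c R. h z = 0}"
  \<comment> \<open>All zeros lie in the compact \<open>cball c r\<close>, which is what bounds
    their number.\<close>
  have Zc: "Z = {z \<in> cball c r. h z = 0}" unfolding Z_def using zr r by auto
  have fin: "finite Z"
  proof (cases "Z = {}")
    case False
    then obtain z0 where "z0 \<in> Z" by blast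
    then have z0: "z0 \<in> ball c R" "h z0 = 0" by (auto simp: Z_def)
    have "\<not> h constant_on ball c R"
    proof
      assume "h constant_on ball c R"
      then obtain k where "\<forall>x\<in>ball c R. h x = k" unfolding constant_on_def by blast
      then show False using z0 b by auto
    qed
    then show ?thesis unfolding Zc using r by (intro holomorphic_compact_finite_zeros[OF hh]) auto
  qed simp
  define f where "f = (\<lambda>z. z - c)"
  define g where "g = (\<lambda>z. c - \<Phi> z)"
  have zf: "{p \<in> ball c R. f p = 0} = {c}" using r by (auto simp: f_def)
  have zorder_f: "zorder f c = 1"
    unfolding f_def by (rule zorder_eqI[of UNIV _ "\<lambda>_. 1"]) auto
  have wind: "winding_number (circlepath c \<rho>) z = 1" if "dist c z \<le> r" for z
    using that \<rho> by (intro winding_number_circlepath) (auto simp: dist_norm norm_minus_commute)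
  have "(\<Sum>p\<in>{p \<in> ball c R. f p + g p = 0}. winding_number (circlepath c \<rho>) p * zorder (\<lambda>p. f p + g p) p)
      = (\<Sum>p\<in>{p \<in> ball c R. f p = 0}. winding_number (circlepath c \<rho>) p * zorder f p)"
  proof (rule Rouche_theorem)
    show "finite {p \<in> ball c R. f p + g p = 0}" using fin unfolding Z_def h_def f_def g_def .
    show "finite {p \<in> ball c R. f p = 0}" unfolding zf by simp
    show "f holomorphic_on ball c R" "g holomorphic_on ball c R"
      unfolding f_def g_def using \<Phi> by (auto intro!: holomorphic_intros)
    show "path_image (circlepath c \<rho>) \<subseteq> ball c R" using \<rho> by (auto simp: dist_norm)
    show "\<forall>z\<in>path_image (circlepath c \<rho>). cmod (g z) < cmod (f z)"
    proof
      fix z assume "z \<in> path_image (circlepath c \<rho>)"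
      then have z: "dist c z = \<rho>" using \<rho> by simp
      then have "z \<in> ball c R" using \<rho> by simp
      then have "cmod (g z) \<le> r" using \<Phi>_le by (simp add: g_def dist_norm)
      also have "\<dots> < cmod (f z)" using z \<rho> by (simp add: f_def dist_norm norm_minus_commute)
      finally show "cmod (g z) < cmod (f z)" .
    qed
    show "\<forall>z. z \<notin> ball c R \<longrightarrow> winding_number (circlepath c \<rho>) z = 0"
      using \<rho> by (auto intro!: winding_number_zero_outside[of _ "cball c \<rho>"] simp: sphere_cball)
  qed auto
  then have sum1: "(\<Sum>p\<in>Z. of_int (zorder h p)) = (1::complex)"
    unfolding zf using wind zr r by (simp add: zorder_f[unfolded f_def] Z_def h_def f_def g_def)
  have zo: "zorder h p > 0 \<and> (zorder h p = 1 \<longrightarrow> deriv h p \<noteq> 0)" if p: "p \<in> Z" for p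
  proof -
    have "\<exists>w\<in>ball c R. h w \<noteq> 0" using b by blast
    with zorder_exist_zero[OF hh, of p] p obtain \<epsilon> where pos: "zorder h p > 0" and \<epsilon>: "\<epsilon> > 0"
      "zor_poly h p holomorphic_on cball p \<epsilon>"
      "\<And>w. w \<in> cball p \<epsilon> \<Longrightarrow> h w = zor_poly h p w * (w - p) ^ nat (zorder h p) \<and> zor_poly h p w \<noteq> 0"
      by (auto simp: Z_def)
    have "deriv h p \<noteq> 0" if "zorder h p = 1"
    proof -
      have "deriv h p = deriv (\<lambda>w. zor_poly h p w * (w - p)) p"
        by (rule deriv_cong_ev) (use \<epsilon> that in \<open>auto simp: eventually_at_filter eventually_nhds intro!: exI[of _ "ball p \<epsilon>"]\<close>)
      also have "\<dots> = zor_poly h p p"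
      proof (rule DERIV_imp_deriv)
        have "(zor_poly h p has_field_derivative deriv (zor_poly h p) p) (at p)"
          using \<epsilon> by (intro holomorphic_derivI[of _ "ball p \<epsilon>"]) (auto intro: holomorphic_on_subset)
        then show "((\<lambda>w. zor_poly h p w * (w - p)) has_field_derivative zor_poly h p p) (at p)"
          by (auto intro!: derivative_eq_intros)
      qed
      also have "\<dots> \<noteq> 0" using \<epsilon> by simp
      finally show ?thesis .
    qed
    then show ?thesis using pos by blast
  qed
  from sum1 have "of_int (\<Sum>p\<in>Z. zorder h p) = (1::complex)" by simp
  then have sumZ: "(\<Sum>p\<in>Z. zorder h p) = 1" by (simp only: of_int_eq_1_iff)
  then have "Z \<noteq> {}" by auto
  then obtain p where p: "p \<in> Z" by blast
  have split: "(\<Sum>p\<in>Z. zorder h p) = zorder h p + (\<Sum>q\<in>Z - {p}. zorder h q)" using fin p by (rule sum.remove)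
  \<comment> \<open>Every order is at least 1 and the orders add up to 1, so there is no second zero
    and the only one is simple.\<close>
  have "(\<Sum>q\<in>Z - {p}. 1) \<le> (\<Sum>q\<in>Z - {p}. zorder h q)"
    using zo by (intro sum_mono) force
  then have "int (card (Z - {p})) \<le> (\<Sum>q\<in>Z - {p}. zorder h q)" by simp
  then have "int (card (Z - {p})) = 0" "zorder h p = 1" using split sumZ zo[OF p] by linarith+
  then have "Z - {p} = {}" using fin by simp
  then have "Z = {p}" using p by blast
  have dh: "deriv h p \<noteq> 0" using zo[OF p] \<open>zorder h p = 1\<close> by simp
  have pB: "p \<in> ball c R" and pf: "\<Phi> p = p" using p by (auto simp: Z_def h_eq)
  have "deriv h p = 1 - deriv \<Phi> p"
  proof (rule DERIV_imp_deriv)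
    have "(\<Phi> has_field_derivative deriv \<Phi> p) (at p)"
      using \<Phi> pB holomorphic_derivI by blast
    then show "(h has_field_derivative 1 - deriv \<Phi> p) (at p)" unfolding h_def
      by (auto intro!: derivative_eq_intros)
  qed
  then have d1: "deriv \<Phi> p \<noteq> 1" using dh by simp
  have uniq: "q = p" if "q \<in> ball c R" "\<Phi> q = q" for q
  proof -
    have "q \<in> Z" using that by (simp add: Z_def h_eq)
    then show ?thesis using \<open>Z = {p}\<close> by blast
  qed
  have pc: "p \<in> cball c r" using p Zc by blast
  show ?thesis by (rule that[OF pc pf d1 uniq])
qed

text \<open>Summing the Cauchy formulas for the coefficients as a geometric series gives
  \<open>(1 / 2\<pi>\<i>) \<integral> \<psi> z / (z - \<Phi> z) dz\<close>, whose only residue is at the fixed point.\<close>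

lemma sum_taylor_coeffs_self_map:
  assumes \<psi>: "\<psi> holomorphic_on ball c R" "\<And>z. z \<in> ball c R \<Longrightarrow> cmod (\<psi> z) \<le> K"
    and p: "p \<in> ball c R" "\<Phi> p = p"
  shows "((\<lambda>k. (deriv ^^ k) (\<lambda>z. \<psi> z * (\<Phi> z - c) ^ k) c / fact k) has_sum \<psi> p / (1 - deriv \<Phi> p)) UNIV"
proof -
  obtain p' where p': "p' \<in> cball c r" "\<Phi> p' = p'" "deriv \<Phi> p' \<noteq> 1"
    "\<And>q. q \<in> ball c R \<Longrightarrow> \<Phi> q = q \<Longrightarrow> q = p'"
    using strict_self_map_fixpoint by metis
  have pp: "p' = p" using p'(4)[OF p] by simp
  have pr: "dist c p \<le> r" using p' pp by simp
  define \<rho> where "\<rho> = (r + R) / 2"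
  have \<rho>: "r < \<rho>" "\<rho> < R" "0 < \<rho>" using r by (auto simp: \<rho>_def)
  have K: "0 \<le> K" using \<psi>(2)[OF p(1)] norm_ge_zero order_trans by blast
  have sub: "cball c \<rho> \<subseteq> ball c R" using \<rho> by auto
  define F where "F k = (\<lambda>z. \<psi> z * (\<Phi> z - c) ^ k)" for k
  have F: "F k holomorphic_on ball c R" for k unfolding F_def using \<psi> \<Phi> by (intro holomorphic_intros)
  define a where "a k = (deriv ^^ k) (F k) c / fact k" for k
  define G where "G k = (\<lambda>z. F k z / (z - c) ^ Suc k)" for k
  have G: "(G k has_contour_integral (2 * of_real pi * \<i> * a k)) (circlepath c \<rho>)" for k
  proof -
    have "((\<lambda>u. F k u / (u - c) ^ Suc k) has_contour_integral (2 * pi * \<i>) / (fact k) * (deriv ^^ k) (F k) c) (circlepath c \<rho>)"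
      by (rule Cauchy_has_contour_integral_higher_derivative_circlepath)
         (use F[of k] sub \<rho> holomorphic_on_imp_continuous_on holomorphic_on_subset ball_subset_cball in \<open>auto intro: continuous_on_subset\<close>)
    then show ?thesis by (simp add: G_def a_def)
  qed
  \<comment> \<open>The geometric ratio: on the circle of radius \<open>\<rho>\<close>,
    \<open>\<Phi> z - c\<close> has modulus at most \<open>r\<close> and \<open>z - c\<close> has
    modulus \<open>\<rho>\<close>.\<close>
  define q where "q = r / \<rho>"
  have q: "0 \<le> q" "q < 1" using r \<rho> by (auto simp: q_def)
  have Gb: "cmod (G k z) \<le> K / \<rho> * q ^ k" if z: "z \<in> sphere c \<rho>" for k z
  proof -
    have zb: "z \<in> ball c R" using z \<rho> by auto
    have nz: "cmod (z - c) = \<rho>" using z by (simp add: dist_norm norm_minus_commute)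
    have "cmod (\<Phi> z - c) \<le> r" using \<Phi>_le[OF zb] by (simp add: dist_norm norm_minus_commute)
    then have "cmod (F k z) \<le> K * r ^ k"
      unfolding F_def norm_mult norm_power using \<psi>(2)[OF zb] K by (intro mult_mono power_mono) auto
    then have "cmod (G k z) \<le> K * r ^ k / \<rho> ^ Suc k"
      unfolding G_def norm_divide norm_power nz using \<rho> by (intro divide_right_mono) auto
    also have "\<dots> = K / \<rho> * q ^ k" by (simp add: q_def power_divide)
    finally show ?thesis .
  qed
  have ab: "cmod (a k) \<le> K * q ^ k" for k
  proof -
    have "cmod (2 * of_real pi * \<i> * a k) \<le> (K / \<rho> * q ^ k) * (2 * pi * \<rho>)"
      using K \<rho> q Gb by (intro has_contour_integral_bound_circlepath[OF G]) (auto simp: norm_minus_commute dist_norm)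
    then show ?thesis using \<rho> by (simp add: norm_mult)
  qed
  have sua: "summable (\<lambda>k. cmod (a k))"
    by (rule summable_comparison_test'[of "\<lambda>k. K * q ^ k" 0]) (use ab q in auto)
  have unif: "uniform_limit (sphere c \<rho>) (\<lambda>n z. \<Sum>k<n. G k z) (\<lambda>z. \<psi> z / (z - \<Phi> z)) sequentially"
  proof -
    have 1: "uniform_limit (sphere c \<rho>) (\<lambda>n z. \<Sum>k<n. G k z) (\<lambda>z. \<Sum>k. G k z) sequentially"
      by (rule Weierstrass_m_test[of _ _ "\<lambda>k. K / \<rho> * q ^ k"]) (use Gb q in auto)
    have 2: "(\<Sum>k. G k z) = \<psi> z / (z - \<Phi> z)" if z: "z \<in> sphere c \<rho>" for z
    proof -
      have zb: "z \<in> ball c R" using z \<rho> by auto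
      have nz: "cmod (z - c) = \<rho>" using z by (simp add: dist_norm norm_minus_commute)
      then have z0: "z - c \<noteq> 0" using \<rho> by auto
      define x where "x = (\<Phi> z - c) / (z - c)"
      have "cmod x \<le> q" unfolding x_def q_def norm_divide nz using \<Phi>_le[OF zb] \<rho>
        by (intro divide_right_mono) (auto simp: dist_norm norm_minus_commute)
      then have x1: "cmod x < 1" using q by simp
      have Gx: "G k z = \<psi> z / (z - c) * x ^ k" for k by (simp add: G_def F_def x_def power_divide)
      have "(\<lambda>k. \<psi> z / (z - c) * x ^ k) sums (\<psi> z / (z - c) * (1 / (1 - x)))"
        by (intro sums_mult geometric_sums x1)
      then have "(\<Sum>k. G k z) = \<psi> z / (z - c) * (1 / (1 - x))" unfolding Gx by (rule sums_unique[symmetric])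
      also have "\<dots> = \<psi> z / ((z - c) * (1 - x))" by simp
      also have "(z - c) * (1 - x) = z - \<Phi> z" using z0 by (simp add: x_def field_simps)
      finally show ?thesis .
    qed
    show ?thesis by (rule uniform_limit_cong'[THEN iffD1, OF refl 2 1])
  qed
  have sumG: "((\<lambda>z. \<Sum>k<n. G k z) has_contour_integral (\<Sum>k<n. 2 * of_real pi * \<i> * a k)) (circlepath c \<rho>)" for n
    by (rule has_contour_integral_sum) (use G in auto)
  have "(\<lambda>n. contour_integral (circlepath c \<rho>) (\<lambda>z. \<Sum>k<n. G k z)) \<longlonglongrightarrow> contour_integral (circlepath c \<rho>) (\<lambda>z. \<psi> z / (z - \<Phi> z))"
  proof (rule contour_integral_uniform_limit_circlepath[OF _ unif])
    show "\<forall>\<^sub>F n in sequentially. (\<lambda>z. \<Sum>k<n. G k z) contour_integrable_on circlepath c \<rho>"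
      using has_contour_integral_integrable[OF sumG] by simp
  qed (use \<rho> in auto)
  moreover have "contour_integral (circlepath c \<rho>) (\<lambda>z. \<Sum>k<n. G k z) = 2 * of_real pi * \<i> * (\<Sum>k<n. a k)" for n
    using contour_integral_unique[OF sumG] by (simp add: sum_distrib_left)
  moreover have "contour_integral (circlepath c \<rho>) (\<lambda>z. \<psi> z / (z - \<Phi> z)) = 2 * of_real pi * \<i> * (\<psi> p / (1 - deriv \<Phi> p))"
  proof -
    define h where "h = (\<lambda>z. z - \<Phi> z)"
    have hh: "h holomorphic_on ball c R" unfolding h_def using \<Phi> by (intro holomorphic_intros)
    have hp: "h p = 0" using p by (simp add: h_def)
    \<comment> \<open>The quotient of \<open>z - \<Phi> z\<close> by \<open>z - p\<close> with the
      singularity removed. It has no zero in the ball, because \<open>p\<close> is the only fixed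
      point and a simple zero; the residue is then Cauchy's formula for
      \<open>\<psi> / Q\<close>.\<close>
    define Q where "Q = (\<lambda>z. if z = p then deriv h p else (h z - h p) / (z - p))"
    have Q: "Q holomorphic_on ball c R" unfolding Q_def by (rule pole_lemma_open[OF hh]) auto
    have "(\<Phi> has_field_derivative deriv \<Phi> p) (at p)" using \<Phi> p holomorphic_derivI by blast
    then have "(h has_field_derivative 1 - deriv \<Phi> p) (at p)" unfolding h_def
      by (auto intro!: derivative_eq_intros)
    then have Qp: "Q p = 1 - deriv \<Phi> p" by (simp add: Q_def DERIV_imp_deriv)
    have Qnz: "Q z \<noteq> 0" if z: "z \<in> ball c R" for z
    proof (cases "z = p")
      case True
      then show ?thesis using Qp p'(3) pp by simp
    next
      case False
      then have "h z \<noteq> 0" using p'(4)[OF z] pp by (auto simp: h_def)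
      then show ?thesis using False hp by (simp add: Q_def)
    qed
    have "((\<lambda>u. (\<psi> u / Q u) / (u - p)) has_contour_integral (2 * of_real pi * \<i> * (\<psi> p / Q p))) (circlepath c \<rho>)"
    proof (rule Cauchy_integral_circlepath_simple)
      show "(\<lambda>u. \<psi> u / Q u) holomorphic_on cball c \<rho>"
        using \<psi>(1) Q Qnz sub by (intro holomorphic_intros) (auto intro: holomorphic_on_subset)
      show "cmod (p - c) < \<rho>" using pr \<rho> by (simp add: dist_norm norm_minus_commute)
    qed
    then have "((\<lambda>z. \<psi> z / (z - \<Phi> z)) has_contour_integral (2 * of_real pi * \<i> * (\<psi> p / Q p))) (circlepath c \<rho>)"
    proof (rule has_contour_integral_eq)
      fix z assume "z \<in> path_image (circlepath c \<rho>)"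
      then have "dist c z = \<rho>" using \<rho> by simp
      then have "z \<noteq> p" using pr \<rho> by auto
      then show "\<psi> z / Q z / (z - p) = \<psi> z / (z - \<Phi> z)" using hp by (simp add: Q_def h_def)
    qed
    then show ?thesis unfolding Qp by (rule contour_integral_unique)
  qed
  ultimately have "(\<lambda>n. 2 * of_real pi * \<i> * (\<Sum>k<n. a k)) \<longlonglongrightarrow> 2 * of_real pi * \<i> * (\<psi> p / (1 - deriv \<Phi> p))"
    by simp
  from tendsto_mult_left[OF this, of "1 / (2 * of_real pi * \<i>)"]
  have "a sums (\<psi> p / (1 - deriv \<Phi> p))" by (simp add: sums_def)
  with sua have "(a has_sum (\<psi> p / (1 - deriv \<Phi> p))) UNIV" by (rule norm_summable_imp_has_sum)
  moreover have "a = (\<lambda>k. (deriv ^^ k) (\<lambda>z. \<psi> z * (\<Phi> z - c) ^ k) c / fact k)"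
    by (simp add: fun_eq_iff a_def F_def)
  ultimately show ?thesis by simp
qed

end

section \<open>Iterated function schemes with a symmetry group\<close>

locale ifs_symmetry =
  fixes S :: ifs and G :: "('g, 'm) monoid_scheme" (structure) and act :: "'g \<Rightarrow> complex \<Rightarrow> complex"
  assumes hifs: "holomorphic_ifs S" and sym: "symmetry_group S G act"
begin

abbreviation D where "D \<equiv> ifs_domain S"
abbreviation N where "N \<equiv> {1..ifs_size S}"

definition cen :: "nat \<Rightarrow> complex" where "cen i = (SOME c. \<exists>r>0. disk S i = ball c r)"
definition rad :: "nat \<Rightarrow> real" where "rad i = (SOME r. r > 0 \<and> disk S i = ball (cen i) r)"

lemma rad_pos: "i \<in> N \<Longrightarrow> rad i > 0"
  and disk_eq: "i \<in> N \<Longrightarrow> disk S i = ball (cen i) (rad i)"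
proof -
  assume "i \<in> N"
  then have "\<exists>c r. r > 0 \<and> disk S i = ball c r"
    using hifs by (simp add: holomorphic_ifs_def)
  then have "\<exists>c. \<exists>r>0. disk S i = ball c r" by blast
  from someI_ex[OF this] have "\<exists>r>0. disk S i = ball (cen i) r" unfolding cen_def .
  then have "\<exists>r. r > 0 \<and> disk S i = ball (cen i) r" by blast
  from someI_ex[OF this] show "rad i > 0" "disk S i = ball (cen i) (rad i)" unfolding rad_def by blast+
qed

lemma open_disk: "i \<in> N \<Longrightarrow> open (disk S i)"
  by (simp add: disk_eq)

lemma disk_disjoint: "\<lbrakk>i \<in> N; j \<in> N; u \<in> disk S i; u \<in> disk S j\<rbrakk> \<Longrightarrow> i = j"
  using hifs closure_subset unfolding holomorphic_ifs_def by (metis (no_types, lifting) disjoint_iff subsetD)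

lemma open_D: "open D"
  unfolding ifs_domain_def using open_disk by blast

lemma bounded_D: "bounded D"
  unfolding ifs_domain_def by (intro bounded_UN) (auto simp: disk_eq)

lemma D_disk: "u \<in> D \<longleftrightarrow> (\<exists>i\<in>N. u \<in> disk S i)"
  by (auto simp: ifs_domain_def)

lemma rel_N: "ifs_rel S i j \<Longrightarrow> i \<in> N \<and> j \<in> N"
  by (simp add: ifs_rel_def)

lemma finite_rel: "finite {(i, j). ifs_rel S i j}"
  by (rule finite_subset[of _ "N \<times> N"]) (auto simp: ifs_rel_def)

lemma branch_holomorphic: "ifs_rel S i j \<Longrightarrow> branch S i j holomorphic_on disk S i"
  and branch_compact: "ifs_rel S i j \<Longrightarrow> compact (closure (branch S i j ` disk S i))"
  and branch_closure: "ifs_rel S i j \<Longrightarrow> closure (branch S i j ` disk S i) \<subseteq> disk S j"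
proof -
  assume "ifs_rel S i j"
  then have "biholomorphic_between (branch S i j) (disk S i) (branch S i j ` disk S i)"
    "relatively_compact_in (branch S i j ` disk S i) (disk S j)"
    using hifs unfolding holomorphic_ifs_def by blast+
  then show "branch S i j holomorphic_on disk S i"
    "compact (closure (branch S i j ` disk S i))" "closure (branch S i j ` disk S i) \<subseteq> disk S j"
    by (auto simp: biholomorphic_between_def relatively_compact_in_def bij_betw_def)
qed

lemma branch_in: "ifs_rel S i j \<Longrightarrow> u \<in> disk S i \<Longrightarrow> branch S i j u \<in> disk S j"
  using branch_closure[of i j] closure_subset[of "branch S i j ` disk S i"] by blast

lemma branch_in_image: "ifs_rel S i j \<Longrightarrow> u \<in> disk S i \<Longrightarrow> branch S i j u \<in> ifs_image S"
  by (auto simp: ifs_image_def)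

lemma branch_eq:
  assumes "ifs_rel S i j" "ifs_rel S k l" "u \<in> disk S i" "v \<in> disk S k" "branch S i j u = branch S k l v"
  shows "i = k \<and> j = l"
proof -
  have "branch S i j ` disk S i \<inter> branch S k l ` disk S k \<noteq> {}" using assms by blast
  then have "(i, j) = (k, l)" using hifs assms(1,2) unfolding holomorphic_ifs_def by blast
  then show ?thesis by simp
qed

section \<open>Words, their maps and their weights\<close>

lemma words_length: "w \<in> words S n \<Longrightarrow> length w = Suc n"
  and words_rel: "w \<in> words S n \<Longrightarrow> i < n \<Longrightarrow> ifs_rel S (w ! i) (w ! Suc i)"
  by (auto simp: words_def)

lemma words_N: "w \<in> words S n \<Longrightarrow> i \<le> n \<Longrightarrow> w ! i \<in> N"
  using nth_mem[of i w] unfolding words_def by (simp add: subset_iff)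

lemma finite_words: "finite (words S n)"
  by (rule finite_subset[OF _ finite_lists_length_eq[of N "n + 1"]]) (auto simp: words_def)

lemma words_0: "words S 0 = (\<lambda>i. [i]) ` N"
  by (auto simp: words_def length_Suc_conv image_iff)

lemma words_Suc_iff: "i # w \<in> words S (Suc n) \<longleftrightarrow> w \<in> words S n \<and> ifs_rel S i (w ! 0)"
proof
  assume *: "i # w \<in> words S (Suc n)"
  have "ifs_rel S (w ! k) (w ! Suc k)" if "k < n" for k
    using words_rel[OF *, of "Suc k"] that by simp
  moreover have "ifs_rel S i (w ! 0)" using words_rel[OF *, of 0] by simp
  ultimately show "w \<in> words S n \<and> ifs_rel S i (w ! 0)" using * by (auto simp: words_def)
next
  assume *: "w \<in> words S n \<and> ifs_rel S i (w ! 0)"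
  have "ifs_rel S ((i # w) ! k) ((i # w) ! Suc k)" if "k < Suc n" for k
    using * that by (cases k) (auto simp: words_rel)
  then show "i # w \<in> words S (Suc n)" using * rel_N by (auto simp: words_def)
qed

lemma words_Suc_cases:
  assumes "v \<in> words S (Suc n)"
  obtains i j w where "v = i # j # w" "j # w \<in> words S n" "ifs_rel S i j"
proof -
  obtain i v' where v: "v = i # v'" using words_length[OF assms] by (cases v) auto
  then have v': "v' \<in> words S n" "ifs_rel S i (v' ! 0)" using assms words_Suc_iff by auto
  obtain j w where "v' = j # w" using words_length[OF v'(1)] by (cases v') auto
  then show ?thesis using that v v' by auto
qed

lemma word_map_in: "w \<in> words S n \<Longrightarrow> u \<in> disk S (w ! 0) \<Longrightarrow> word_map S w u \<in> disk S (w ! n)"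
proof (induction n arbitrary: w u)
  case 0
  then show ?case by (auto simp: words_0)
next
  case (Suc n)
  from Suc.prems(1) obtain i j v where v: "w = i # j # v" "j # v \<in> words S n" "ifs_rel S i j"
    by (rule words_Suc_cases)
  then have "branch S i j u \<in> disk S ((j # v) ! 0)" using Suc.prems(2) branch_in by simp
  from Suc.IH[OF v(2) this] show ?case by (simp add: v(1))
qed

lemma word_map_holomorphic: "w \<in> words S n \<Longrightarrow> word_map S w holomorphic_on disk S (w ! 0)"
proof (induction n arbitrary: w)
  case 0
  then show ?case by (auto simp: words_0 intro: holomorphic_on_id)
next
  case (Suc n)
  from Suc.prems(1) obtain i j v where v: "w = i # j # v" "j # v \<in> words S n" "ifs_rel S i j"
    by (rule words_Suc_cases)
  have "word_map S (j # v) \<circ> branch S i j holomorphic_on disk S i"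
    by (rule holomorphic_on_compose_gen[OF branch_holomorphic[OF v(3)] Suc.IH[OF v(2)]]) (use branch_in[OF v(3)] in auto)
  then show ?case by (simp only: v(1) word_map.simps nth_Cons_0)
qed

lemma word_map_last: 
  "w \<in> words S (Suc n) \<Longrightarrow> u \<in> disk S (w ! 0) \<Longrightarrow> word_map S w u \<in> branch S (w ! n) (w ! Suc n) ` disk S (w ! n)"
proof (induction n arbitrary: w u)
  case 0
  from 0(1) obtain i j v where v: "w = i # j # v" "j # v \<in> words S 0" "ifs_rel S i j"
    by (rule words_Suc_cases)
  then show ?case using 0(2) by (auto simp: words_0)
next
  case (Suc n)
  from Suc.prems(1) obtain i j v where v: "w = i # j # v" "j # v \<in> words S (Suc n)" "ifs_rel S i j"
    by (rule words_Suc_cases)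
  then have "branch S i j u \<in> disk S ((j # v) ! 0)" using Suc.prems(2) branch_in by simp
  from Suc.IH[OF v(2) this] show ?case by (simp add: v(1))
qed

text \<open>The last branch of the word sends its disk into a compact subset of
  \<open>disk S (w ! n)\<close>, on which the distance from the centre attains a maximum. The gap
  between \<open>r\<close> and the radius of the disk makes all later series geometric.\<close>

lemma word_map_contained:
  assumes "w \<in> words S n" "n \<ge> 1"
  obtains r where "0 < r" "r < rad (w ! n)" "\<And>u. u \<in> disk S (w ! 0) \<Longrightarrow> dist (cen (w ! n)) (word_map S w u) \<le> r"
proof -
  obtain m where m: "n = Suc m" using assms(2) by (cases n) auto
  define K where "K = closure (branch S (w ! m) (w ! n) ` disk S (w ! m))"
  have rel: "ifs_rel S (w ! m) (w ! n)" using words_rel[OF assms(1), of m] m by simp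
  have nN: "w ! n \<in> N" using words_N[OF assms(1)] by simp
  have K: "compact K" "K \<subseteq> ball (cen (w ! n)) (rad (w ! n))"
    using branch_compact[OF rel] branch_closure[OF rel] disk_eq[OF nN] by (auto simp: K_def)
  have inK: "word_map S w u \<in> K" if "u \<in> disk S (w ! 0)" for u
    unfolding K_def m by (rule subsetD[OF closure_subset word_map_last]) (use assms(1) that m in auto)
  have "\<exists>r<rad (w ! n). \<forall>z\<in>K. dist (cen (w ! n)) z \<le> r"
  proof (cases "K = {}")
    case True
    then show ?thesis using lt_ex by auto
  next
    case False
    have "continuous_on K (\<lambda>z. dist (cen (w ! n)) z)" by (intro continuous_intros)
    from continuous_attains_sup[OF K(1) False this]
    obtain z where z: "z \<in> K" "\<forall>y\<in>K. dist (cen (w ! n)) y \<le> dist (cen (w ! n)) z" by blast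
    then show ?thesis using K(2) by (intro exI[of _ "dist (cen (w ! n)) z"]) auto
  qed
  then obtain r where r: "r < rad (w ! n)" "\<And>z. z \<in> K \<Longrightarrow> dist (cen (w ! n)) z \<le> r" by blast
  \<comment> \<open>The maximum with half the radius of the disk ensures a positive bound.\<close>
  have "0 < max r (rad (w ! n) / 2)" "max r (rad (w ! n) / 2) < rad (w ! n)" using rad_pos[OF nN] r by auto
  moreover have "dist (cen (w ! n)) (word_map S w u) \<le> max r (rad (w ! n) / 2)" if "u \<in> disk S (w ! 0)" for u
    using r(2)[OF inK[OF that]] by simp
  ultimately show ?thesis by (rule that)
qed

text \<open>The factor with index \<open>k = 1\<close> belongs to the first two letters; the others
  are the factors of the tail, started at \<open>branch S i j u\<close>.\<close>

lemma word_weight_Cons: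
  "word_weight S V (i # j # w) u = V (branch S i j u) * word_weight S V (j # w) (branch S i j u)"
proof -
  have "word_weight S V (i # j # w) u
      = (\<Prod>k\<in>Suc ` {0..length w}. V (word_map S (take (k + 1) (i # j # w)) u))"
    by (simp add: word_weight_def image_Suc_atLeastAtMost)
  also have "\<dots> = (\<Prod>k\<in>{0..length w}. V (word_map S (j # take k w) (branch S i j u)))"
    by (subst prod.reindex) auto
  also have "\<dots> = V (branch S i j u) * (\<Prod>k\<in>{1..length w}. V (word_map S (j # take k w) (branch S i j u)))"
    by (subst prod.atLeast_Suc_atMost) auto
  also have "(\<Prod>k\<in>{1..length w}. V (word_map S (j # take k w) (branch S i j u))) = word_weight S V (j # w) (branch S i j u)"
    by (simp add: word_weight_def)
  finally show ?thesis .
qed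

lemma word_weight_single: "word_weight S V [i] u = 1"
  by (simp add: word_weight_def)

lemma word_weight_holomorphic:
  assumes V: "V holomorphic_on ifs_image S"
  shows "w \<in> words S n \<Longrightarrow> word_weight S V w holomorphic_on disk S (w ! 0)"
proof (induction n arbitrary: w)
  case 0
  then show ?case by (auto simp: words_0 word_weight_single[abs_def])
next
  case (Suc n)
  from Suc.prems(1) obtain i j v where v: "w = i # j # v" "j # v \<in> words S n" "ifs_rel S i j"
    by (rule words_Suc_cases)
  have "(\<lambda>u. V (branch S i j u)) holomorphic_on disk S i"
    using holomorphic_on_compose_gen[OF branch_holomorphic[OF v(3)] V] branch_in_image[OF v(3)] by (auto simp: o_def)
  moreover have "(\<lambda>u. word_weight S V (j # v) (branch S i j u)) holomorphic_on disk S i"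
    using holomorphic_on_compose_gen[OF branch_holomorphic[OF v(3)] Suc.IH[OF v(2)]] branch_in[OF v(3)]
    by (auto simp: o_def)
  ultimately show ?case unfolding v(1) word_weight_Cons[abs_def] by (auto intro: holomorphic_on_mult)
qed

text \<open>\<open>max M 1\<close> keeps the base nonnegative even if \<open>ifs_image S\<close> is
  empty and \<open>M\<close> is arbitrary.\<close>

lemma word_weight_bound:
  assumes V: "\<And>z. z \<in> ifs_image S \<Longrightarrow> cmod (V z) \<le> M"
  shows "w \<in> words S n \<Longrightarrow> u \<in> disk S (w ! 0) \<Longrightarrow> cmod (word_weight S V w u) \<le> (max M 1) ^ n"
proof (induction n arbitrary: w u)
  case 0
  then show ?case by (auto simp: words_0 word_weight_single)
next
  case (Suc n)
  from Suc.prems(1) obtain i j v where v: "w = i # j # v" "j # v \<in> words S n" "ifs_rel S i j"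
    by (rule words_Suc_cases)
  have u: "u \<in> disk S i" using Suc.prems(2) v by simp
  have "cmod (V (branch S i j u)) \<le> max M 1" using V[OF branch_in_image[OF v(3) u]] by simp
  moreover have "cmod (word_weight S V (j # v) (branch S i j u)) \<le> (max M 1) ^ n"
    using Suc.IH[OF v(2)] branch_in[OF v(3) u] by simp
  ultimately show ?case unfolding v(1) word_weight_Cons norm_mult power_Suc by (intro mult_mono) auto
qed

section \<open>The group action on disks and symbols\<close>

interpretation group_action G D act
  using sym by (simp add: symmetry_group_def)

lemma group_G: "group G" and finite_G: "finite (carrier G)"
  using sym group_hom group_hom.axioms(1) by (auto simp: symmetry_group_def)

interpretation group G by (rule group_G)

lemma act_in: "g \<in> carrier G \<Longrightarrow> u \<in> D \<Longrightarrow> act g u \<in> D"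
  using element_image by blast

lemma act_mult: "g \<in> carrier G \<Longrightarrow> h \<in> carrier G \<Longrightarrow> u \<in> D \<Longrightarrow> act (g \<otimes> h) u = act g (act h u)"
  using composition_rule by blast

lemma act_one: "u \<in> D \<Longrightarrow> act \<one> u = u"
  using id_eq_one by (metis restrict_apply')

lemma act_inv_act: "g \<in> carrier G \<Longrightarrow> u \<in> D \<Longrightarrow> act (inv g) (act g u) = u"
  and act_act_inv: "g \<in> carrier G \<Longrightarrow> u \<in> D \<Longrightarrow> act g (act (inv g) u) = u"
  by (simp_all add: act_mult[symmetric] act_one)

lemma act_holomorphic: "g \<in> carrier G \<Longrightarrow> act g holomorphic_on D"
  using sym by (simp add: symmetry_group_def)

lemma disk_subset_D: "i \<in> N \<Longrightarrow> disk S i \<subseteq> D"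
  by (auto simp: ifs_domain_def)

text \<open>The image of a disk is connected, and \<open>D\<close> is the disjoint union of the open
  sets \<open>disk S j\<close> and \<open>X\<close>, the union of the other disks.\<close>

lemma act_disk_subset:
  assumes "g \<in> carrier G" "i \<in> N" "j \<in> N" "u \<in> disk S i" "act g u \<in> disk S j"
  shows "act g ` disk S i \<subseteq> disk S j"
proof (rule ccontr)
  assume "\<not> act g ` disk S i \<subseteq> disk S j"
  then obtain v where v: "v \<in> disk S i" "act g v \<notin> disk S j" by blast
  define X where "X = (\<Union>k\<in>N - {j}. disk S k)"
  have "connected (act g ` disk S i)"
  proof (rule connected_continuous_image)
    show "continuous_on (disk S i) (act g)"
      using act_holomorphic[OF assms(1)] disk_subset_D[OF assms(2)] holomorphic_on_imp_continuous_on continuous_on_subset by blast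
    show "connected (disk S i)" using assms by (simp add: disk_eq)
  qed
  moreover have "open (disk S j)" "open X" using assms(3) open_disk by (auto simp: X_def)
  moreover have "disk S j \<inter> X \<inter> act g ` disk S i = {}"
    using disk_disjoint assms(3) unfolding X_def by blast
  moreover have "act g ` disk S i \<subseteq> disk S j \<union> X"
  proof -
    have "D = disk S j \<union> X" unfolding X_def ifs_domain_def using assms(3) by (metis UN_insert insert_Diff)
    moreover have "act g ` disk S i \<subseteq> D"
      by (intro image_subsetI act_in[OF assms(1)] subsetD[OF disk_subset_D[OF assms(2)]])
    ultimately show ?thesis by simp
  qed
  moreover have "disk S j \<inter> act g ` disk S i \<noteq> {}" using assms by blast
  moreover have "X \<inter> act g ` disk S i \<noteq> {}"
  proof -
    have "act g v \<in> D" using act_in[OF assms(1)] disk_subset_D[OF assms(2)] v by blast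
    then obtain k where "k \<in> N" "act g v \<in> disk S k" by (auto simp: D_disk)
    then show ?thesis using v unfolding X_def by blast
  qed
  ultimately show False unfolding connected_def by blast
qed

lemma act_disk:
  assumes "g \<in> carrier G" "i \<in> N" "j \<in> N" "u \<in> disk S i" "act g u \<in> disk S j"
  shows "act g ` disk S i = disk S j"
proof
  show "act g ` disk S i \<subseteq> disk S j" by (rule act_disk_subset[OF assms])
  have uD: "u \<in> D" using disk_subset_D assms by blast
  have "act (inv g) ` disk S j \<subseteq> disk S i"
    by (rule act_disk_subset[of _ _ _ "act g u"]) (use assms act_inv_act[OF assms(1) uD] in auto)
  moreover have "v = act g (act (inv g) v)" if "v \<in> disk S j" for v
    using act_act_inv[OF assms(1), of v] disk_subset_D[OF assms(3)] that by auto
  ultimately show "disk S j \<subseteq> act g ` disk S i" by blast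
qed

lemma symbol_act_eqI:
  assumes "g \<in> carrier G" "i \<in> N" "j \<in> N" "u \<in> disk S i" "act g u \<in> disk S j"
  shows "symbol_act S act g i = j"
  unfolding symbol_act_def
proof (rule the_equality)
  show "j \<in> N \<and> act g ` disk S i = disk S j" using act_disk[OF assms] assms by blast
  fix k assume "k \<in> N \<and> act g ` disk S i = disk S k"
  then show "k = j" using assms disk_disjoint by blast
qed

lemma symbol_act:
  assumes "g \<in> carrier G" "i \<in> N"
  shows "symbol_act S act g i \<in> N" "act g ` disk S i = disk S (symbol_act S act g i)"
proof -
  have u: "cen i \<in> disk S i" using rad_pos disk_eq assms by simp
  then have "act g (cen i) \<in> D" using act_in disk_subset_D assms by blast
  then obtain j where j: "j \<in> N" "act g (cen i) \<in> disk S j" by (auto simp: D_disk)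
  show "symbol_act S act g i \<in> N" "act g ` disk S i = disk S (symbol_act S act g i)"
    using symbol_act_eqI[OF assms j(1) u j(2)] act_disk[OF assms j(1) u j(2)] j by auto
qed

lemma act_in_disk_iff:
  assumes "g \<in> carrier G" "i \<in> N" "j \<in> N" "u \<in> disk S i"
  shows "act g u \<in> disk S j \<longleftrightarrow> symbol_act S act g i = j"
  using symbol_act_eqI[OF assms] symbol_act[OF assms(1,2)] assms(4) by blast

end

lemma bounded_holomorphic_in_bergman_space:
  assumes "open D" "bounded D" "f holomorphic_on D" "\<And>u. u \<notin> D \<Longrightarrow> f u = 0" "\<And>u. u \<in> D \<Longrightarrow> cmod (f u) \<le> K"
  shows "f \<in> bergman_space D" "Re (bergman_inner D f f) \<le> K\<^sup>2 * measure lborel D"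
proof -
  have fin: "emeasure lborel D < \<infinity>" using assms(2) emeasure_bounded_finite by auto
  have "(\<integral>\<^sup>+u\<in>D. ennreal ((cmod (f u))\<^sup>2) \<partial>lborel) \<le> (\<integral>\<^sup>+u\<in>D. ennreal (K\<^sup>2) \<partial>lborel)"
    using assms(5) by (intro nn_integral_mono) (auto simp: indicator_def intro!: ennreal_leI power_mono)
  also have "\<dots> = ennreal (K\<^sup>2) * emeasure lborel D"
    using assms(1) by (subst nn_integral_cmult_indicator) auto
  also have "\<dots> = ennreal (K\<^sup>2 * measure lborel D)"
    using fin by (simp add: emeasure_eq_ennreal_measure ennreal_mult)
  finally have le: "(\<integral>\<^sup>+u\<in>D. ennreal ((cmod (f u))\<^sup>2) \<partial>lborel) \<le> ennreal (K\<^sup>2 * measure lborel D)" .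
  then show f: "f \<in> bergman_space D"
    unfolding bergman_space_iff_nn_integral[OF assms(1)] using assms(3,4) by (auto simp: le_less_trans)
  show "Re (bergman_inner D f f) \<le> K\<^sup>2 * measure lborel D"
    using le[folded ennreal_bergman_inner_same[OF assms(1) f]] by (subst (asm) ennreal_le_iff) auto
qed

section \<open>Iterates and symmetry of the transfer operator, and the action on the Bergman
  space\<close>

context ifs_symmetry begin

text \<open>One more application of the operator prepends a letter, since the earlier iterate is
  evaluated at \<open>branch S i j u\<close>. That \<open>f\<close> vanishes off \<open>D\<close>
  enters at length 0, where the sum is empty for \<open>u\<close> outside \<open>D\<close>.\<close>

lemma transfer_op_pow:
  assumes f: "\<And>u. u \<notin> D \<Longrightarrow> f u = 0"
  shows "(transfer_op S V ^^ n) f u = (\<Sum>w\<in>{w \<in> words S n. u \<in> disk S (w ! 0)}. word_weight S V w u * f (word_map S w u))"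
proof (induction n arbitrary: u)
  case 0
  show ?case
  proof (cases "u \<in> D")
    case True
    then obtain i where i: "i \<in> N" "u \<in> disk S i" by (auto simp: D_disk)
    then have "{w \<in> words S 0. u \<in> disk S (w ! 0)} = {[i]}"
      using disk_disjoint by (auto simp: words_0)
    then show ?thesis by (simp add: word_weight_single)
  next
    case False
    then have e: "{w \<in> words S 0. u \<in> disk S (w ! 0)} = {}"
      by (auto simp: words_0 D_disk)
    show ?thesis unfolding e using f False by simp
  qed
next
  case (Suc n)
  define P where "P = {(i, j). ifs_rel S i j \<and> u \<in> disk S i}"
  define W where "W = (\<lambda>p::nat \<times> nat. {w \<in> words S n. w ! 0 = snd p})"
  have finP: "finite P" unfolding P_def by (rule finite_subset[OF _ finite_rel]) auto
  have finW: "finite (W p)" for p unfolding W_def using finite_words by simp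
  have "(transfer_op S V ^^ Suc n) f u
      = (\<Sum>p\<in>P. V (branch S (fst p) (snd p) u) * (transfer_op S V ^^ n) f (branch S (fst p) (snd p) u))"
    by (simp add: transfer_op_def P_def case_prod_beta)
  also have "\<dots> = (\<Sum>p\<in>P. \<Sum>w\<in>W p. word_weight S V (fst p # w) u * f (word_map S (fst p # w) u))"
  proof (intro sum.cong refl)
    fix p assume p: "p \<in> P"
    obtain i j where ij: "p = (i, j)" "ifs_rel S i j" "u \<in> disk S i" using p by (auto simp: P_def)
    have b: "branch S i j u \<in> disk S j" using branch_in ij by blast
    \<comment> \<open>A point lies in at most one disk, so the words available at the image point
      are those starting with \<open>j\<close>.\<close>
    have "{w \<in> words S n. branch S i j u \<in> disk S (w ! 0)} = W p"
      unfolding W_def ij(1) using b disk_disjoint words_N[of _ n 0] rel_N[OF ij(2)] by auto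
    then have "(transfer_op S V ^^ n) f (branch S i j u)
        = (\<Sum>w\<in>W p. word_weight S V w (branch S i j u) * f (word_map S w (branch S i j u)))"
      unfolding Suc.IH by simp
    moreover have "V (branch S i j u) * (word_weight S V w (branch S i j u) * f (word_map S w (branch S i j u)))
        = word_weight S V (i # w) u * f (word_map S (i # w) u)" if "w \<in> W p" for w
    proof -
      have w: "w \<in> words S n" "w ! 0 = j" using that by (simp_all add: W_def ij(1))
      obtain v where "w = j # v" using w(2) words_length[OF w(1)] by (cases w) auto
      then show ?thesis by (simp add: word_weight_Cons)
    qed
    ultimately show "V (branch S (fst p) (snd p) u) * (transfer_op S V ^^ n) f (branch S (fst p) (snd p) u)
        = (\<Sum>w\<in>W p. word_weight S V (fst p # w) u * f (word_map S (fst p # w) u))"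
      by (simp add: ij(1) sum_distrib_left)
  qed
  also have "\<dots> = (\<Sum>(p, w)\<in>Sigma P W. word_weight S V (fst p # w) u * f (word_map S (fst p # w) u))"
    using finP finW by (subst sum.Sigma) auto
  also have "\<dots> = (\<Sum>w\<in>{w \<in> words S (Suc n). u \<in> disk S (w ! 0)}. word_weight S V w u * f (word_map S w u))"
  \<comment> \<open>A longer word corresponds to its tail together with the pair of its first two
    letters; the second letter is recorded twice, as an entry of the pair and as head of the
    tail.\<close>
  proof (rule sum.reindex_bij_witness[where j = "\<lambda>(p, w). fst p # w" and i = "\<lambda>v. ((hd v, hd (tl v)), tl v)"])
    fix a assume "a \<in> Sigma P W"
    then obtain i j w where a: "a = ((i, j), w)" "ifs_rel S i j" "u \<in> disk S i" "w \<in> words S n" "w ! 0 = j"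
      by (auto simp: P_def W_def)
    obtain v where v: "w = j # v" using a words_length[of w n] by (cases w) auto
    show "(\<lambda>v. ((hd v, hd (tl v)), tl v)) ((\<lambda>(p, w). fst p # w) a) = a" by (simp add: a v)
    show "(\<lambda>(p, w). fst p # w) a \<in> {w \<in> words S (Suc n). u \<in> disk S (w ! 0)}"
      using a words_Suc_iff by simp
  next
    fix b assume b: "b \<in> {w \<in> words S (Suc n). u \<in> disk S (w ! 0)}"
    then obtain i j w where "b = i # j # w" "j # w \<in> words S n" "ifs_rel S i j"
      using words_Suc_cases by blast
    then show "(\<lambda>(p, w). fst p # w) ((hd b, hd (tl b)), tl b) = b" "((hd b, hd (tl b)), tl b) \<in> Sigma P W"
      using b by (auto simp: P_def W_def)
  qed (auto split: prod.splits)
  finally show ?case .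
qed

interpretation group G by (rule group_G)

text \<open>Symmetry only provides some pair \<open>k\<close>, \<open>l\<close> for each pair
  \<open>i\<close>, \<open>j\<close>. Working with the set of image points instead of index pairs
  turns equivariance into an equality of two sets.\<close>

definition branch_images :: "complex \<Rightarrow> complex set" where
  "branch_images u = (\<lambda>(i, j). branch S i j u) ` {(i, j). ifs_rel S i j \<and> u \<in> disk S i}"

text \<open>Disjointness of the branch images makes the indexing injective, so no two terms are
  merged when the sum runs over points.\<close>

lemma transfer_op_branch_images: "transfer_op S V f u = (\<Sum>x\<in>branch_images u. V x * f x)"
proof -
  have "inj_on (\<lambda>(i, j). branch S i j u) {(i, j). ifs_rel S i j \<and> u \<in> disk S i}"
    by (rule inj_onI) (use branch_eq in auto)
  then show ?thesis unfolding transfer_op_def branch_images_def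
    by (subst sum.reindex) (auto intro!: sum.cong)
qed

lemma branch_images_in: "x \<in> branch_images u \<Longrightarrow> x \<in> D \<and> x \<in> ifs_image S"
proof -
  assume "x \<in> branch_images u"
  then obtain i j where ij: "ifs_rel S i j" "u \<in> disk S i" "x = branch S i j u" by (auto simp: branch_images_def)
  have "x \<in> disk S j" using branch_in[OF ij(1,2)] ij(3) by simp
  moreover have "j \<in> N" using rel_N[OF ij(1)] by blast
  ultimately show ?thesis using branch_in_image[OF ij(1,2)] ij(3) D_disk by blast
qed

lemma branch_images_empty: "u \<notin> D \<Longrightarrow> branch_images u = {}"
proof -
  assume "u \<notin> D"
  then have "\<not> (ifs_rel S i j \<and> u \<in> disk S i)" for i j using rel_N[of i j] D_disk by blast
  then show ?thesis by (simp add: branch_images_def)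
qed

lemma act_branch_images_subset:
  assumes "g \<in> carrier G" shows "act g ` branch_images u \<subseteq> branch_images (act g u)"
proof
  fix y assume "y \<in> act g ` branch_images u"
  then obtain i j where ij: "ifs_rel S i j" "u \<in> disk S i" "y = act g (branch S i j u)"
    by (auto simp: branch_images_def)
  obtain k l where "ifs_rel S k l" "\<forall>u\<in>disk S i. act g u \<in> disk S k \<and> act g (branch S i j u) = branch S k l (act g u)"
    using sym assms ij(1) unfolding symmetry_group_def by blast
  then show "y \<in> branch_images (act g u)" unfolding branch_images_def using ij by force
qed

text \<open>The symmetry condition gives one inclusion; the other is the same inclusion for
  \<open>inv g\<close>.\<close>

lemma act_branch_images:
  assumes g: "g \<in> carrier G" and u: "u \<in> D" shows "act g ` branch_images u = branch_images (act g u)"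
proof
  show "act g ` branch_images u \<subseteq> branch_images (act g u)" by (rule act_branch_images_subset[OF g])
  have "act (inv g) ` branch_images (act g u) \<subseteq> branch_images u"
    using act_branch_images_subset[of "inv g" "act g u"] g act_inv_act[OF g u] by simp
  then have "act g ` act (inv g) ` branch_images (act g u) \<subseteq> act g ` branch_images u" by blast
  moreover have "act g ` act (inv g) ` branch_images (act g u) = branch_images (act g u)"
    using act_act_inv[OF g] branch_images_in by (force simp: image_image)
  ultimately show "branch_images (act g u) \<subseteq> act g ` branch_images u" by simp
qed

text \<open>The sum over image points is reindexed by \<open>act (inv g)\<close>, and invariance of
  \<open>V\<close> on the image set removes the group element from the weight.\<close>

lemma transfer_op_act:
  assumes V: "invariant_potential S G act V" and g: "g \<in> carrier G"
  shows "act_on_functions S G act g (transfer_op S V f) u = transfer_op S V (act_on_functions S G act g f) u"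
proof (cases "u \<in> D")
  case True
  have gi: "inv g \<in> carrier G" using g by simp
  have inj: "inj_on (act (inv g)) (branch_images u)"
    using act_act_inv[OF g] branch_images_in by (metis inj_onI)
  have "act_on_functions S G act g (transfer_op S V f) u = (\<Sum>x\<in>act (inv g) ` branch_images u. V x * f x)"
    using True by (simp add: act_on_functions_def transfer_op_branch_images act_branch_images[OF gi True])
  also have "\<dots> = (\<Sum>x\<in>branch_images u. V (act (inv g) x) * f (act (inv g) x))"
    using inj by (simp add: sum.reindex)
  also have "\<dots> = (\<Sum>x\<in>branch_images u. V x * act_on_functions S G act g f x)"
    using V gi branch_images_in by (intro sum.cong) (auto simp: invariant_potential_def act_on_functions_def)
  finally show ?thesis by (simp add: transfer_op_branch_images)
next
  case False
  then have "branch_images u = {}" by (rule branch_images_empty)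
  then show ?thesis using False by (simp add: act_on_functions_def transfer_op_branch_images)
qed

lemma transfer_op_sum:
  "transfer_op S V (\<lambda>u. b * (\<Sum>g\<in>A. c g * f g u)) u = b * (\<Sum>g\<in>A. c g * transfer_op S V (f g) u)"
  unfolding transfer_op_branch_images sum_distrib_left
  by (subst sum.swap) (simp add: mult_ac)

lemma transfer_op_isotypic_proj:
  assumes V: "invariant_potential S G act V"
  shows "isotypic_proj S G act \<rho> (transfer_op S V f) = transfer_op S V (isotypic_proj S G act \<rho> f)"
proof
  fix u
  show "isotypic_proj S G act \<rho> (transfer_op S V f) u = transfer_op S V (isotypic_proj S G act \<rho> f) u"
    unfolding isotypic_proj_def[abs_def] transfer_op_sum by (simp add: transfer_op_act[OF V])
qed

text \<open>Branch images are relatively compact in \<open>D\<close>, so \<open>f\<close> is bounded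
  on them; the result is a bounded holomorphic function on a bounded open set.\<close>

lemma transfer_op_bergman:
  assumes V: "V holomorphic_on ifs_image S" "\<And>z. z \<in> ifs_image S \<Longrightarrow> cmod (V z) \<le> M"
    and f: "f \<in> bergman_space D"
  shows "transfer_op S V f \<in> bergman_space D"
proof -
  have fh: "f holomorphic_on D" using f by (rule bergman_space_holomorphic)
  have "\<exists>K. \<forall>u\<in>disk S i. cmod (f (branch S i j u)) \<le> K" if ij: "ifs_rel S i j" for i j
  proof -
    have "closure (branch S i j ` disk S i) \<subseteq> D" 
      by (rule subset_trans[OF branch_closure[OF ij] disk_subset_D]) (use rel_N[OF ij] in blast)
    then have "compact (f ` closure (branch S i j ` disk S i))"
      using branch_compact[OF ij] fh by (intro compact_continuous_image holomorphic_on_imp_continuous_on) (auto intro: holomorphic_on_subset)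
    then obtain K where "\<forall>x\<in>f ` closure (branch S i j ` disk S i). cmod x \<le> K"
      using compact_imp_bounded bounded_iff by metis
    then show ?thesis using closure_subset by blast
  qed
  then obtain K where K: "\<And>i j u. ifs_rel S i j \<Longrightarrow> u \<in> disk S i \<Longrightarrow> cmod (f (branch S i j u)) \<le> K i j" by metis
  define B where "B = (\<Sum>(i, j)\<in>{(i, j). ifs_rel S i j}. \<bar>M\<bar> * \<bar>K i j\<bar>)"
  have bd: "cmod (transfer_op S V f u) \<le> B" for u
  proof -
    have "cmod (transfer_op S V f u) \<le> (\<Sum>(i, j)\<in>{(i, j). ifs_rel S i j \<and> u \<in> disk S i}. \<bar>M\<bar> * \<bar>K i j\<bar>)"
      unfolding transfer_op_def
    proof (rule sum_norm_le, clarify)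
      fix i j assume ij: "ifs_rel S i j" "u \<in> disk S i"
      have "cmod (V (branch S i j u)) \<le> \<bar>M\<bar>" using V(2)[OF branch_in_image[OF ij]] by simp
      moreover have "cmod (f (branch S i j u)) \<le> \<bar>K i j\<bar>" using K[OF ij] by simp
      ultimately show "cmod (V (branch S i j u) * f (branch S i j u)) \<le> \<bar>M\<bar> * \<bar>K i j\<bar>"
        unfolding norm_mult by (intro mult_mono) auto
    qed
    also have "\<dots> \<le> B" unfolding B_def using finite_rel by (intro sum_mono2) auto
    finally show ?thesis .
  qed
  have hol: "transfer_op S V f holomorphic_on disk S i" if i: "i \<in> N" for i
  proof -
    have "(\<lambda>u. \<Sum>(i, j)\<in>{(k, j). ifs_rel S k j \<and> k = i}. V (branch S i j u) * f (branch S i j u)) holomorphic_on disk S i"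
    proof (intro holomorphic_on_sum, clarify)
      fix j assume ij: "ifs_rel S i j"
      have "(\<lambda>u. V (branch S i j u)) holomorphic_on disk S i"
        using holomorphic_on_compose_gen[OF branch_holomorphic[OF ij] V(1)] branch_in_image[OF ij] by (auto simp: o_def)
      moreover have "branch S i j ` disk S i \<subseteq> D" 
        using branch_in[OF ij] disk_subset_D[of j] rel_N[OF ij] by blast
      then have "(\<lambda>u. f (branch S i j u)) holomorphic_on disk S i"
        using holomorphic_on_compose_gen[OF branch_holomorphic[OF ij] fh] by (auto simp: o_def)
      ultimately show "(\<lambda>u. V (branch S i j u) * f (branch S i j u)) holomorphic_on disk S i"
        by (rule holomorphic_on_mult)
    qed
    moreover have "{(k, j). ifs_rel S k j \<and> k = i} = {(k, j). ifs_rel S k j \<and> u \<in> disk S k}" if "u \<in> disk S i" for u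
    proof -
      have "k = i" if "ifs_rel S k j" "u \<in> disk S k" for k j
        using disk_disjoint[OF _ i that(2) \<open>u \<in> disk S i\<close>] rel_N[OF that(1)] by blast
      then show ?thesis using \<open>u \<in> disk S i\<close> by auto
    qed
    then have "(\<Sum>(i, j)\<in>{(k, j). ifs_rel S k j \<and> k = i}. V (branch S i j u) * f (branch S i j u)) = transfer_op S V f u"
      if "u \<in> disk S i" for u using that by (simp add: transfer_op_def)
    ultimately show ?thesis by (rule holomorphic_transform)
  qed
  show ?thesis
  proof (rule bounded_holomorphic_in_bergman_space(1)[OF open_D bounded_D])
    show "transfer_op S V f holomorphic_on D"
      unfolding ifs_domain_def using hol open_disk by (intro holomorphic_on_UN_open) auto
    show "transfer_op S V f u = 0" if "u \<notin> D" for u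
      using branch_images_empty[OF that] by (simp add: transfer_op_branch_images)
  qed (rule bd)
qed

text \<open>On each disk the substitution estimate bounds the new integral by a multiple of the old
  one, because an isomorphism between two disks has bounded derivative.\<close>

lemma act_on_functions_bergman:
  assumes g: "g \<in> carrier G" and f: "f \<in> bergman_space D"
  shows "act_on_functions S G act g f \<in> bergman_space D"
proof -
  have gi: "inv g \<in> carrier G" using g by simp
  have fh: "f holomorphic_on D" using f by (rule bergman_space_holomorphic)
  have hol: "act_on_functions S G act g f holomorphic_on D"
  proof (rule holomorphic_transform)
    show "(\<lambda>u. f (act (inv g) u)) holomorphic_on D"
      using holomorphic_on_compose_gen[OF act_holomorphic[OF gi] fh] act_in[OF gi] by (auto simp: o_def)
  qed (simp add: act_on_functions_def)
  define F where "F = (\<lambda>u. ennreal ((cmod (f u))\<^sup>2))"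
  have "(\<lambda>u. indicator D u *\<^sub>R f u) = f" using f by (auto simp: bergman_space_def indicator_def)
  then have "f \<in> borel_measurable borel" using holomorphic_indicator_measurable[OF open_D fh] by simp
  then have F: "F \<in> borel_measurable borel" unfolding F_def by measurable
  have fin: "(\<integral>\<^sup>+u\<in>D. F u \<partial>lborel) < \<infinity>" using f unfolding F_def by (simp add: bergman_space_iff_nn_integral[OF open_D])
  have disk_fin: "(\<integral>\<^sup>+v\<in>disk S j. F (act (inv g) v) \<partial>lborel) < \<infinity>" if j: "j \<in> N" for j
  proof -
    define i where "i = symbol_act S act (inv g) j"
    have i: "i \<in> N" "act (inv g) ` disk S j = disk S i" using symbol_act[OF gi j] by (auto simp: i_def)
    have ij: "act g ` disk S i \<subseteq> disk S j"
      unfolding i(2)[symmetric] using act_act_inv[OF g] disk_subset_D[OF j] by auto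
    have D: "u \<in> D" if "u \<in> disk S i \<or> u \<in> disk S j" for u using that disk_subset_D[OF j] disk_subset_D[OF i(1)] by blast
    have h: "act g holomorphic_on disk S i" "act (inv g) holomorphic_on disk S j"
      using act_holomorphic g gi disk_subset_D i j by (blast intro: holomorphic_on_subset)+
    \<comment> \<open>The integrand is composed with \<open>act (inv g)\<close>, so the substitution
      is made by \<open>act g\<close> and its derivative enters.\<close>
    have "\<exists>B. \<forall>z\<in>disk S i. cmod (deriv (act g) z) \<le> B"
      using disc_biholomorphism_deriv_bounded[of "rad i" "rad j" "act g" "cen i" "cen j" "act (inv g)"]
        h ij i j rad_pos act_inv_act[OF g] act_act_inv[OF g] D by (simp add: disk_eq)
    then obtain B where B: "\<And>z. z \<in> disk S i \<Longrightarrow> cmod (deriv (act g) z) \<le> B" by blast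
    have "(\<integral>\<^sup>+v\<in>disk S j. F (act (inv g) v) \<partial>lborel) \<le> ennreal (B\<^sup>2) * (\<integral>\<^sup>+u\<in>disk S i. F u \<partial>lborel)"
      using i j act_inv_act[OF g] act_act_inv[OF g] D B ij
      by (intro nn_integral_holomorphic_substitution_le[OF _ _ _ h _ _ _ _ _ F] open_disk) (auto simp: disk_eq)
    also have "\<dots> \<le> ennreal (B\<^sup>2) * (\<integral>\<^sup>+u\<in>D. F u \<partial>lborel)"
      using disk_subset_D[OF i(1)] by (intro mult_left_mono nn_set_integral_set_mono) auto
    also have "\<dots> < \<infinity>" using fin by (simp add: ennreal_mult_less_top less_top)
    finally show ?thesis .
  qed
  have "(\<integral>\<^sup>+u\<in>D. ennreal ((cmod (act_on_functions S G act g f u))\<^sup>2) \<partial>lborel)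
      \<le> (\<integral>\<^sup>+v. (\<Sum>j\<in>N. F (act (inv g) v) * indicator (disk S j) v) \<partial>lborel)"
  proof (rule nn_integral_mono)
    fix u
    show "ennreal ((cmod (act_on_functions S G act g f u))\<^sup>2) * indicator D u
        \<le> (\<Sum>j\<in>N. F (act (inv g) u) * indicator (disk S j) u)"
    proof (cases "u \<in> D")
      case True
      then obtain j where j: "j \<in> N" "u \<in> disk S j" by (auto simp: D_disk)
      have "F (act (inv g) u) * indicator (disk S j) u \<le> (\<Sum>j\<in>N. F (act (inv g) u) * indicator (disk S j) u)"
        using j by (intro member_le_sum) auto
      then show ?thesis using True j by (simp add: act_on_functions_def F_def)
    qed simp
  qed
  also have "\<dots> = (\<Sum>j\<in>N. \<integral>\<^sup>+v\<in>disk S j. F (act (inv g) v) \<partial>lborel)"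
  proof (rule nn_integral_sum)
    fix j assume j: "j \<in> N"
    have "continuous_on (disk S j) (\<lambda>v. f (act (inv g) v))"
    proof (rule continuous_on_compose2[OF holomorphic_on_imp_continuous_on[OF fh]])
      show "continuous_on (disk S j) (act (inv g))"
        using act_holomorphic[OF gi] disk_subset_D[OF j] by (blast intro: holomorphic_on_imp_continuous_on holomorphic_on_subset)
      show "act (inv g) ` disk S j \<subseteq> D" using act_in[OF gi] disk_subset_D[OF j] by blast
    qed
    then have "(\<lambda>v. indicator (disk S j) v *\<^sub>R (cmod (f (act (inv g) v)))\<^sup>2) \<in> borel_measurable borel"
      using open_disk[OF j] by (intro borel_measurable_continuous_on_indicator continuous_intros) auto
    then have "(\<lambda>v. ennreal (indicator (disk S j) v *\<^sub>R (cmod (f (act (inv g) v)))\<^sup>2)) \<in> borel_measurable borel"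
      by measurable
    also have "(\<lambda>v. ennreal (indicator (disk S j) v *\<^sub>R (cmod (f (act (inv g) v)))\<^sup>2)) = (\<lambda>v. F (act (inv g) v) * indicator (disk S j) v)"
      by (auto simp: F_def indicator_def)
    finally show "(\<lambda>v. F (act (inv g) v) * indicator (disk S j) v) \<in> borel_measurable lborel" by simp
  qed
  also have "\<dots> < \<infinity>" using disk_fin by (simp add: less_top)
  finally show ?thesis unfolding bergman_space_iff_nn_integral[OF open_D] using hol by (simp add: act_on_functions_def)
qed

lemma act_on_functions_mult:
  assumes "g \<in> carrier G" "h \<in> carrier G"
  shows "act_on_functions S G act g (act_on_functions S G act h f) = act_on_functions S G act (g \<otimes> h) f"
  using assms act_in[of "inv g"] by (auto simp: fun_eq_iff act_on_functions_def inv_mult_group act_mult)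

end

section \<open>Bergman spaces as Hilbert spaces, and series in them\<close>

abbreviation fun_scale :: "complex \<Rightarrow> (complex \<Rightarrow> complex) \<Rightarrow> complex \<Rightarrow> complex" where
  "fun_scale a f \<equiv> (\<lambda>u. a * f u)"

lemma sum_fun_apply: "(\<Sum>i\<in>F. f i) u = (\<Sum>i\<in>F. f i u)" for f :: "'i \<Rightarrow> complex \<Rightarrow> complex"
  by (induction F rule: infinite_finite_induct) (auto simp: plus_fun_def zero_fun_def)

text \<open>Norm limits in the Bergman space are also pointwise limits, so a subspace is complete as
  soon as it contains the pointwise limits that belong to the Bergman space.\<close>

lemma carrier_hilbert_bergman:
  assumes "open D" and sub: "H \<subseteq> bergman_space D" and zero: "(\<lambda>_. 0) \<in> H"
    and lin: "\<And>f h a b. f \<in> H \<Longrightarrow> h \<in> H \<Longrightarrow> (\<lambda>u. a * f u + b * h u) \<in> H"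
    and lim: "\<And>X f. \<lbrakk>\<And>n. X n \<in> H; f \<in> bergman_space D; \<And>u. (\<lambda>n. X n u) \<longlonglongrightarrow> f u\<rbrakk> \<Longrightarrow> f \<in> H"
  shows "carrier_hilbert fun_scale H (bergman_inner D)"
proof -
  have vs: "vector_space fun_scale"
    by unfold_locales (auto simp: fun_eq_iff algebra_simps plus_fun_def)
  interpret vector_space fun_scale by (rule vs)
  have B: "f \<in> bergman_space D" if "f \<in> H" for f using sub that by blast
  show ?thesis
  proof
    show "subspace H"
      unfolding subspace_def
    proof (intro conjI ballI allI)
      show "0 \<in> H" using zero by (simp add: zero_fun_def)
      show "f + h \<in> H" if "f \<in> H" "h \<in> H" for f h using lin[OF that, of 1 1] by (simp add: plus_fun_def)
      show "fun_scale a f \<in> H" if "f \<in> H" for a f using lin[OF that that, of a 0] by simp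
    qed
    show "bergman_inner D (f + h) k = bergman_inner D f k + bergman_inner D h k" if "f \<in> H" "h \<in> H" "k \<in> H" for f h k
      using bergman_inner_lincomb[OF assms(1) B[OF that(1)] B[OF that(2)] B[OF that(3)], of 1 1] by (simp add: plus_fun_def)
    show "bergman_inner D (fun_scale a f) k = a * bergman_inner D f k" if "f \<in> H" "k \<in> H" for a f k
      using bergman_inner_lincomb[OF assms(1) B[OF that(1)] B[OF that(1)] B[OF that(2)], of a 0] by simp
    show "bergman_inner D h f = cnj (bergman_inner D f h)" for f h by (rule bergman_inner_cnj)
    show "0 \<le> Re (bergman_inner D f f)" for f by (rule bergman_inner_same_ge_0)
    show "f = 0" if "f \<in> H" "Re (bergman_inner D f f) = 0" for f
      using bergman_inner_same_eq_0[OF assms(1) B[OF that(1)] that(2)] by (simp add: zero_fun_def)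
    fix X :: "nat \<Rightarrow> complex \<Rightarrow> complex"
    assume X: "\<And>n. X n \<in> H"
      and C: "\<And>e. 0 < e \<Longrightarrow> \<exists>M. \<forall>m\<ge>M. \<forall>n\<ge>M. Re (bergman_inner D (X m - X n) (X m - X n)) < e"
    obtain f where f: "f \<in> bergman_space D" "\<And>u. (\<lambda>n. X n u) \<longlonglongrightarrow> f u"
      "(\<lambda>n. Re (bergman_inner D (\<lambda>u. X n u - f u) (\<lambda>u. X n u - f u))) \<longlonglongrightarrow> 0"
      by (rule bergman_space_complete[OF assms(1), of X]) (use X B C in \<open>auto simp: fun_diff_def\<close>)
    show "\<exists>x\<in>H. (\<lambda>n. Re (bergman_inner D (X n - x) (X n - x))) \<longlonglongrightarrow> 0"
      using lim[OF X f(1,2)] f(3) by (intro bexI[of _ f]) (auto simp: fun_diff_def)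
  qed
qed

lemma zero_bergman: "(\<lambda>_. 0) \<in> bergman_space D"
  by (simp add: bergman_space_def set_integrable_def)

lemma carrier_hilbert_bergman_space: "open D \<Longrightarrow> carrier_hilbert fun_scale (bergman_space D) (bergman_inner D)"
  by (intro carrier_hilbert_bergman bergman_space_lincomb zero_bergman) auto

lemma bergman_nrm_bounded:
  assumes "open D" "bounded D" "f \<in> bergman_space D" "\<And>u. u \<in> D \<Longrightarrow> cmod (f u) \<le> K" "0 \<le> K"
  shows "sqrt (Re (bergman_inner D f f)) \<le> K * sqrt (measure lborel D)"
proof -
  have "Re (bergman_inner D f f) \<le> K\<^sup>2 * measure lborel D"
    using assms by (intro bounded_holomorphic_in_bergman_space(2)) (auto simp: bergman_space_def)
  then have "sqrt (Re (bergman_inner D f f)) \<le> sqrt (K\<^sup>2 * measure lborel D)" by simp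
  then show ?thesis using assms(5) by (simp add: real_sqrt_mult)
qed

text \<open>The majorant bounds the tail of the series in the supremum norm, hence in the Bergman
  norm with the extra factor \<open>A\<close>, the root of the area; Cauchy-Schwarz passes to inner
  products.\<close>

lemma bergman_inner_has_sum:
  assumes D: "open D" "bounded D" and f: "\<And>i. i \<in> I \<Longrightarrow> f i \<in> bergman_space D" and t: "t \<in> bergman_space D"
    and hs: "\<And>u. u \<in> D \<Longrightarrow> ((\<lambda>i. f i u) has_sum t u) I"
    and m: "\<And>i u. i \<in> I \<Longrightarrow> u \<in> D \<Longrightarrow> cmod (f i u) \<le> m i" "m summable_on I" "\<And>i. i \<in> I \<Longrightarrow> 0 \<le> m i"
    and h: "h \<in> bergman_space D"
  shows "((\<lambda>i. bergman_inner D (f i) h) has_sum bergman_inner D t h) I"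
proof -
  interpret carrier_hilbert fun_scale "bergman_space D" "bergman_inner D"
    by (rule carrier_hilbert_bergman_space[OF D(1)])
  define A where "A = sqrt (measure lborel D)"
  show ?thesis unfolding has_sum_def
  proof (rule LIM_zero_cancel, rule Lim_null_comparison)
    show "\<forall>\<^sub>F F in finite_subsets_at_top I. norm ((\<Sum>i\<in>F. bergman_inner D (f i) h) - bergman_inner D t h)
        \<le> (infsum m I - sum m F) * A * nrm h"
    proof (rule eventually_finite_subsets_at_top_weakI)
      fix F assume F: "finite F" "F \<subseteq> I"
      define v where "v = (\<Sum>i\<in>F. f i)"
      have vH: "v \<in> bergman_space D" unfolding v_def using f F by (intro H_sum) auto
      have dH: "v - t \<in> bergman_space D" using vH t by blast
      have mIF: "m summable_on (I - F)" using m(2) by (rule summable_on_subset_banach) auto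
      have tail: "infsum m (I - F) = infsum m I - sum m F"
        using infsum_Diff[of m I F] m(2) F by simp
      have bd: "cmod ((v - t) u) \<le> infsum m (I - F)" if u: "u \<in> D" for u
      proof -
        have "((\<lambda>i. f i u) has_sum (t u - sum (\<lambda>i. f i u) F)) (I - F)"
          using has_sum_Diff[OF hs[OF u] has_sum_finite[OF F(1)] F(2)] .
        from norm_infsum_le[OF this has_sum_infsum[OF mIF]] m(1) u
        have "cmod (t u - sum (\<lambda>i. f i u) F) \<le> infsum m (I - F)" by auto
        then show ?thesis by (simp add: v_def sum_fun_apply fun_diff_def norm_minus_commute)
      qed
      have K0: "0 \<le> infsum m (I - F)" using m(3) by (intro infsum_nonneg) auto
      have "nrm (v - t) \<le> infsum m (I - F) * A"
        unfolding nrm_def A_def by (rule bergman_nrm_bounded[OF D dH bd K0])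
      then have "nrm (v - t) * nrm h \<le> infsum m (I - F) * A * nrm h" using h by (intro mult_right_mono) auto
      moreover have "(\<Sum>i\<in>F. bergman_inner D (f i) h) - bergman_inner D t h = bergman_inner D (v - t) h"
        unfolding v_def using h t f F by (subst ip_diff) (auto simp: ip_sum subset_iff)
      ultimately show "norm ((\<Sum>i\<in>F. bergman_inner D (f i) h) - bergman_inner D t h)
        \<le> (infsum m I - sum m F) * A * nrm h"
        using Cauchy_Schwarz[OF dH h] by (simp add: tail)
    qed
    have "(sum m \<longlongrightarrow> infsum m I) (finite_subsets_at_top I)" using m(2) by (rule infsum_tendsto)
    then have "((\<lambda>F. (infsum m I - sum m F) * A * nrm h) \<longlongrightarrow> (infsum m I - infsum m I) * A * nrm h) (finite_subsets_at_top I)"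
      by (intro tendsto_intros)
    then show "((\<lambda>F. (infsum m I - sum m F) * A * nrm h) \<longlongrightarrow> 0) (finite_subsets_at_top I)" by simp
  qed
qed

lemma has_sum_finite_sum:
  fixes f :: "'a \<Rightarrow> 'b \<Rightarrow> complex"
  assumes "finite A" "\<And>x. x \<in> A \<Longrightarrow> (f x has_sum s x) B"
  shows "((\<lambda>y. \<Sum>x\<in>A. f x y) has_sum (\<Sum>x\<in>A. s x)) B"
  using assms by (induction A) (auto intro!: has_sum_add has_sum_0)

text \<open>Cauchy's inequality on the circle of radius \<open>\<rho>\<close>, fed with the point
  evaluation bound on \<open>cball c \<rho>\<close>. Since \<open>C\<close> is uniform in
  \<open>f\<close> and \<open>k\<close>, the dependence on \<open>k\<close> is purely
  geometric.\<close>

lemma taylor_coeff_bound: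
  assumes "open D" "cball c \<rho> \<subseteq> D" "0 < \<rho>"
  obtains C where "0 \<le> C" "\<And>f k. f \<in> bergman_space D \<Longrightarrow>
     cmod ((deriv ^^ k) f c / fact k) \<le> C / \<rho> ^ k * sqrt (Re (bergman_inner D f f))"
proof -
  obtain C where C: "C \<ge> 0" "\<And>f z. f \<in> bergman_space D \<Longrightarrow> z \<in> cball c \<rho> \<Longrightarrow> cmod (f z) \<le> C * sqrt (Re (bergman_inner D f f))"
    using bergman_point_evaluation_bound[OF assms(1) compact_cball assms(2)] by metis
  have "cmod ((deriv ^^ k) f c / fact k) \<le> C / \<rho> ^ k * sqrt (Re (bergman_inner D f f))"
    if f: "f \<in> bergman_space D" for f k
  proof -
    have fh: "f holomorphic_on cball c \<rho>" using bergman_space_holomorphic[OF f] assms(2) holomorphic_on_subset by blast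
    have "norm ((deriv ^^ k) f c) \<le> fact k * (C * sqrt (Re (bergman_inner D f f))) / \<rho> ^ k"
    proof (rule Cauchy_inequality)
      show "f holomorphic_on ball c \<rho>" using fh ball_subset_cball holomorphic_on_subset by blast
      show "continuous_on (cball c \<rho>) f" using fh by (rule holomorphic_on_imp_continuous_on)
      show "norm (f x) \<le> C * sqrt (Re (bergman_inner D f f))" if "norm (c - x) = \<rho>" for x
        using that by (intro C(2)[OF f]) (simp add: dist_norm)
    qed (rule assms(3))
    then show ?thesis by (simp add: norm_divide field_simps)
  qed
  then show ?thesis using that C(1) by blast
qed

section \<open>The isotypic projection and its range\<close>

context ifs_symmetry begin

interpretation group G by (rule group_G)
interpretation B: carrier_hilbert fun_scale "bergman_space D" "bergman_inner D"
  by (rule carrier_hilbert_bergman_space[OF open_D])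

definition isotypic_coeff :: "('g \<Rightarrow> complex^'n^'n) \<Rightarrow> 'g \<Rightarrow> complex" where
  "isotypic_coeff \<rho> g = of_nat CARD('n) / of_nat (card (carrier G)) * cnj (character \<rho> g)"

lemma isotypic_proj_apply:
  "isotypic_proj S G act \<rho> f u = (\<Sum>g\<in>carrier G. isotypic_coeff \<rho> g * act_on_functions S G act g f u)"
  by (simp add: isotypic_proj_def isotypic_coeff_def sum_distrib_left mult.assoc)

lemma isotypic_proj_eq_sum:
  "isotypic_proj S G act \<rho> f = (\<Sum>g\<in>carrier G. fun_scale (isotypic_coeff \<rho> g) (act_on_functions S G act g f))"
  by (simp add: fun_eq_iff isotypic_proj_apply sum_fun_apply)

lemma isotypic_proj_bergman:
  "f \<in> bergman_space D \<Longrightarrow> isotypic_proj S G act \<rho> f \<in> bergman_space D"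
  unfolding isotypic_proj_eq_sum by (intro B.H_sum B.H_scale act_on_functions_bergman)

text \<open>Applying the projection twice convolves its coefficients over the group;
  \<open>character_convolution\<close> reproduces them up to a factor, which the normalization in
  \<open>isotypic_coeff\<close> cancels.\<close>

lemma isotypic_proj_idem:
  fixes \<rho> :: "'g \<Rightarrow> complex^'n^'n"
  assumes irr: "irreducible_unitary_rep G \<rho>"
  shows "isotypic_proj S G act \<rho> (isotypic_proj S G act \<rho> f) = isotypic_proj S G act \<rho> f"
proof
  fix u
  define F where "F k = act_on_functions S G act k f u" for k
  define \<kappa> :: complex where "\<kappa> = of_nat CARD('n) / of_nat (card (carrier G))"
  have act: "act_on_functions S G act g (isotypic_proj S G act \<rho> f) u = (\<Sum>h\<in>carrier G. isotypic_coeff \<rho> h * F (g \<otimes> h))"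
    if g: "g \<in> carrier G" for g
  proof -
    have "act_on_functions S G act g (isotypic_proj S G act \<rho> f) u
        = (\<Sum>h\<in>carrier G. isotypic_coeff \<rho> h * act_on_functions S G act g (act_on_functions S G act h f) u)"
      by (simp add: act_on_functions_def[of _ _ _ g] isotypic_proj_apply)
    then show ?thesis using g by (simp add: act_on_functions_mult F_def)
  qed
  have re: "(\<Sum>h\<in>carrier G. isotypic_coeff \<rho> h * F (g \<otimes> h)) = (\<Sum>k\<in>carrier G. isotypic_coeff \<rho> (inv g \<otimes> k) * F k)"
    if g: "g \<in> carrier G" for g
    by (rule sum.reindex_bij_witness[where j = "\<lambda>h. g \<otimes> h" and i = "\<lambda>k. inv g \<otimes> k"])
       (use g in \<open>auto simp: m_assoc[symmetric]\<close>)
  have conv: "(\<Sum>g\<in>carrier G. isotypic_coeff \<rho> g * isotypic_coeff \<rho> (inv g \<otimes> k)) = isotypic_coeff \<rho> k"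
    if k: "k \<in> carrier G" for k
  proof -
    have "(\<Sum>g\<in>carrier G. isotypic_coeff \<rho> g * isotypic_coeff \<rho> (inv g \<otimes> k))
      = \<kappa>\<^sup>2 * cnj (\<Sum>g\<in>carrier G. character \<rho> g * character \<rho> (inv g \<otimes> k))"
      by (simp add: isotypic_coeff_def \<kappa>_def sum_distrib_left power2_eq_square mult_ac)
    also have "\<dots> = \<kappa>\<^sup>2 * cnj (of_nat (card (carrier G)) / of_nat CARD('n) * character \<rho> k)"
      by (subst character_convolution[OF group_G finite_G irr k]) (rule refl)
    also have "\<dots> = isotypic_coeff \<rho> k"
      using finite_G one_closed by (auto simp: isotypic_coeff_def \<kappa>_def power2_eq_square)
    finally show ?thesis .
  qed
  have "isotypic_proj S G act \<rho> (isotypic_proj S G act \<rho> f) u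
    = (\<Sum>g\<in>carrier G. \<Sum>k\<in>carrier G. isotypic_coeff \<rho> g * (isotypic_coeff \<rho> (inv g \<otimes> k) * F k))"
    by (simp add: isotypic_proj_apply[of _ "isotypic_proj S G act \<rho> f"] act re sum_distrib_left)
  also have "\<dots> = (\<Sum>k\<in>carrier G. (\<Sum>g\<in>carrier G. isotypic_coeff \<rho> g * isotypic_coeff \<rho> (inv g \<otimes> k)) * F k)"
    by (subst sum.swap) (simp add: sum_distrib_right mult.assoc)
  also have "\<dots> = isotypic_proj S G act \<rho> f u"
    by (simp add: conv isotypic_proj_apply F_def)
  finally show "isotypic_proj S G act \<rho> (isotypic_proj S G act \<rho> f) u = isotypic_proj S G act \<rho> f u" .
qed

text \<open>By idempotence the range is the fixed space, so membership becomes an equation that can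
  be checked pointwise.\<close>

lemma isotypic_space_iff:
  assumes "irreducible_unitary_rep G \<rho>"
  shows "f \<in> isotypic_space S G act \<rho> \<longleftrightarrow> f \<in> bergman_space D \<and> isotypic_proj S G act \<rho> f = f"
  unfolding isotypic_space_def using isotypic_proj_idem[OF assms] isotypic_proj_bergman by (metis imageE imageI)

lemma isotypic_proj_lincomb:
  "isotypic_proj S G act \<rho> (\<lambda>u. a * f u + b * h u) u = a * isotypic_proj S G act \<rho> f u + b * isotypic_proj S G act \<rho> h u"
proof -
  have "act_on_functions S G act g (\<lambda>u. a * f u + b * h u) u
    = a * act_on_functions S G act g f u + b * act_on_functions S G act g h u" for g
    by (simp add: act_on_functions_def)
  then show ?thesis
    by (simp add: isotypic_proj_apply sum.distrib sum_distrib_left algebra_simps)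
qed

text \<open>The fixed point equation at \<open>u\<close> involves only finitely many values of
  \<open>f\<close>, so it survives pointwise limits.\<close>

lemma carrier_hilbert_isotypic:
  assumes irr: "irreducible_unitary_rep G \<rho>"
  shows "carrier_hilbert fun_scale (isotypic_space S G act \<rho>) (bergman_inner D)"
proof (rule carrier_hilbert_bergman[OF open_D])
  show "isotypic_space S G act \<rho> \<subseteq> bergman_space D" using isotypic_space_iff[OF irr] by blast
  show "(\<lambda>_. 0) \<in> isotypic_space S G act \<rho>"
    unfolding isotypic_space_iff[OF irr] using zero_bergman by (simp add: fun_eq_iff isotypic_proj_apply act_on_functions_def)
  show "(\<lambda>u. a * f u + b * h u) \<in> isotypic_space S G act \<rho>"
    if "f \<in> isotypic_space S G act \<rho>" "h \<in> isotypic_space S G act \<rho>" for f h a b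
    using that unfolding isotypic_space_iff[OF irr]
    by (auto simp: fun_eq_iff isotypic_proj_lincomb intro!: bergman_space_lincomb open_D)
  fix X f assume X: "\<And>n::nat. X n \<in> isotypic_space S G act \<rho>" and f: "f \<in> bergman_space D"
    and lim: "\<And>u. (\<lambda>n. X n u) \<longlonglongrightarrow> f u"
  have "isotypic_proj S G act \<rho> f u = f u" for u
  proof (rule LIMSEQ_unique)
    show "(\<lambda>n. isotypic_proj S G act \<rho> (X n) u) \<longlonglongrightarrow> isotypic_proj S G act \<rho> f u"
      unfolding isotypic_proj_apply act_on_functions_def by (cases "u \<in> D") (auto intro!: tendsto_intros lim)
    show "(\<lambda>n. isotypic_proj S G act \<rho> (X n) u) \<longlonglongrightarrow> f u"
      using X lim[of u] by (simp add: isotypic_space_iff[OF irr])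
  qed
  then show "f \<in> isotypic_space S G act \<rho>" unfolding isotypic_space_iff[OF irr] using f by blast
qed

lemma transfer_op_isotypic:
  assumes irr: "irreducible_unitary_rep G \<rho>"
    and V: "V holomorphic_on ifs_image S" "\<And>z. z \<in> ifs_image S \<Longrightarrow> cmod (V z) \<le> M" "invariant_potential S G act V"
    and f: "f \<in> isotypic_space S G act \<rho>"
  shows "transfer_op S V f \<in> isotypic_space S G act \<rho>"
  using f transfer_op_bergman[OF V(1,2)] transfer_op_isotypic_proj[OF V(3), of \<rho> f]
  unfolding isotypic_space_iff[OF irr] by simp

text \<open>\<open>reduced_transfer_op\<close> is \<open>undefined\<close> off the isotypic space,
  so the iterates agree only because each of them stays in that space; the induction carries both
  facts.\<close>

lemma reduced_transfer_op_pow: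
  assumes irr: "irreducible_unitary_rep G \<rho>"
    and V: "V holomorphic_on ifs_image S" "\<And>z. z \<in> ifs_image S \<Longrightarrow> cmod (V z) \<le> M" "invariant_potential S G act V"
    and f: "f \<in> isotypic_space S G act \<rho>"
  shows "(reduced_transfer_op S G act \<rho> V ^^ n) f = (transfer_op S V ^^ n) f \<and> (transfer_op S V ^^ n) f \<in> isotypic_space S G act \<rho>"
proof (induction n)
  case (Suc n)
  then show ?case using transfer_op_isotypic[OF irr V] by (simp add: reduced_transfer_op_def)
qed (use f in simp)

end

section \<open>The trace formula\<close>

context ifs_symmetry begin

interpretation group G by (rule group_G)
interpretation B: carrier_hilbert fun_scale "bergman_space D" "bergman_inner D"
  by (rule carrier_hilbert_bergman_space[OF open_D])

definition word_fun :: "(complex \<Rightarrow> complex) \<Rightarrow> nat list \<Rightarrow> nat \<Rightarrow> complex \<Rightarrow> complex" where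
  "word_fun V w k u = (if u \<in> disk S (w ! 0) then word_weight S V w u * (word_map S w u - cen (last w)) ^ k else 0)"

definition taylor :: "nat list \<Rightarrow> nat \<Rightarrow> (complex \<Rightarrow> complex) \<Rightarrow> complex" where
  "taylor w k f = (deriv ^^ k) f (cen (last w)) / fact k"

lemma words_last: "w \<in> words S n \<Longrightarrow> last w = w ! n"
  using words_length[of w n] last_conv_nth[of w] by force

lemma cen_in_disk: "i \<in> N \<Longrightarrow> cen i \<in> disk S i"
  using disk_eq rad_pos by simp

lemma word_fun_bound:
  assumes V: "\<And>z. z \<in> ifs_image S \<Longrightarrow> cmod (V z) \<le> M" and w: "w \<in> words S n"
    and r: "\<And>u. u \<in> disk S (w ! 0) \<Longrightarrow> dist (cen (w ! n)) (word_map S w u) \<le> r" "0 \<le> r"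
  shows "cmod (word_fun V w k u) \<le> (max M 1) ^ n * r ^ k"
proof (cases "u \<in> disk S (w ! 0)")
  case True
  have "cmod (word_map S w u - cen (last w)) \<le> r"
    using r(1)[OF True] by (simp add: words_last[OF w] dist_norm norm_minus_commute)
  then show ?thesis using True word_weight_bound[OF V w True]
    by (auto simp: word_fun_def norm_mult norm_power intro!: mult_mono power_mono)
qed (use r in \<open>simp add: word_fun_def\<close>)

lemma word_fun_holomorphic:
  assumes V: "V holomorphic_on ifs_image S" and w: "w \<in> words S n"
  shows "word_fun V w k holomorphic_on D"
proof -
  have w0: "w ! 0 \<in> N" using words_N[OF w] by simp
  have "word_fun V w k holomorphic_on disk S i" if i: "i \<in> N" for i
  proof (cases "i = w ! 0")
    case True
    have "(\<lambda>u. word_weight S V w u * (word_map S w u - cen (last w)) ^ k) holomorphic_on disk S i"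
      using word_weight_holomorphic[OF V w] word_map_holomorphic[OF w] True by (auto intro!: holomorphic_intros)
    then show ?thesis by (rule holomorphic_transform) (simp add: word_fun_def True)
  next
    case False
    have "(\<lambda>_. 0) holomorphic_on disk S i" by simp
    then show ?thesis
      by (rule holomorphic_transform) (use disk_disjoint[OF i w0] False in \<open>auto simp: word_fun_def\<close>)
  qed
  then show ?thesis unfolding ifs_domain_def using open_disk by (intro holomorphic_on_UN_open) auto
qed

lemma word_fun_bergman:
  assumes V: "V holomorphic_on ifs_image S" "\<And>z. z \<in> ifs_image S \<Longrightarrow> cmod (V z) \<le> M"
    and w: "w \<in> words S n" "n \<ge> 1"
  shows "word_fun V w k \<in> bergman_space D"
proof -
  obtain r where r: "0 < r" "\<And>u. u \<in> disk S (w ! 0) \<Longrightarrow> dist (cen (w ! n)) (word_map S w u) \<le> r"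
    using word_map_contained[OF w] by metis
  have "word_fun V w k u = 0" if "u \<notin> D" for u
    using that words_N[OF w(1), of 0] D_disk by (auto simp: word_fun_def)
  then show ?thesis
    using word_fun_bound[OF V(2) w(1) r(2)] r(1)
    by (intro bounded_holomorphic_in_bergman_space(1)[OF open_D bounded_D word_fun_holomorphic[OF V(1) w(1)]]) auto
qed

lemma taylor_functional: 
  assumes "w \<in> words S n"
  shows "B.functional (taylor w k)"
proof -
  have c: "cen (last w) \<in> D"
    using cen_in_disk[of "w ! n"] disk_subset_D[of "w ! n"] words_N[OF assms, of n] unfolding words_last[OF assms] by blast
  show ?thesis unfolding B.functional_def
  proof (intro conjI ballI allI)
    fix f h assume "f \<in> bergman_space D" "h \<in> bergman_space D"
    then have "(deriv ^^ k) (\<lambda>u. f u + h u) (cen (last w)) = (deriv ^^ k) f (cen (last w)) + (deriv ^^ k) h (cen (last w))"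
      by (intro higher_deriv_add[OF _ _ open_D c] bergman_space_holomorphic)
    then show "taylor w k (f + h) = taylor w k f + taylor w k h"
      by (simp add: taylor_def plus_fun_def add_divide_distrib)
  next
    fix a f assume "f \<in> bergman_space D"
    then have "(deriv ^^ k) (\<lambda>u. a * f u) (cen (last w)) = a * (deriv ^^ k) f (cen (last w))"
      by (intro higher_deriv_cmult[OF _ c open_D] bergman_space_holomorphic)
    then show "taylor w k (fun_scale a f) = a * taylor w k f" by (simp add: taylor_def)
  qed
qed

text \<open>The Taylor series of \<open>f\<close> about the centre of the last disk, evaluated at
  \<open>word_map S w u\<close>, which lies in that disk.\<close>

lemma taylor_word_fun_sums:
  assumes w: "w \<in> words S n" and f: "f \<in> bergman_space D" and u: "u \<in> disk S (w ! 0)"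
  shows "(\<lambda>k. taylor w k f * word_fun V w k u) sums (word_weight S V w u * f (word_map S w u))"
proof -
  have nN: "w ! n \<in> N" using words_N[OF w] by simp
  have "f holomorphic_on ball (cen (w ! n)) (rad (w ! n))"
    using bergman_space_holomorphic[OF f] disk_subset_D[OF nN] disk_eq[OF nN] holomorphic_on_subset by metis
  moreover have "word_map S w u \<in> ball (cen (w ! n)) (rad (w ! n))" using word_map_in[OF w u] disk_eq[OF nN] by simp
  ultimately have "(\<lambda>k. (deriv ^^ k) f (cen (w ! n)) / fact k * (word_map S w u - cen (w ! n)) ^ k) sums f (word_map S w u)"
    by (rule holomorphic_power_series)
  from sums_mult[OF this, of "word_weight S V w u"] show ?thesis
    using u by (simp add: taylor_def word_fun_def words_last[OF w] mult_ac)
qed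

text \<open>Collects what the results on strict self-maps of a disk require of
  \<open>word_map S w \<circ> act g\<close>: \<open>act g\<close> carries the last disk onto the
  first one, and the word leads back into a smaller concentric disk.\<close>

lemma twisted_self_map:
  assumes w: "w \<in> words S n" "n \<ge> 1" and g: "g \<in> carrier G" and tw: "symbol_act S act g (w ! n) = w ! 0"
  obtains r where "0 < r" "r < rad (w ! n)" "(word_map S w \<circ> act g) holomorphic_on ball (cen (w ! n)) (rad (w ! n))"
    "\<forall>z\<in>ball (cen (w ! n)) (rad (w ! n)). dist (cen (w ! n)) ((word_map S w \<circ> act g) z) \<le> r"
    "act g ` ball (cen (w ! n)) (rad (w ! n)) = disk S (w ! 0)"
    "act g holomorphic_on ball (cen (w ! n)) (rad (w ! n))"
proof -
  have nN: "w ! n \<in> N" using words_N[OF w(1)] by simp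
  have im: "act g ` ball (cen (w ! n)) (rad (w ! n)) = disk S (w ! 0)"
    using symbol_act(2)[OF g nN] tw disk_eq[OF nN] by simp
  have ah: "act g holomorphic_on ball (cen (w ! n)) (rad (w ! n))"
    using act_holomorphic[OF g] disk_subset_D[OF nN] disk_eq[OF nN] holomorphic_on_subset by metis
  have h: "(word_map S w \<circ> act g) holomorphic_on ball (cen (w ! n)) (rad (w ! n))"
    by (rule holomorphic_on_compose_gen[OF ah word_map_holomorphic[OF w(1)]]) (simp add: im)
  obtain r where r: "0 < r" "r < rad (w ! n)" "\<And>u. u \<in> disk S (w ! 0) \<Longrightarrow> dist (cen (w ! n)) (word_map S w u) \<le> r"
    using word_map_contained[OF w] by metis
  have "dist (cen (w ! n)) ((word_map S w \<circ> act g) z) \<le> r" if "z \<in> ball (cen (w ! n)) (rad (w ! n))" for z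
  proof -
    have "act g z \<in> disk S (w ! 0)" using im that by blast
    from r(3)[OF this] show ?thesis by simp
  qed
  then show ?thesis using that[OF r(1,2) h _ im ah] by blast
qed

lemma twisted_fixpoint_unique:
  assumes w: "w \<in> words S n" "n \<ge> 1" and g: "g \<in> carrier G" and tw: "symbol_act S act g (w ! n) = w ! 0"
  shows "\<exists>!u. is_twisted_fixpoint S act w g u"
proof -
  obtain r where r: "0 < r" "r < rad (w ! n)" "(word_map S w \<circ> act g) holomorphic_on ball (cen (w ! n)) (rad (w ! n))"
    "\<forall>z\<in>ball (cen (w ! n)) (rad (w ! n)). dist (cen (w ! n)) ((word_map S w \<circ> act g) z) \<le> r"
    "act g ` ball (cen (w ! n)) (rad (w ! n)) = disk S (w ! 0)"
    "act g holomorphic_on ball (cen (w ! n)) (rad (w ! n))"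
    by (rule twisted_self_map[OF assms]) (rule that)
  obtain p where p: "p \<in> cball (cen (w ! n)) r" "(word_map S w \<circ> act g) p = p"
    "\<And>q. q \<in> ball (cen (w ! n)) (rad (w ! n)) \<Longrightarrow> (word_map S w \<circ> act g) q = q \<Longrightarrow> q = p"
    using strict_self_map_fixpoint[OF r(1-3) r(4)[rule_format]] by metis
  have iff: "is_twisted_fixpoint S act w g u \<longleftrightarrow> u \<in> ball (cen (w ! n)) (rad (w ! n)) \<and> (word_map S w \<circ> act g) u = u" for u
    using disk_eq[of "w ! n"] words_N[OF w(1), of n] by (auto simp: is_twisted_fixpoint_def words_last[OF w(1)])
  show ?thesis unfolding iff
  proof (rule ex1I[of _ p])
    show "p \<in> ball (cen (w ! n)) (rad (w ! n)) \<and> (word_map S w \<circ> act g) p = p" using p(1,2) r by auto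
  qed (use p(3) in blast)
qed

definition twisted_term :: "(complex \<Rightarrow> complex) \<Rightarrow> nat list \<Rightarrow> 'g \<Rightarrow> complex" where
  "twisted_term V w g = (let u = twisted_fixpoint S act w g
                 in word_weight S V w (act g u) / (1 - deriv (word_map S w \<circ> act g) u))"

text \<open>\<open>act_on_functions\<close> composes with the inverse, so \<open>inv g\<close>
  produces composition with \<open>act g\<close>. If \<open>act g\<close> carries the last disk
  elsewhere, the composed functions vanish identically on it; otherwise their diagonal Taylor
  coefficients are those of \<open>sum_taylor_coeffs_self_map\<close>.\<close>

lemma twisted_trace:
  assumes V: "V holomorphic_on ifs_image S" "\<And>z. z \<in> ifs_image S \<Longrightarrow> cmod (V z) \<le> M"
    and w: "w \<in> words S n" "n \<ge> 1" and g: "g \<in> carrier G"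
  shows "((\<lambda>k. taylor w k (act_on_functions S G act (inv g) (word_fun V w k))) has_sum
    (if symbol_act S act g (w ! n) = w ! 0 then twisted_term V w g else 0)) UNIV"
proof -
  define c where "c = cen (w ! n)"
  define X where "X = ball c (rad (w ! n))"
  have nN: "w ! n \<in> N" and w0: "w ! 0 \<in> N" using words_N[OF w(1)] by auto
  have X: "X = disk S (w ! n)" "X \<subseteq> D" "open X" "c \<in> X"
    using disk_eq[OF nN] disk_subset_D[OF nN] rad_pos[OF nN] by (auto simp: X_def c_def)
  define F where "F k = act_on_functions S G act (inv g) (word_fun V w k)" for k
  have Fh: "F k holomorphic_on X" for k
    unfolding F_def
    by (rule holomorphic_on_subset[OF bergman_space_holomorphic[OF act_on_functions_bergman[OF inv_closed[OF g] word_fun_bergman[OF V w]]] X(2)])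
  have Fu: "F k u = word_fun V w k (act g u)" if "u \<in> X" for k u
    using that X g by (auto simp: F_def act_on_functions_def)
  show ?thesis
  proof (cases "symbol_act S act g (w ! n) = w ! 0")
    case False
    have "F k u = 0" if "u \<in> X" for k u
      using act_in_disk_iff[OF g nN w0, of u] that X(1) False by (simp add: Fu[OF that] word_fun_def)
    then have "(deriv ^^ k) (F k) c = (deriv ^^ k) (\<lambda>_. 0) c" for k
      by (intro higher_deriv_transform_within_open[OF Fh _ X(3,4)]) auto
    then have "taylor w k (F k) = 0" for k by (simp add: taylor_def words_last[OF w(1)] c_def)
    then show ?thesis using False by (simp add: F_def)
  next
    case True
    obtain r where r: "0 < r" "r < rad (w ! n)" "(word_map S w \<circ> act g) holomorphic_on ball (cen (w ! n)) (rad (w ! n))"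
      "\<forall>z\<in>ball (cen (w ! n)) (rad (w ! n)). dist (cen (w ! n)) ((word_map S w \<circ> act g) z) \<le> r"
      and im: "act g ` ball (cen (w ! n)) (rad (w ! n)) = disk S (w ! 0)"
      and ah: "act g holomorphic_on ball (cen (w ! n)) (rad (w ! n))"
      by (rule twisted_self_map[OF w g True]) (rule that)
    note r = r[folded c_def, folded X_def] and im = im[folded c_def, folded X_def] and ah = ah[folded c_def, folded X_def]
    define \<Phi> where "\<Phi> = word_map S w \<circ> act g"
    define \<psi> where "\<psi> = word_weight S V w \<circ> act g"
    have \<psi>: "\<psi> holomorphic_on X" unfolding \<psi>_def
      by (rule holomorphic_on_compose_gen[OF ah word_weight_holomorphic[OF V(1) w(1)]]) (simp add: im)
    have actX: "act g u \<in> disk S (w ! 0)" if "u \<in> X" for u using im that by blast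
    have \<psi>b: "cmod (\<psi> z) \<le> (max M 1) ^ n" if "z \<in> X" for z
      using word_weight_bound[OF V(2) w(1) actX[OF that]] by (simp add: \<psi>_def)
    define p where "p = twisted_fixpoint S act w g"
    have "is_twisted_fixpoint S act w g p"
      unfolding p_def twisted_fixpoint_def by (rule theI'[OF twisted_fixpoint_unique[OF w g True]])
    then have p: "p \<in> X" "\<Phi> p = p"
      using X(1) by (auto simp: is_twisted_fixpoint_def words_last[OF w(1)] \<Phi>_def)
    have "((\<lambda>k. (deriv ^^ k) (\<lambda>z. \<psi> z * (\<Phi> z - c) ^ k) c / fact k) has_sum \<psi> p / (1 - deriv \<Phi> p)) UNIV"
    proof (rule sum_taylor_coeffs_self_map[OF r(1,2)])
      show "\<Phi> holomorphic_on ball c (rad (w ! n))" using r(3) by (simp only: \<Phi>_def X_def)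
      show "dist c (\<Phi> z) \<le> r" if "z \<in> ball c (rad (w ! n))" for z using r(4) that by (simp add: \<Phi>_def X_def)
    qed (use \<psi> \<psi>b p in \<open>auto simp: X_def\<close>)
    moreover have "(deriv ^^ k) (\<lambda>z. \<psi> z * (\<Phi> z - c) ^ k) c / fact k = taylor w k (F k)" for k
    proof -
      have "(deriv ^^ k) (F k) c = (deriv ^^ k) (\<lambda>z. \<psi> z * (\<Phi> z - c) ^ k) c"
      proof (rule higher_deriv_transform_within_open[OF Fh _ X(3,4)])
        show "(\<lambda>z. \<psi> z * (\<Phi> z - c) ^ k) holomorphic_on X"
          using \<psi> r(3) unfolding \<Phi>_def by (intro holomorphic_intros)
        show "F k z = \<psi> z * (\<Phi> z - c) ^ k" if "z \<in> X" for z
          using actX[OF that] by (simp add: Fu[OF that] word_fun_def \<psi>_def \<Phi>_def words_last[OF w(1)] c_def)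
      qed
      then show ?thesis by (simp add: taylor_def words_last[OF w(1)] c_def)
    qed
    moreover have "\<psi> p / (1 - deriv \<Phi> p) = twisted_term V w g"
      by (simp add: twisted_term_def Let_def p_def \<psi>_def \<Phi>_def)
    ultimately show ?thesis using True by (simp add: F_def)
  qed
qed

lemma isotypic_proj_bound:
  assumes "\<And>u. cmod (f u) \<le> K"
  shows "cmod (isotypic_proj S G act \<rho> f u) \<le> (\<Sum>g\<in>carrier G. cmod (isotypic_coeff \<rho> g)) * K"
proof -
  have "cmod (isotypic_proj S G act \<rho> f u) \<le> (\<Sum>g\<in>carrier G. cmod (isotypic_coeff \<rho> g) * K)"
    unfolding isotypic_proj_apply
  proof (rule sum_norm_le)
    fix g
    have "cmod (act_on_functions S G act g f u) \<le> K"
      using assms norm_ge_zero order_trans by (auto simp: act_on_functions_def intro: order_trans[OF norm_ge_zero])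
    then show "cmod (isotypic_coeff \<rho> g * act_on_functions S G act g f u) \<le> cmod (isotypic_coeff \<rho> g) * K"
      unfolding norm_mult by (rule mult_left_mono) simp
  qed
  then show ?thesis by (simp add: sum_distrib_right)
qed

text \<open>All majorants are geometric with ratio \<open>r w / q w\<close>: the Taylor functionals
  are estimated on the circle of radius \<open>q w\<close>, the word functions by powers of the
  smaller \<open>r w\<close>. The bounds \<open>c\<close> are existentially quantified because they
  depend on the radii chosen.\<close>

lemma reduced_transfer_op_nuclear:
  fixes \<rho> :: "'g \<Rightarrow> complex^'n^'n"
  assumes irr: "irreducible_unitary_rep G \<rho>"
    and V: "V holomorphic_on ifs_image S" "\<And>z. z \<in> ifs_image S \<Longrightarrow> cmod (V z) \<le> M" "invariant_potential S G act V"
    and n: "n \<ge> 1"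
  shows "\<exists>c. nuclear_op fun_scale (isotypic_space S G act \<rho>) (bergman_inner D) (reduced_transfer_op S G act \<rho> V ^^ n)
    (words S n \<times> UNIV) (\<lambda>(w, k). taylor w k) (\<lambda>(w, k). isotypic_proj S G act \<rho> (word_fun V w k)) c"
proof -
  define H where "H = isotypic_space S G act \<rho>"
  define I where "I = words S n \<times> (UNIV :: nat set)"
  define A where "A = (\<Sum>g\<in>carrier G. cmod (isotypic_coeff \<rho> g)) * (max M 1) ^ n"
  have A0: "0 \<le> A" unfolding A_def by (intro mult_nonneg_nonneg sum_nonneg) auto
  have HB: "f \<in> bergman_space D" if "f \<in> H" for f using that isotypic_space_iff[OF irr] by (simp add: H_def)
  have "\<exists>r \<rho>' C. 0 < r \<and> r < \<rho>' \<and> 0 \<le> C \<and>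
      (\<forall>u\<in>disk S (w ! 0). dist (cen (w ! n)) (word_map S w u) \<le> r) \<and>
      (\<forall>f\<in>bergman_space D. \<forall>k. cmod (taylor w k f) \<le> C / \<rho>' ^ k * sqrt (Re (bergman_inner D f f)))"
    if w: "w \<in> words S n" for w
  proof -
    have nN: "w ! n \<in> N" using words_N[OF w] by simp
    obtain r where r: "0 < r" "r < rad (w ! n)" "\<And>u. u \<in> disk S (w ! 0) \<Longrightarrow> dist (cen (w ! n)) (word_map S w u) \<le> r"
      using word_map_contained[OF w n] by metis
    \<comment> \<open>Any radius strictly between the one confining the word map and that of the
      disk would do; Cauchy's estimate there beats the powers of \<open>r\<close>.\<close>
    define \<rho>' where "\<rho>' = (r + rad (w ! n)) / 2"
    have \<rho>': "r < \<rho>'" "\<rho>' < rad (w ! n)" using r by (auto simp: \<rho>'_def)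
    have sub: "cball (cen (w ! n)) \<rho>' \<subseteq> D"
      using \<rho>' disk_subset_D[OF nN] disk_eq[OF nN] by auto
    have pos: "0 < \<rho>'" using \<rho>' r by linarith
    obtain C where C: "0 \<le> C" "\<And>f k. f \<in> bergman_space D \<Longrightarrow>
        cmod ((deriv ^^ k) f (cen (w ! n)) / fact k) \<le> C / \<rho>' ^ k * sqrt (Re (bergman_inner D f f))"
      using taylor_coeff_bound[OF open_D sub pos] by metis
    show ?thesis
      using r \<rho>' C unfolding taylor_def words_last[OF w]
      by (intro exI[of _ r] exI[of _ \<rho>'] exI[of _ C]) simp
  qed
  \<comment> \<open>The two radii and the constant are chosen together, as one triple per
    word.\<close>
  then have "\<exists>R. \<forall>w\<in>words S n. case R w of (r, \<rho>', C) \<Rightarrow> 0 < r \<and> r < \<rho>' \<and> 0 \<le> C \<and>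
      (\<forall>u\<in>disk S (w ! 0). dist (cen (w ! n)) (word_map S w u) \<le> r) \<and>
      (\<forall>f\<in>bergman_space D. \<forall>k. cmod (taylor w k f) \<le> C / \<rho>' ^ k * sqrt (Re (bergman_inner D f f)))"
    by (intro bchoice ballI) fastforce
  then obtain R where R: "\<forall>w\<in>words S n. case R w of (r, \<rho>', C) \<Rightarrow> 0 < r \<and> r < \<rho>' \<and> 0 \<le> C \<and>
      (\<forall>u\<in>disk S (w ! 0). dist (cen (w ! n)) (word_map S w u) \<le> r) \<and>
      (\<forall>f\<in>bergman_space D. \<forall>k. cmod (taylor w k f) \<le> C / \<rho>' ^ k * sqrt (Re (bergman_inner D f f)))" by blast
  define r where "r w = fst (R w)" for w
  define q where "q w = fst (snd (R w))" for w
  define C where "C w = snd (snd (R w))" for w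
  have rq: "0 < r w" "r w < q w" "0 \<le> C w"
    "\<And>u. u \<in> disk S (w ! 0) \<Longrightarrow> dist (cen (w ! n)) (word_map S w u) \<le> r w"
    "\<And>f k. f \<in> bergman_space D \<Longrightarrow> cmod (taylor w k f) \<le> C w / q w ^ k * sqrt (Re (bergman_inner D f f))"
    if "w \<in> words S n" for w
    using R[rule_format, OF that] by (auto simp: r_def q_def C_def split: prod.splits)
  define c where "c = (\<lambda>(w, k). C w / q w ^ k)"
  define la where "la = (\<lambda>(w, k). taylor w k)"
  define a where "a = (\<lambda>(w, k). isotypic_proj S G act \<rho> (word_fun V w k))"
  have c0: "0 \<le> c i" if i: "i \<in> I" for i
  proof -
    obtain w k where wk: "i = (w, k)" "w \<in> words S n" using i by (auto simp: I_def)
    show ?thesis using rq(1,2,3)[OF wk(2)] by (simp add: wk(1) c_def)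
  qed
  have aH: "a i \<in> H" if "i \<in> I" for i
    using that word_fun_bergman[OF V(1,2) _ n] by (auto simp: a_def I_def H_def isotypic_space_def)
  have ab: "cmod (a (w, k) u) \<le> A * r w ^ k" if w: "w \<in> words S n" for w k u
  proof -
    have "cmod (word_fun V w k u) \<le> (max M 1) ^ n * r w ^ k" for u
      using word_fun_bound[OF V(2) w rq(4)[OF w]] rq(1)[OF w] by simp
    from isotypic_proj_bound[OF this] show ?thesis by (simp add: a_def A_def mult.assoc)
  qed
  \<comment> \<open>One majorant serves three times, with different \<open>K\<close>: for the
    pointwise expansion, for the summability of \<open>c i * nrm (a i)\<close> and for the inner
    products.\<close>
  have geo: "(\<lambda>i. case i of (w, k) \<Rightarrow> C w / q w ^ k * (K * r w ^ k)) summable_on I" if K: "0 \<le> K" for K :: real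
  proof -
    have hs: "((\<lambda>k. C w / q w ^ k * (K * r w ^ k)) has_sum (C w * K * (1 / (1 - r w / q w)))) UNIV" if w: "w \<in> words S n" for w
    proof -
      have x: "0 \<le> r w / q w" "r w / q w < 1" using rq(1,2)[OF w] by auto
      then have "(\<lambda>k. C w * K * (r w / q w) ^ k) sums (C w * K * (1 / (1 - r w / q w)))"
        by (intro sums_mult geometric_sums) simp
      then have "((\<lambda>k. C w * K * (r w / q w) ^ k) has_sum (C w * K * (1 / (1 - r w / q w)))) UNIV"
        using rq(3)[OF w] K x by (intro norm_summable_imp_has_sum) (auto simp: sums_iff norm_mult norm_power)
      then show ?thesis by (simp add: power_divide mult_ac)
    qed
    show ?thesis unfolding I_def
    proof (rule summable_on_SigmaI)
      show "((\<lambda>k. case (w, k) of (w, k) \<Rightarrow> C w / q w ^ k * (K * r w ^ k)) has_sum (C w * K * (1 / (1 - r w / q w)))) UNIV"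
        if "w \<in> words S n" for w using hs[OF that] by simp
      show "(\<lambda>w. C w * K * (1 / (1 - r w / q w))) summable_on words S n" using finite_words by simp
      show "0 \<le> (case (w, k) of (w, k) \<Rightarrow> C w / q w ^ k * (K * r w ^ k))" if "w \<in> words S n" for w k
        using rq(1,2,3)[OF that] K by simp
    qed
  qed
  interpret H: carrier_hilbert fun_scale H "bergman_inner D"
    unfolding H_def by (rule carrier_hilbert_isotypic[OF irr])
  have nrm: "H.nrm f = sqrt (Re (bergman_inner D f f))" for f by (simp add: H.nrm_def)
  have point: "((\<lambda>i. la i f * a i u) has_sum (transfer_op S V ^^ n) f u) I" if f: "f \<in> H" for f u
  proof -
    \<comment> \<open>The expansion before projecting; its factors \<open>word_fun V w k\<close> lie
      in the Bergman space but in general not in \<open>H\<close>.\<close>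
    have raw: "((\<lambda>(w, k). taylor w k f * word_fun V w k u) has_sum (transfer_op S V ^^ n) f u) I" for u
    proof -
      have abs: "cmod (case i of (w, k) \<Rightarrow> taylor w k f * word_fun V w k u)
          \<le> (case i of (w, k) \<Rightarrow> C w / q w ^ k * ((H.nrm f * (max M 1) ^ n) * r w ^ k))" if i: "i \<in> I" for i
      proof -
        obtain w k where wk: "i = (w, k)" "w \<in> words S n" using i by (auto simp: I_def)
        have "cmod (taylor w k f) * cmod (word_fun V w k u) \<le> (C w / q w ^ k * H.nrm f) * ((max M 1) ^ n * r w ^ k)"
          using rq(5)[OF wk(2) HB[OF f], of k] word_fun_bound[OF V(2) wk(2) rq(4)[OF wk(2)]] rq(1,2,3)[OF wk(2)] f
          by (intro mult_mono) (auto simp: nrm[symmetric])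
        then show ?thesis by (simp add: wk(1) norm_mult mult_ac)
      qed
      have su: "(\<lambda>(w, k). taylor w k f * word_fun V w k u) summable_on I"
        by (rule abs_summable_summable, rule summable_on_comparison_test[OF geo[of "H.nrm f * (max M 1) ^ n"] abs])
           (use f in auto)
      define s where "s w = (if u \<in> disk S (w ! 0) then word_weight S V w u * f (word_map S w u) else 0)" for w
      have inner: "((\<lambda>k. taylor w k f * word_fun V w k u) has_sum s w) UNIV" if w: "w \<in> words S n" for w
      proof (cases "u \<in> disk S (w ! 0)")
        case True
        have "(\<lambda>k. taylor w k f * word_fun V w k u) summable_on UNIV"
          using summable_on_SigmaD1[of "\<lambda>w k. taylor w k f * word_fun V w k u" "words S n" "\<lambda>_. UNIV" w] su w
          by (simp add: I_def)
        then have "((\<lambda>k. taylor w k f * word_fun V w k u) has_sum (\<Sum>\<^sub>\<infinity>k. taylor w k f * word_fun V w k u)) UNIV"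
          by (rule has_sum_infsum)
        moreover from has_sum_imp_sums[OF this] taylor_word_fun_sums[OF w HB[OF f] True, of V]
        have "(\<Sum>\<^sub>\<infinity>k. taylor w k f * word_fun V w k u) = s w" using True by (simp add: s_def sums_unique2)
        ultimately show ?thesis by simp
      qed (simp add: word_fun_def s_def)
      have "((\<lambda>(w, k). taylor w k f * word_fun V w k u) has_sum infsum (\<lambda>(w, k). taylor w k f * word_fun V w k u) I) I"
        using su by (rule has_sum_infsum)
      moreover from has_sum_SigmaD[OF this[unfolded I_def], of s] inner
      have "(s has_sum infsum (\<lambda>(w, k). taylor w k f * word_fun V w k u) I) (words S n)" by (simp add: I_def)
      then have "infsum (\<lambda>(w, k). taylor w k f * word_fun V w k u) I = (\<Sum>w\<in>words S n. s w)"
        using has_sum_finite_iff[OF finite_words] by blast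
      moreover have "(\<Sum>w\<in>words S n. s w) = (transfer_op S V ^^ n) f u"
        using HB[OF f] finite_words unfolding s_def
        by (subst transfer_op_pow) (auto simp: bergman_space_def sum.If_cases Int_def intro!: sum.cong)
      ultimately show ?thesis by simp
    qed
    \<comment> \<open>The iterate is fixed by the projection, so projecting the raw expansion term
      by term changes the factors but not the sum.\<close>
    have LH: "(transfer_op S V ^^ n) f \<in> H" using reduced_transfer_op_pow[OF irr V f[unfolded H_def]] by (simp add: H_def)
    have "((\<lambda>i. \<Sum>g\<in>carrier G. isotypic_coeff \<rho> g * (case i of (w, k) \<Rightarrow> taylor w k f * act_on_functions S G act g (word_fun V w k) u))
        has_sum (\<Sum>g\<in>carrier G. isotypic_coeff \<rho> g * act_on_functions S G act g ((transfer_op S V ^^ n) f) u)) I"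
    proof (intro has_sum_finite_sum finite_G has_sum_cmult_right)
      fix g
      show "((\<lambda>i. case i of (w, k) \<Rightarrow> taylor w k f * act_on_functions S G act g (word_fun V w k) u)
        has_sum act_on_functions S G act g ((transfer_op S V ^^ n) f) u) I"
      proof -
        have eq: "(case i of (w, k) \<Rightarrow> taylor w k f * act_on_functions S G act g (word_fun V w k) u)
          = (if u \<in> D then (case i of (w, k) \<Rightarrow> taylor w k f * word_fun V w k (act (inv g) u)) else 0)" for i
          by (cases i) (simp add: act_on_functions_def)
        show ?thesis unfolding eq using raw[of "act (inv g) u"] by (cases "u \<in> D") (simp_all add: act_on_functions_def)
      qed
    qed
    moreover have "(\<Sum>g\<in>carrier G. isotypic_coeff \<rho> g * act_on_functions S G act g ((transfer_op S V ^^ n) f) u) = (transfer_op S V ^^ n) f u"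
      using LH isotypic_space_iff[OF irr] by (simp add: isotypic_proj_apply[symmetric] H_def)
    moreover have "(\<Sum>g\<in>carrier G. isotypic_coeff \<rho> g * (case i of (w, k) \<Rightarrow> taylor w k f * act_on_functions S G act g (word_fun V w k) u))
        = la i f * a i u" for i
      by (simp add: la_def a_def case_prod_beta isotypic_proj_apply sum_distrib_left mult_ac)
    ultimately show ?thesis by simp
  qed
  have "nuclear_op fun_scale H (bergman_inner D) (reduced_transfer_op S G act \<rho> V ^^ n) I la a c"
  proof
    show "countable I" unfolding I_def by (rule countable_SIGMA) (use finite_words in \<open>auto intro: countable_finite\<close>)
    have TL: "(reduced_transfer_op S G act \<rho> V ^^ n) f = (transfer_op S V ^^ n) f" "(transfer_op S V ^^ n) f \<in> H" if "f \<in> H" for f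
      using reduced_transfer_op_pow[OF irr V that[unfolded H_def]] by (auto simp: H_def)
    show "(reduced_transfer_op S G act \<rho> V ^^ n) f \<in> H" if "f \<in> H" for f using TL[OF that] by simp
    show "H.functional (la i)" if "i \<in> I" for i
      using that taylor_functional HB unfolding H.functional_def B.functional_def la_def I_def by (auto; blast)
    show "cmod (la i f) \<le> c i * H.nrm f" if "i \<in> I" "f \<in> H" for i f
      using that rq(5)[OF _ HB[OF that(2)]] by (auto simp: la_def c_def I_def nrm)
    show "0 \<le> c i" if "i \<in> I" for i by (rule c0[OF that])
    show "a i \<in> H" if "i \<in> I" for i by (rule aH[OF that])
    show "(\<lambda>i. c i * H.nrm (a i)) summable_on I"
    proof (rule summable_on_comparison_test)
      show "(\<lambda>i. case i of (w, k) \<Rightarrow> C w / q w ^ k * ((A * sqrt (measure lborel D)) * r w ^ k)) summable_on I"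
        by (rule geo) (use A0 in simp)
      fix i assume i: "i \<in> I"
      obtain w k where wk: "i = (w, k)" "w \<in> words S n" using i by (auto simp: I_def)
      have "H.nrm (a i) \<le> (A * r w ^ k) * sqrt (measure lborel D)"
        unfolding nrm wk(1) using aH[OF i] ab[OF wk(2)] A0 rq(1)[OF wk(2)] wk(1)
        by (intro bergman_nrm_bounded[OF open_D bounded_D HB]) auto
      then have "c i * H.nrm (a i) \<le> c i * ((A * r w ^ k) * sqrt (measure lborel D))"
        using c0[OF i] by (rule mult_left_mono)
      then show "c i * H.nrm (a i) \<le> (case i of (w, k) \<Rightarrow> C w / q w ^ k * ((A * sqrt (measure lborel D)) * r w ^ k))"
        by (simp add: wk(1) c_def mult_ac)
      show "0 \<le> c i * H.nrm (a i)" using c0[OF i] aH[OF i] by simp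
    qed
    fix f h assume f: "f \<in> H" and h: "h \<in> H"
    have "((\<lambda>i. bergman_inner D (fun_scale (la i f) (a i)) h) has_sum bergman_inner D ((transfer_op S V ^^ n) f) h) I"
    proof (rule bergman_inner_has_sum[OF open_D bounded_D])
      show "fun_scale (la i f) (a i) \<in> bergman_space D" if "i \<in> I" for i using HB[OF H.H_scale[OF aH[OF that]]] .
      show "(transfer_op S V ^^ n) f \<in> bergman_space D" using HB TL f by blast
      show "((\<lambda>i. la i f * a i u) has_sum (transfer_op S V ^^ n) f u) I" for u by (rule point[OF f])
      show "(\<lambda>i. case i of (w, k) \<Rightarrow> C w / q w ^ k * ((H.nrm f * A) * r w ^ k)) summable_on I"
        by (rule geo) (use A0 f in simp)
      fix i assume i: "i \<in> I"
      obtain w k where wk: "i = (w, k)" "w \<in> words S n" using i by (auto simp: I_def)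
      show "0 \<le> (case i of (w, k) \<Rightarrow> C w / q w ^ k * ((H.nrm f * A) * r w ^ k))"
        using A0 f rq(1,2,3)[OF wk(2)] by (simp add: wk(1))
      fix u
      have "cmod (la i f) * cmod (a i u) \<le> (C w / q w ^ k * H.nrm f) * (A * r w ^ k)"
        using rq(5)[OF wk(2) HB[OF f], of k] ab[OF wk(2), of k u] rq(1,2,3)[OF wk(2)] f
        unfolding wk(1) la_def by (intro mult_mono) (auto simp: nrm[symmetric])
      then show "cmod (la i f * a i u) \<le> (case i of (w, k) \<Rightarrow> C w / q w ^ k * ((H.nrm f * A) * r w ^ k))"
        by (simp add: wk(1) norm_mult mult_ac)
    qed (rule HB[OF h])
    moreover have "bergman_inner D (fun_scale (la i f) (a i)) h = la i f * bergman_inner D (a i) h" if "i \<in> I" for i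
      by (rule H.ip_scale[OF aH[OF that] h])
    ultimately show "((\<lambda>i. la i f * bergman_inner D (a i) h) has_sum bergman_inner D ((reduced_transfer_op S G act \<rho> V ^^ n) f) h) I"
      unfolding TL(1)[OF f] by (simp cong: has_sum_cong)
  qed
  then show ?thesis unfolding H_def I_def la_def a_def by blast
qed

text \<open>The double series is summed over \<open>k\<close> first, where
  \<open>twisted_trace\<close> applies to each group element. Replacing \<open>g\<close> by its
  inverse then turns the conjugated character into \<open>character \<rho> g\<close> and restores
  \<open>g\<close> in the fixed point terms.\<close>

lemma nuclear_trace_eq:
  fixes \<rho> :: "'g \<Rightarrow> complex^'n^'n"
  assumes irr: "irreducible_unitary_rep G \<rho>"
    and V: "V holomorphic_on ifs_image S" "\<And>z. z \<in> ifs_image S \<Longrightarrow> cmod (V z) \<le> M"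
    and n: "n \<ge> 1"
    and su: "(\<lambda>(w, k). taylor w k (isotypic_proj S G act \<rho> (word_fun V w k))) summable_on (words S n \<times> UNIV)"
  shows "(\<Sum>\<^sub>\<infinity>(w, k)\<in>words S n \<times> UNIV. taylor w k (isotypic_proj S G act \<rho> (word_fun V w k)))
    = of_nat CARD('n) / of_nat (card (carrier G)) *
      (\<Sum>g\<in>carrier G. character \<rho> g * (\<Sum>w\<in>twisted_words S act n g. twisted_term V w g))"
proof -
  define t where "t w g = (if symbol_act S act g (w ! n) = w ! 0 then twisted_term V w g else 0)" for w g
  define s where "s w = (\<Sum>g\<in>carrier G. isotypic_coeff \<rho> g * t w (inv g))" for w
  have inner: "((\<lambda>k. taylor w k (isotypic_proj S G act \<rho> (word_fun V w k))) has_sum s w) UNIV" if w: "w \<in> words S n" for w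
  proof -
    have "taylor w k (isotypic_proj S G act \<rho> (word_fun V w k))
        = (\<Sum>g\<in>carrier G. isotypic_coeff \<rho> g * taylor w k (act_on_functions S G act g (word_fun V w k)))" for k
      unfolding isotypic_proj_eq_sum
      using act_on_functions_bergman[OF _ word_fun_bergman[OF V w n]]
      by (subst B.functional_sum[OF taylor_functional[OF w]])
         (auto simp: B.functional_scale[OF taylor_functional[OF w]])
    moreover have "((\<lambda>k. \<Sum>g\<in>carrier G. isotypic_coeff \<rho> g * taylor w k (act_on_functions S G act g (word_fun V w k))) has_sum s w) UNIV"
      unfolding s_def
    proof (intro has_sum_finite_sum finite_G has_sum_cmult_right)
      fix g assume g: "g \<in> carrier G"
      show "((\<lambda>k. taylor w k (act_on_functions S G act g (word_fun V w k))) has_sum t w (inv g)) UNIV"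
        using twisted_trace[OF V w n, of "inv g"] g by (simp add: t_def)
    qed
    ultimately show ?thesis by simp
  qed
  have "((\<lambda>(w, k). taylor w k (isotypic_proj S G act \<rho> (word_fun V w k))) has_sum
      (\<Sum>\<^sub>\<infinity>(w, k)\<in>words S n \<times> UNIV. taylor w k (isotypic_proj S G act \<rho> (word_fun V w k)))) (words S n \<times> UNIV)"
    using su by (rule has_sum_infsum)
  from has_sum_SigmaD[OF this, of s] inner
  have "(s has_sum (\<Sum>\<^sub>\<infinity>(w, k)\<in>words S n \<times> UNIV. taylor w k (isotypic_proj S G act \<rho> (word_fun V w k)))) (words S n)"
    by simp
  then have "(\<Sum>\<^sub>\<infinity>(w, k)\<in>words S n \<times> UNIV. taylor w k (isotypic_proj S G act \<rho> (word_fun V w k))) = (\<Sum>w\<in>words S n. s w)"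
    using has_sum_finite_iff[OF finite_words] by blast
  also have "\<dots> = (\<Sum>g\<in>carrier G. isotypic_coeff \<rho> g * (\<Sum>w\<in>words S n. t w (inv g)))"
    unfolding s_def by (subst sum.swap) (simp add: sum_distrib_left)
  also have "\<dots> = (\<Sum>g\<in>carrier G. isotypic_coeff \<rho> (inv g) * (\<Sum>w\<in>words S n. t w g))"
    by (rule sum.reindex_bij_witness[where i = "\<lambda>g. inv g" and j = "\<lambda>g. inv g"]) auto
  also have "\<dots> = (\<Sum>g\<in>carrier G. of_nat CARD('n) / of_nat (card (carrier G)) *
      (character \<rho> g * (\<Sum>w\<in>twisted_words S act n g. twisted_term V w g)))"
  proof (intro sum.cong refl)
    fix g assume g: "g \<in> carrier G"
    have "(\<Sum>w\<in>words S n. t w g) = (\<Sum>w\<in>twisted_words S act n g. twisted_term V w g)"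
      unfolding t_def twisted_words_def using finite_words by (subst sum.inter_filter) auto
    moreover have "isotypic_coeff \<rho> (inv g) = of_nat CARD('n) / of_nat (card (carrier G)) * character \<rho> g"
      using character_inv[OF group_G finite_G irr g] by (simp add: isotypic_coeff_def)
    ultimately show "isotypic_coeff \<rho> (inv g) * (\<Sum>w\<in>words S n. t w g) = of_nat CARD('n) / of_nat (card (carrier G)) *
      (character \<rho> g * (\<Sum>w\<in>twisted_words S act n g. twisted_term V w g))" by (simp add: mult.assoc)
  qed
  finally show ?thesis by (simp add: sum_distrib_left)
qed

end

theorem proposition3p3:
  fixes S :: ifs
    and G :: "('g, 'm) monoid_scheme"
    and act :: "'g \<Rightarrow> complex \<Rightarrow> complex"
    and V :: "complex \<Rightarrow> complex"
    and \<rho> :: "'g \<Rightarrow> complex^'n^'n"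
    and n :: nat
  assumes "holomorphic_ifs S"
    and "eventually_contracting S"
    and "symmetry_group S G act"
    and "V holomorphic_on ifs_image S"
    and "bounded (V ` ifs_image S)"
    and "invariant_potential S G act V"
    and "irreducible_unitary_rep G \<rho>"
    and "n \<ge> 1"
  shows "(\<forall>g\<in>carrier G. \<forall>w\<in>twisted_words S act n g. \<exists>!u. is_twisted_fixpoint S act w g u) \<and>
         trace_class_on (bergman_inner (ifs_domain S)) (isotypic_space S G act \<rho>)
           (reduced_transfer_op S G act \<rho> V ^^ n) \<and>
         trace_on (bergman_inner (ifs_domain S)) (isotypic_space S G act \<rho>)
           (reduced_transfer_op S G act \<rho> V ^^ n) =
         of_nat CARD('n) / of_nat (card (carrier G)) *
           (\<Sum>g\<in>carrier G. character \<rho> g *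
              (\<Sum>w\<in>twisted_words S act n g.
                 let u = twisted_fixpoint S act w g
                 in word_weight S V w (act g u) / (1 - deriv (word_map S w \<circ> act g) u)))"
proof -
  interpret I: ifs_symmetry S G act using assms(1,3) by unfold_locales
  obtain M where M: "\<And>z. z \<in> ifs_image S \<Longrightarrow> cmod (V z) \<le> M" using assms(5) by (auto simp: bounded_iff)
  define ip where "ip = bergman_inner (ifs_domain S)"
  define H where "H = isotypic_space S G act \<rho>"
  define T where "T = reduced_transfer_op S G act \<rho> V ^^ n"
  obtain c where nuc: "nuclear_op fun_scale H ip T (words S n \<times> UNIV) (\<lambda>(w, k). I.taylor w k)
      (\<lambda>(w, k). isotypic_proj S G act \<rho> (I.word_fun V w k)) c"
    using I.reduced_transfer_op_nuclear[OF assms(7,4) M assms(6,8)] unfolding H_def ip_def T_def by blast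
  interpret T: nuclear_op fun_scale H ip T "words S n \<times> UNIV" "\<lambda>(w, k). I.taylor w k"
    "\<lambda>(w, k). isotypic_proj S G act \<rho> (I.word_fun V w k)" c by (rule nuc)
  have onb: "orthonormal_basis_of ip H E \<longleftrightarrow> T.onb E" for E
    unfolding orthonormal_basis_of_def T.onb_def T.orthonormal_def zero_fun_def by auto
  \<comment> \<open>\<open>bounded_op_on\<close> speaks of pointwise linear combinations; this
    translation is applied both to \<open>T\<close> and to its absolute value
    \<open>P\<close>.\<close>
  have bounded_op: "bounded_op_on ip H Q"
    if "\<And>x. x \<in> H \<Longrightarrow> Q x \<in> H" "\<And>x y. x \<in> H \<Longrightarrow> y \<in> H \<Longrightarrow> Q (x + y) = Q x + Q y"
      "\<And>b x. x \<in> H \<Longrightarrow> Q (fun_scale b x) = fun_scale b (Q x)" "\<And>x. x \<in> H \<Longrightarrow> T.nrm (Q x) \<le> T.B * T.nrm x" for Q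
  proof -
    have "Q (\<lambda>u. a * f u + b * h u) = (\<lambda>u. a * Q f u + b * Q h u)" if "f \<in> H" "h \<in> H" for f h a b
      using \<open>\<And>x y. x \<in> H \<Longrightarrow> y \<in> H \<Longrightarrow> Q (x + y) = Q x + Q y\<close>[OF T.H_scale[OF that(1), of a] T.H_scale[OF that(2), of b]]
        \<open>\<And>b x. x \<in> H \<Longrightarrow> Q (fun_scale b x) = fun_scale b (Q x)\<close> that
      by (simp add: plus_fun_def)
    then show ?thesis unfolding bounded_op_on_def using that(1,4) unfolding T.nrm_def by blast
  qed
  obtain P E where P: "\<And>x. x \<in> H \<Longrightarrow> P x \<in> H" "\<And>x y. x \<in> H \<Longrightarrow> y \<in> H \<Longrightarrow> P (x + y) = P x + P y"
    "\<And>b x. x \<in> H \<Longrightarrow> P (fun_scale b x) = fun_scale b (P x)" "\<And>x. x \<in> H \<Longrightarrow> T.nrm (P x) \<le> T.B * T.nrm x"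
    "\<And>x. x \<in> H \<Longrightarrow> Im (ip (P x) x) = 0 \<and> 0 \<le> Re (ip (P x) x)"
    "\<And>x y. x \<in> H \<Longrightarrow> y \<in> H \<Longrightarrow> ip (P (P x)) y = ip (T x) (T y)"
    and E: "T.onb E" "(\<lambda>e. ip (P e) e) summable_on E"
    by (rule T.abs_op_exists) (rule that)
  have tc: "trace_class_on ip H T"
    unfolding trace_class_on_def is_abs_op_on_def onb
    using bounded_op[OF T.T_H T.T_add T.T_scale T.nrm_T_le] bounded_op[OF P(1-4)] P(5,6) E by blast
  define t where "t = (\<Sum>\<^sub>\<infinity>i\<in>words S n \<times> UNIV. (\<lambda>(w, k). I.taylor w k) i ((\<lambda>(w, k). isotypic_proj S G act \<rho> (I.word_fun V w k)) i))"
  have hs: "\<forall>E. orthonormal_basis_of ip H E \<longrightarrow> ((\<lambda>e. ip (T e) e) has_sum t) E"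
    unfolding onb t_def using T.trace_has_sum by blast
  have tr: "trace_on ip H T = t"
    unfolding trace_on_def
  proof (rule the_equality)
    show "\<forall>E. orthonormal_basis_of ip H E \<longrightarrow> ((\<lambda>e. ip (T e) e) has_sum t) E" by (rule hs)
    \<comment> \<open>Uniqueness of the value requires that some orthonormal basis exists, and
      \<open>E\<close> is one.\<close>
    fix t' assume "\<forall>E. orthonormal_basis_of ip H E \<longrightarrow> ((\<lambda>e. ip (T e) e) has_sum t') E"
    then show "t' = t" using hs E(1) onb has_sum_unique by blast
  qed
  \<comment> \<open>The bound of the \<open>i\<close>-th functional, taken at the vector
    \<open>a i\<close> itself, is a term of the summable majorant of the nuclear
    representation.\<close>
  have su: "(\<lambda>(w, k). I.taylor w k (isotypic_proj S G act \<rho> (I.word_fun V w k))) summable_on (words S n \<times> UNIV)"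
  proof (rule abs_summable_summable, rule summable_on_comparison_test[OF T.summable_ca])
    fix i :: "nat list \<times> nat" assume i: "i \<in> words S n \<times> UNIV"
    show "norm (case i of (w, k) \<Rightarrow> I.taylor w k (isotypic_proj S G act \<rho> (I.word_fun V w k)))
        \<le> c i * T.nrm (case i of (w, k) \<Rightarrow> isotypic_proj S G act \<rho> (I.word_fun V w k))"
      using T.la_bound[OF i T.a_H[OF i]] by (simp add: case_prod_beta)
  qed auto
  have "t = of_nat CARD('n) / of_nat (card (carrier G)) *
      (\<Sum>g\<in>carrier G. character \<rho> g * (\<Sum>w\<in>twisted_words S act n g. I.twisted_term V w g))"
  proof -
    have "t = (\<Sum>\<^sub>\<infinity>(w, k)\<in>words S n \<times> UNIV. I.taylor w k (isotypic_proj S G act \<rho> (I.word_fun V w k)))"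
      unfolding t_def by (rule infsum_cong) auto
    then show ?thesis using I.nuclear_trace_eq[OF assms(7,4) M assms(8) su] by simp
  qed
  moreover have "\<exists>!u. is_twisted_fixpoint S act w g u" if "g \<in> carrier G" "w \<in> twisted_words S act n g" for g w
    using that I.twisted_fixpoint_unique[OF _ assms(8)] by (auto simp: twisted_words_def)
  ultimately show ?thesis
    using tc tr unfolding ip_def H_def T_def I.twisted_term_def by blast
qed

end
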